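(* Let $n\ge2$ and $0<H<\frac{n-1}{n}$. There exists a complete translation hypersurface $\mathcal{T}_H$ in $\mathbb{H}^n\times\mathbb{R}$, of constant mean curvature $H$, such that: 1. $\mathcal{T}_H$ is a complete monotone vertical $H$-graph over the non-mean-convex side of an equidistant hypersurface $\Gamma\subset\mathbb{H}^n$ with mean curvature $\frac{nH}{n-1}$; 2. $\mathcal{T}_H$ takes infinite boundary value data on $\Gamma$ and infinite asymptotic boundary data.
   Context: $\mathbb{H}^n$ is the hyperbolic space in the unit ball model with metric $4(1-|x|^2)^{-2}(dx_1^2+\cdots+dx_n^2)$, and $\mathbb{H}^n\times\mathbb{R}$ carries the product metric with $dt^2$. Mean curvatures are normalized (averages of principal curvatures); the mean curvature of $\mathcal{T}_H$ is taken with respect to the unit normal pointing upwards. Translation hypersurfaces: let $\gamma$ be a geodesic through $0$ in $\mathbb{H}^n$, $\rho$ the signed hyperbolic distance to $0$ on $\gamma$, $\mathbb{V}=\gamma\times\mathbb{R}$, and $\mathbb{P}$ the totally geodesic hyperplane of $\mathbb{H}^n$ orthogonal to $\gamma$ at $0$. A curve $t=\mu(\rho)$ in $\mathbb{V}$ generates a translation hypersurface: in each slice $\mathbb{H}^n\times\{\mu(\rho)\}$ the point of the curve is moved by the hyperbolic translations along the geodesics through $0$ in $\mathbb{P}$ and sweeps out the equidistant hypersurface at signed distance $\rho$ from $\mathbb{P}$. An equidistant hypersurface $\Gamma$ is the set of points at a fixed signed distance from a totally geodesic hyperplane (here $\mathbb{P}$); its non-mean-convex side is the connected component of $\mathbb{H}^n\setminus\Gamma$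 into which the mean curvature vector of $\Gamma$ does not point. A vertical $H$-graph is the graph of a function $u$ on a domain of $\mathbb{H}^n$ with constant mean curvature $H$; monotone means that $u=\mu(\rho)$ is a strictly monotone function of the signed distance $\rho$ to $\mathbb{P}$. Infinite boundary value data on $\Gamma$ means that $u$ tends to infinity in absolute value at $\Gamma$; infinite asymptotic boundary data means that $u$ tends to infinity in absolute value at the points of the asymptotic boundary of the domain lying in $\partial_\infty\mathbb{H}^n\setminus\partial_\infty\Gamma$, i.e. as $\rho\to\infty$. *)

theory Defs
  imports "HOL-Analysis.Analysis"
begin

section \<open>Riemannian metrics on open subsets of a Euclidean space\<close>

text \<open>A metric is given in global coordinates: \<open>g p v w\<close> is the inner product at the point \<open>p\<close>
  of the tangent vectors \<open>v\<close> and \<open>w\<close>.\<close>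

type_synonym 'a riem_metric = "'a \<Rightarrow> 'a \<Rightarrow> 'a \<Rightarrow> real"

text \<open>Christoffel symbols of the Levi-Civita connection (Koszul formula for constant fields):
  the covariant derivative of a field \<open>Y\<close> in direction \<open>v\<close> at \<open>p\<close> is
  \<open>DY p v + christoffel g p v (Y p)\<close>.\<close>

definition christoffel :: "'a::euclidean_space riem_metric \<Rightarrow> 'a \<Rightarrow> 'a \<Rightarrow> 'a \<Rightarrow> 'a" where
  "christoffel g p v w = (THE z. \<forall>y. g p z y =
     (frechet_derivative (\<lambda>q. g q w y) (at p) v
    + frechet_derivative (\<lambda>q. g q v y) (at p) w
    - frechet_derivative (\<lambda>q. g q v w) (at p) y) / 2)"

definition unit_speed_geodesic :: "'a::euclidean_space riem_metric \<Rightarrow> 'a set \<Rightarrow> (real \<Rightarrow> 'a) \<Rightarrow> bool" where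
  "unit_speed_geodesic g U \<gamma> \<longleftrightarrow> (\<exists>\<gamma>'. \<forall>s. \<gamma> s \<in> U
     \<and> (\<gamma> has_vector_derivative \<gamma>' s) (at s)
     \<and> g (\<gamma> s) (\<gamma>' s) (\<gamma>' s) = 1
     \<and> (\<gamma>' has_vector_derivative - christoffel g (\<gamma> s) (\<gamma>' s) (\<gamma>' s)) (at s))"

text \<open>Infimum of the lengths of the rectifiable piecewise \<open>C\<^sup>1\<close> curves inside \<open>S\<close>. If \<open>S\<close> is open this
  is the Riemannian distance of \<open>S\<close>; if \<open>S\<close> is a hypersurface it is the distance of the induced
  metric. The speed of a \<open>valid_path\<close> need not be integrable, hence \<open>has_integral\<close>. Points that
  cannot be joined in \<open>S\<close> get the dummy value 0.\<close>

definition curve_lengths :: "'a::euclidean_space riem_metric \<Rightarrow> 'a set \<Rightarrow> 'a \<Rightarrow> 'a \<Rightarrow> real set" where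
  "curve_lengths g S p q = {L. \<exists>c. valid_path c \<and> path_image c \<subseteq> S
     \<and> pathstart c = p \<and> pathfinish c = q
     \<and> ((\<lambda>s. sqrt (g (c s) (vector_derivative c (at s within {0..1}))
                           (vector_derivative c (at s within {0..1})))) has_integral L) {0..1}}"

definition riem_dist :: "'a::euclidean_space riem_metric \<Rightarrow> 'a set \<Rightarrow> 'a \<Rightarrow> 'a \<Rightarrow> real" where
  "riem_dist g S p q = (if curve_lengths g S p q = {} then 0 else Inf (curve_lengths g S p q))"

text \<open>\<open>Metric_space\<close> fails for a set that is not connected by such curves, because of the dummy
  value in \<open>riem_dist\<close>.\<close>

definition complete_induced_metric :: "'a::euclidean_space riem_metric \<Rightarrow> 'a set \<Rightarrow> bool" where
  "complete_induced_metric g S \<longleftrightarrow>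
     Metric_space S (riem_dist g S) \<and> Metric_space.mcomplete S (riem_dist g S)"


section \<open>Hypersurfaces and their mean curvature\<close>

fun Ck_on :: "nat \<Rightarrow> ('a::euclidean_space \<Rightarrow> real) \<Rightarrow> 'a set \<Rightarrow> bool" where
  "Ck_on 0 f U \<longleftrightarrow> continuous_on U f"
| "Ck_on (Suc k) f U \<longleftrightarrow> (\<forall>x\<in>U. f differentiable (at x))
     \<and> (\<forall>v. Ck_on k (\<lambda>x. frechet_derivative f (at x) v) U)"

definition smooth_on :: "('a::euclidean_space \<Rightarrow> real) \<Rightarrow> 'a set \<Rightarrow> bool" where
  "smooth_on f U \<longleftrightarrow> (\<forall>k. Ck_on k f U)"

definition smooth_hypersurface :: "'a::euclidean_space set \<Rightarrow> bool" where
  "smooth_hypersurface S \<longleftrightarrow> (\<forall>p\<in>S. \<exists>V \<phi>. open V \<and> p \<in> V \<and> smooth_on \<phi> V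
     \<and> (\<forall>x\<in>V. frechet_derivative \<phi> (at x) \<noteq> (\<lambda>v. 0))
     \<and> S \<inter> V = {x \<in> V. \<phi> x = 0})"

definition tangent_space :: "'a::euclidean_space set \<Rightarrow> 'a \<Rightarrow> 'a set" where
  "tangent_space S p = {v. \<exists>c \<delta>. \<delta> > 0 \<and> c 0 = p \<and> (\<forall>s. \<bar>s\<bar> < \<delta> \<longrightarrow> c s \<in> S)
     \<and> (c has_vector_derivative v) (at (0::real))}"

definition unit_normal_field :: "'a::euclidean_space riem_metric \<Rightarrow> 'a set \<Rightarrow> ('a \<Rightarrow> 'a) \<Rightarrow> bool" where
  "unit_normal_field g S \<nu> \<longleftrightarrow>
     (\<forall>p\<in>S. g p (\<nu> p) (\<nu> p) = 1 \<and> (\<forall>v\<in>tangent_space S p. g p (\<nu> p) v = 0))"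

text \<open>\<open>h\<close> is the average of the principal curvatures of \<open>S\<close> at \<open>p\<close> with respect to the unit normal
  \<open>\<nu>\<close>: there is an orthonormal basis \<open>B\<close> of the tangent space with \<open>\<nabla>\<^sub>e \<nu> = - \<kappa> e *\<^sub>R e\<close>. The
  derivative of \<open>\<nu>\<close> within \<open>S\<close> is only determined on tangent vectors.\<close>

definition has_mean_curvature_at ::
    "'a::euclidean_space riem_metric \<Rightarrow> 'a set \<Rightarrow> ('a \<Rightarrow> 'a) \<Rightarrow> 'a \<Rightarrow> real \<Rightarrow> bool" where
  "has_mean_curvature_at g S \<nu> p h \<longleftrightarrow> (\<exists>A B \<kappa>.
     (\<nu> has_derivative A) (at p within S)
     \<and> finite B \<and> card B = DIM('a) - 1 \<and> B \<subseteq> tangent_space S p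
     \<and> (\<forall>e\<in>B. \<forall>f\<in>B. g p e f = (if e = f then 1 else 0))
     \<and> (\<forall>e\<in>B. A e + christoffel g p e (\<nu> p) = - (\<kappa> e *\<^sub>R e))
     \<and> h = (\<Sum>e\<in>B. \<kappa> e) / real (card B))"

definition has_constant_mean_curvature ::
    "'a::euclidean_space riem_metric \<Rightarrow> 'a set \<Rightarrow> ('a \<Rightarrow> 'a) \<Rightarrow> real \<Rightarrow> bool" where
  "has_constant_mean_curvature g S \<nu> h \<longleftrightarrow>
     unit_normal_field g S \<nu> \<and> (\<forall>p\<in>S. has_mean_curvature_at g S \<nu> p h)"


section \<open>The spaces \<open>\<H>\<^sup>n\<close> and \<open>\<H>\<^sup>n \<times> \<real>\<close>\<close>

abbreviation hyp :: "(real ^ 'n) set" where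
  "hyp \<equiv> ball 0 1"

definition hyp_metric :: "(real ^ 'n) riem_metric" where
  "hyp_metric x v w = 4 / (1 - (norm x)\<^sup>2)\<^sup>2 * (v \<bullet> w)"

definition hyp_prod_metric :: "((real ^ 'n) \<times> real) riem_metric" where
  "hyp_prod_metric p v w = hyp_metric (fst p) (fst v) (fst w) + snd v * snd w"

definition hyp_dist :: "real ^ 'n \<Rightarrow> real ^ 'n \<Rightarrow> real" where
  "hyp_dist = riem_dist hyp_metric hyp"

definition geodesic_through_0 :: "(real \<Rightarrow> real ^ 'n) \<Rightarrow> bool" where
  "geodesic_through_0 \<gamma> \<longleftrightarrow> unit_speed_geodesic hyp_metric hyp \<gamma> \<and> \<gamma> 0 = 0"

text \<open>The totally geodesic hyperplane orthogonal to \<open>\<gamma>\<close> at 0, as the union of the geodesics leaving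
  0 orthogonally to \<open>\<gamma>\<close>.\<close>

definition orth_hyperplane :: "(real \<Rightarrow> real ^ 'n) \<Rightarrow> (real ^ 'n) set" where
  "orth_hyperplane \<gamma> = {\<sigma> s | \<sigma> s. geodesic_through_0 \<sigma>
     \<and> hyp_metric 0 (vector_derivative \<sigma> (at 0)) (vector_derivative \<gamma> (at 0)) = 0}"

text \<open>Signed distance to this hyperplane, positive on the side of \<open>\<gamma> s\<close> with \<open>s > 0\<close>.\<close>

definition signed_dist :: "(real \<Rightarrow> real ^ 'n) \<Rightarrow> real ^ 'n \<Rightarrow> real" where
  "signed_dist \<gamma> x =
     (if connected_component (hyp - orth_hyperplane \<gamma>) (\<gamma> 1) x then 1 else - 1)
     * (INF y\<in>orth_hyperplane \<gamma>. hyp_dist x y)"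

definition equidistant :: "(real \<Rightarrow> real ^ 'n) \<Rightarrow> real \<Rightarrow> (real ^ 'n) set" where
  "equidistant \<gamma> a = {x \<in> hyp. signed_dist \<gamma> x = a}"

text \<open>The hyperbolic translation of the ball along the geodesic through 0 and \<open>b\<close> which takes 0
  to \<open>b\<close> (Moebius addition of \<open>b\<close>).\<close>

definition hyp_translation :: "real ^ 'n \<Rightarrow> real ^ 'n \<Rightarrow> real ^ 'n" where
  "hyp_translation b x =
     (1 / (1 + 2 * (b \<bullet> x) + (norm b)\<^sup>2 * (norm x)\<^sup>2)) *\<^sub>R
     ((1 + 2 * (b \<bullet> x) + (norm x)\<^sup>2) *\<^sub>R b + (1 - (norm b)\<^sup>2) *\<^sub>R x)"

text \<open>The curve \<open>t = \<mu> \<rho>\<close>, \<open>\<rho> \<in> I\<close>, in \<open>\<gamma> \<times> \<real>\<close> is \<open>\<rho> \<mapsto> (\<gamma> \<rho>, \<mu> \<rho>)\<close>, because \<open>\<gamma>\<close> has unit speed.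
  A translation along a geodesic through 0 in the hyperplane is determined by the image \<open>b\<close> of 0.\<close>

definition translation_hypersurface ::
    "(real \<Rightarrow> real ^ 'n) \<Rightarrow> real set \<Rightarrow> (real \<Rightarrow> real) \<Rightarrow> ((real ^ 'n) \<times> real) set" where
  "translation_hypersurface \<gamma> I \<mu> =
     {(hyp_translation b (\<gamma> \<rho>), \<mu> \<rho>) | b \<rho>. b \<in> orth_hyperplane \<gamma> \<and> \<rho> \<in> I}"

definition points_into :: "'a::real_normed_vector \<Rightarrow> 'a \<Rightarrow> 'a set \<Rightarrow> bool" where
  "points_into p v C \<longleftrightarrow> (\<forall>\<^sub>F s in at_right (0::real). p + s *\<^sub>R v \<in> C)"

text \<open>The mean curvature vector \<open>h p *\<^sub>R \<xi> p\<close> does not depend on the choice of the unit normal.\<close>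

definition non_mean_convex_side :: "(real ^ 'n) set \<Rightarrow> (real ^ 'n) set \<Rightarrow> bool" where
  "non_mean_convex_side S C \<longleftrightarrow> C \<in> components (hyp - S)
     \<and> (\<exists>\<xi> h. unit_normal_field hyp_metric S \<xi>
          \<and> (\<forall>p\<in>S. has_mean_curvature_at hyp_metric S \<xi> p (h p)
                 \<and> \<not> points_into p (h p *\<^sub>R \<xi> p) C))"

definition asymptotic_boundary :: "(real ^ 'n) set \<Rightarrow> (real ^ 'n) set" where
  "asymptotic_boundary A = closure A \<inter> sphere 0 1"

definition graph_over :: "'a set \<Rightarrow> ('a \<Rightarrow> real) \<Rightarrow> ('a \<times> real) set" where
  "graph_over D u = {(x, u x) | x. x \<in> D}"

definition strictly_monotone_on :: "real set \<Rightarrow> (real \<Rightarrow> real) \<Rightarrow> bool" where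
  "strictly_monotone_on I f \<longleftrightarrow> strict_mono_on I f \<or> monotone_on I (<) (>) f"

end

theory Submission
  imports Defs
begin

text \<open>
  Let \<open>e\<close> be the direction of the geodesic at the origin and \<open>P\<close> the hyperplane orthogonal to it. The
  function \<open>hyp_height e\<close>, the coordinate along \<open>e\<close> in the hyperboloid model, vanishes on \<open>P\<close>, its
  Hessian is the height times the metric (\<open>height_hessian\<close>) and its gradient has squared length
  \<open>1 + height\<^sup>2\<close> (\<open>height_grad_norm\<close>). So \<open>\<rho> = arsinh height\<close> has a gradient of length 1. It is the signed
  distance to \<open>P\<close> (\<open>signed_dist_radial\<close>), and the equidistant hypersurface at distance \<open>\<rho>\<close> has all its
  principal curvatures equal to \<open>tanh \<rho>\<close> with respect to \<open>- grad \<rho>\<close> (\<open>equidistant_mean_curvature\<close>). Every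
  level of \<open>\<rho>\<close> is swept out from its point on the geodesic by the translations along \<open>P\<close>, hence a
  translation hypersurface is the graph of a function \<open>u = \<mu>(\<rho>)\<close>
  (\<open>translation_hypersurface_eq_graph\<close>).

  Put \<open>q = \<mu>' / sqrt (1 + \<mu>'\<^sup>2)\<close>. The principal curvatures of the graph with respect to the upward normal
  are \<open>q'\<close> in the direction of the generating curve and \<open>q tanh \<rho>\<close> in the other \<open>n - 1\<close> directions
  (\<open>mean_curvature_T\<close>). The mean curvature is therefore \<open>H\<close> if and only if
  \<open>q' + (n - 1) q tanh \<rho> = n H\<close>, a linear equation of first order. Write \<open>n H = (n - 1) tanh a\<close> with
  \<open>a > 0\<close>, which the bound on \<open>H\<close> allows, and take the solution with \<open>q(a) = 1\<close>. Then \<open>q'(a) = 0\<close>, so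
  \<open>1 - q\<close> vanishes to second order at \<open>a\<close>, and \<open>tanh a \<le> q < 1\<close> on the right of \<open>a\<close>
  (\<open>sine_profile_exists\<close>). Hence \<open>\<mu>' = q / sqrt (1 - q\<^sup>2)\<close> is at least a positive multiple of
  \<open>1 / (\<rho> - a)\<close>, and integration gives \<open>\<mu> \<rightarrow> - \<infinity>\<close> at \<open>a\<close> and \<open>\<mu> \<rightarrow> \<infinity>\<close> at infinity
  (\<open>profile_exists\<close>). The hypersurface \<open>\<rho> = a\<close> has mean curvature \<open>tanh a = n H / (n - 1)\<close> and its
  mean curvature vector points to the side of \<open>P\<close>, away from the domain \<open>\<rho> > a\<close>
  (\<open>non_mean_convex_side_equidistant\<close>).

  For completeness (\<open>complete_T\<close>), lengths on the graph dominate Euclidean distances, the variation of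
  \<open>- ln (1 - |x|\<^sup>2)\<close> and the variation of \<open>t\<close>. A Cauchy sequence thus has a Euclidean limit, which is
  not on the boundary sphere, and not over \<open>\<rho> = a\<close> because \<open>t\<close> would tend to \<open>- \<infinity>\<close>; so it lies on the
  graph. There Euclidean convergence implies convergence in the induced metric, because graphs over
  short segments are short.
\<close>


section \<open>Functions of class C^k\<close>

lemma frechet_derivative_cong_open:
  fixes f g :: "'a::euclidean_space \<Rightarrow> real"
  assumes "open U" "x \<in> U" "\<And>y. y \<in> U \<Longrightarrow> f y = g y"
  shows "frechet_derivative f (at x) = frechet_derivative g (at x)"
    and "f differentiable (at x) \<longleftrightarrow> g differentiable (at x)"
proof -
  have "(f has_derivative D) (at x) \<longleftrightarrow> (g has_derivative D) (at x)" for D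
    using has_derivative_transform_within_open[OF _ assms(1,2), of f D UNIV g]
      has_derivative_transform_within_open[OF _ assms(1,2), of g D UNIV f] assms(3) by fastforce
  then show "frechet_derivative f (at x) = frechet_derivative g (at x)"
    and "f differentiable (at x) \<longleftrightarrow> g differentiable (at x)"
    by (simp_all add: frechet_derivative_def differentiable_def)
qed

lemma Ck_on_cong:
  fixes f g :: "'a::euclidean_space \<Rightarrow> real"
  assumes "open U" "\<And>x. x \<in> U \<Longrightarrow> f x = g x"
  shows "Ck_on k f U \<longleftrightarrow> Ck_on k g U"
  using assms(2)
proof (induction k arbitrary: f g)
  case 0
  then show ?case by (auto intro: continuous_on_cong)
next
  case (Suc k)
  have "Ck_on k (\<lambda>x. frechet_derivative f (at x) v) U \<longleftrightarrow>
      Ck_on k (\<lambda>x. frechet_derivative g (at x) v) U" for v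
    by (intro Suc.IH) (use frechet_derivative_cong_open(1)[OF assms(1) _ Suc.prems] in auto)
  then show ?case
    using frechet_derivative_cong_open(2)[OF assms(1) _ Suc.prems] by auto
qed

lemma Ck_on_SucD: "Ck_on (Suc k) f U \<Longrightarrow> Ck_on k f U"
proof (induction k arbitrary: f)
  case 0
  then show ?case
    by (simp add: differentiable_imp_continuous_on differentiable_at_imp_differentiable_on)
next
  case (Suc k)
  show ?case
    unfolding Ck_on.simps(2)[of k]
    using Suc.prems Suc.IH unfolding Ck_on.simps(2)[of "Suc k"] by blast
qed

text \<open>The recursion for \<open>Ck_on\<close> speaks of \<open>frechet_derivative\<close>, a choice term. This form allows explicit
  derivatives instead.\<close>

lemma Ck_on_SucI:
  assumes "open U" "\<And>x. x \<in> U \<Longrightarrow> (f has_derivative f' x) (at x)"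
    and "\<And>v. Ck_on k (\<lambda>x. f' x v) U"
  shows "Ck_on (Suc k) f U"
proof -
  have fr: "frechet_derivative f (at x) = f' x" if "x \<in> U" for x
    using frechet_derivative_at[OF assms(2)[OF that]] by simp
  have "Ck_on k (\<lambda>x. frechet_derivative f (at x) v) U" for v
    using Ck_on_cong[OF assms(1), of "\<lambda>x. frechet_derivative f (at x) v" "\<lambda>x. f' x v"]
      fr assms(3) by simp
  then show ?thesis
    using assms(2) by (auto simp: differentiable_def)
qed

lemma Ck_on_SucE:
  assumes "Ck_on (Suc k) f U" "x \<in> U"
  shows "(f has_derivative frechet_derivative f (at x)) (at x)"
  using assms by (simp add: frechet_derivative_works)

lemma Ck_on_subset: "Ck_on k f U \<Longrightarrow> V \<subseteq> U \<Longrightarrow> Ck_on k f V"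
  by (induction k arbitrary: f) (auto intro: continuous_on_subset)

lemma Ck_on_const: "open U \<Longrightarrow> Ck_on k (\<lambda>x. c) U"
proof (induction k arbitrary: c)
  case (Suc k)
  show ?case
    by (rule Ck_on_SucI[where f' = "\<lambda>_ _. 0"]) (use Suc in auto)
qed simp

lemma Ck_on_linear: 
  assumes "open U" "bounded_linear f"
  shows "Ck_on k f U"
proof (cases k)
  case 0
  then show ?thesis using assms by (simp add: linear_continuous_on)
next
  case (Suc j)
  show ?thesis unfolding Suc
    by (rule Ck_on_SucI[where f' = "\<lambda>_. f"])
      (use assms Ck_on_const in \<open>auto intro: bounded_linear_imp_has_derivative\<close>)
qed

lemma Ck_on_add:
  assumes "open U" "Ck_on k f U" "Ck_on k g U"
  shows "Ck_on k (\<lambda>x. f x + g x) U"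
  using assms(2,3)
proof (induction k arbitrary: f g)
  case 0
  then show ?case by (simp add: continuous_on_add)
next
  case (Suc k)
  show ?case
  proof (rule Ck_on_SucI[OF assms(1) has_derivative_add])
    fix v
    show "Ck_on k (\<lambda>x. frechet_derivative f (at x) v + frechet_derivative g (at x) v) U"
      using Suc.prems by (intro Suc.IH) auto
  qed (rule Ck_on_SucE[OF Suc.prems(1)] Ck_on_SucE[OF Suc.prems(2)]; assumption)+
qed

lemma Ck_on_mult:
  assumes "open U" "Ck_on k f U" "Ck_on k g U"
  shows "Ck_on k (\<lambda>x. f x * g x) U"
  using assms(2,3)
proof (induction k arbitrary: f g)
  case 0
  then show ?case by (simp add: continuous_on_mult)
next
  case (Suc k)
  show ?case
  proof (rule Ck_on_SucI[OF assms(1) has_derivative_mult])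
    fix v
    show "Ck_on k (\<lambda>x. f x * frechet_derivative g (at x) v + frechet_derivative f (at x) v * g x) U"
      by (intro Ck_on_add[OF assms(1)] Suc.IH Suc.prems[THEN Ck_on_SucD])
        (use Suc.prems in simp_all)
  qed (rule Ck_on_SucE[OF Suc.prems(1)] Ck_on_SucE[OF Suc.prems(2)]; assumption)+
qed

lemma Ck_on_uminus: "open U \<Longrightarrow> Ck_on k f U \<Longrightarrow> Ck_on k (\<lambda>x. - f x) U"
  using Ck_on_mult[OF _ Ck_on_const[of U k "-1"]] by simp

lemma Ck_on_diff: "open U \<Longrightarrow> Ck_on k f U \<Longrightarrow> Ck_on k g U \<Longrightarrow> Ck_on k (\<lambda>x. f x - g x) U"
  using Ck_on_add[OF _ _ Ck_on_uminus] by simp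

text \<open>Lifts functions from the base to the product along the projection.\<close>

lemma Ck_on_compose_linear:
  assumes "bounded_linear L" "open U" "Ck_on k f U"
  shows "Ck_on k (\<lambda>x. f (L x)) (L -` U)"
  using assms(3)
proof (induction k arbitrary: f)
  case 0
  then show ?case
    using continuous_on_compose2[of U f "L -` U" L] linear_continuous_on[OF assms(1)] by auto
next
  case (Suc k)
  have op: "open (L -` U)"
    using assms linear_continuous_on[OF assms(1)]
    by (metis open_vimage linear_continuous_on)
  show ?case
  proof (rule Ck_on_SucI[OF op, where f' = "\<lambda>x v. frechet_derivative f (at (L x)) (L v)"])
    fix x assume "x \<in> L -` U"
    then show "((\<lambda>x. f (L x)) has_derivative (\<lambda>v. frechet_derivative f (at (L x)) (L v))) (at x)"
      using has_derivative_compose[OF bounded_linear_imp_has_derivative[OF assms(1)] 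
          Ck_on_SucE[OF Suc.prems]] by simp
  next
    fix v
    show "Ck_on k (\<lambda>x. frechet_derivative f (at (L x)) (L v)) (L -` U)"
      by (rule Suc.IH) (use Suc.prems in simp)
  qed
qed

lemma Ck_on_compose:
  fixes h :: "real \<Rightarrow> real"
  assumes "open U" "open I" "Ck_on k h I" "Ck_on k f U" "\<And>x. x \<in> U \<Longrightarrow> f x \<in> I"
  shows "Ck_on k (\<lambda>x. h (f x)) U"
  using assms(3,4)
proof (induction k arbitrary: h)
  case 0
  then show ?case using assms(5) continuous_on_compose2[of I h U f] by auto
next
  case (Suc k)
  show ?case
  proof (rule Ck_on_SucI[OF assms(1), where f' = "\<lambda>x v. frechet_derivative h (at (f x)) 1 * frechet_derivative f (at x) v"])
    fix x assume x: "x \<in> U"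
    have hd: "((\<lambda>x. h (f x)) has_derivative (\<lambda>v. frechet_derivative h (at (f x)) (frechet_derivative f (at x) v))) (at x)"
      using has_derivative_compose[OF Ck_on_SucE[OF Suc.prems(2) x] Ck_on_SucE[OF Suc.prems(1) assms(5)[OF x]]] .
    have "frechet_derivative h (at (f x)) y = frechet_derivative h (at (f x)) 1 * y" for y
      using linear_cmul[OF has_derivative_linear[OF Ck_on_SucE[OF Suc.prems(1) assms(5)[OF x]]], of y 1]
      by (simp add: mult.commute[of y])
    then show "((\<lambda>x. h (f x)) has_derivative (\<lambda>v. frechet_derivative h (at (f x)) 1 * frechet_derivative f (at x) v)) (at x)"
      by (intro has_derivative_eq_rhs[OF hd] ext) 
  next
    fix v
    have "Ck_on k (\<lambda>x. frechet_derivative h (at (f x)) 1) U"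
      using Suc.prems(1) by (intro Suc.IH[of "\<lambda>y. frechet_derivative h (at y) 1"] Ck_on_SucD[OF Suc.prems(2)]) simp
    then show "Ck_on k (\<lambda>x. frechet_derivative h (at (f x)) 1 * frechet_derivative f (at x) v) U"
      using Suc.prems(2) by (intro Ck_on_mult[OF assms(1)]) simp_all
  qed
qed

text \<open>Functions that solve a differential equation, such as \<open>tanh\<close> below and the profile curve later, get
  one more derivative from the equation itself; this is the induction step of that bootstrap.\<close>

lemma Ck_on_real_SucI:
  fixes h :: "real \<Rightarrow> real"
  assumes "open I" "\<And>x. x \<in> I \<Longrightarrow> (h has_real_derivative h' x) (at x)" "Ck_on k h' I"
  shows "Ck_on (Suc k) h I"
proof (rule Ck_on_SucI[OF assms(1), where f' = "\<lambda>x v. h' x * v"])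
  show "Ck_on k (\<lambda>x. h' x * v) I" for v
    using Ck_on_mult[OF assms(1,3) Ck_on_const[OF assms(1)]] .
qed (rule assms(2)[unfolded has_field_derivative_def])

lemma Ck_on_powr: "Ck_on k (\<lambda>s::real. s powr r) {0<..}"
proof (induction k arbitrary: r)
  case 0
  then show ?case by (auto intro!: continuous_intros)
next
  case (Suc k)
  show ?case
  proof (rule Ck_on_real_SucI[where h' = "\<lambda>s. r * s powr (r - 1)"])
    show "Ck_on k (\<lambda>s. r * s powr (r - 1)) {0<..}"
      using Suc by (intro Ck_on_mult Ck_on_const) auto
  qed (simp_all add: has_real_derivative_powr)
qed

lemma Ck_on_powr_comp:
  assumes "open U" "Ck_on k f U" "\<And>x. x \<in> U \<Longrightarrow> f x > 0"
  shows "Ck_on k (\<lambda>x. f x powr r) U"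
  by (rule Ck_on_compose[OF assms(1) _ Ck_on_powr assms(2)]) (simp_all add: assms(3))

lemma Ck_on_arsinh: "Ck_on k (arsinh :: real \<Rightarrow> real) UNIV"
proof (cases k)
  case 0
  show ?thesis unfolding 0 by (simp add: continuous_on_arsinh)
next
  case (Suc j)
  show ?thesis unfolding Suc
  proof (rule Ck_on_real_SucI[where h' = "\<lambda>s. (s * s + 1) powr (- (1/2))"])
    fix x :: real
    have "0 < x * x + 1" by (simp add: add_nonneg_pos)
    then have "1 / sqrt (x\<^sup>2 + 1) = (x * x + 1) powr (- (1 / 2))"
      by (simp add: powr_minus_divide powr_half_sqrt power2_eq_square)
    then show "(arsinh has_real_derivative (x * x + 1) powr - (1 / 2)) (at x)"
      using arsinh_real_has_field_derivative[of x UNIV] by simp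
  next
    have "Ck_on j (\<lambda>s::real. s * s + 1) UNIV"
      by (intro Ck_on_add Ck_on_mult Ck_on_const Ck_on_linear bounded_linear_ident open_UNIV)
    then show "Ck_on j (\<lambda>s. (s * s + 1) powr - (1 / 2)) (UNIV::real set)"
      by (rule Ck_on_powr_comp[OF open_UNIV]) (simp add: add_nonneg_pos)
  qed simp
qed

lemma Ck_on_tanh: "Ck_on k (tanh :: real \<Rightarrow> real) UNIV"
proof (induction k)
  case 0
  then show ?case by (auto intro!: continuous_intros)
next
  case (Suc k)
  show ?case
  proof (rule Ck_on_real_SucI[where h' = "\<lambda>s. 1 - tanh s * tanh s"])
    show "(tanh has_real_derivative 1 - tanh s * tanh s) (at s)" for s :: real
      by (auto intro!: derivative_eq_intros simp: power2_eq_square)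
    show "Ck_on k (\<lambda>s::real. 1 - tanh s * tanh s) UNIV"
      by (intro Ck_on_diff Ck_on_const Ck_on_mult Suc open_UNIV)
  qed simp
qed

lemma Ck_on_inner_self: "Ck_on k (\<lambda>x::'a::euclidean_space. x \<bullet> x) UNIV"
proof (cases k)
  case 0
  then show ?thesis by (simp add: continuous_on_inner)
next
  case (Suc j)
  have "Ck_on j (\<lambda>x::'a. 2 * (x \<bullet> v)) UNIV" for v
    by (intro Ck_on_linear bounded_linear_intros open_UNIV)
  then show ?thesis
    unfolding Suc by (intro Ck_on_SucI[where f' = "\<lambda>x h. 2 * (x \<bullet> h)"])
      (auto intro!: derivative_eq_intros simp: inner_commute)
qed


section \<open>Lengths of curves and completeness\<close>

text \<open>Finitely many parameters carry no length, so any expression for the velocity that is correct outside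
  a finite set may be used. This spares all later arguments the corners and end points.\<close>

lemma curve_lengthsI:
  assumes "valid_path c" "path_image c \<subseteq> S" "pathstart c = p" "pathfinish c = q" "finite K"
    and "\<And>s. s \<in> {0..1} - K \<Longrightarrow> (c has_vector_derivative D s) (at s)"
    and "((\<lambda>s. sqrt (g (c s) (D s) (D s))) has_integral L) {0..1}"
  shows "L \<in> curve_lengths g S p q"
proof -
  have "((\<lambda>s. sqrt (g (c s) (vector_derivative c (at s within {0..1}))
             (vector_derivative c (at s within {0..1})))) has_integral L) {0..1}"
    by (rule has_integral_spike_finite[OF assms(5) _ assms(7)])
      (use vector_derivative_at_within_ivl[OF assms(6)] in auto)
  then show ?thesis
    using assms(1-4) by (auto simp: curve_lengths_def)
qed

lemma curve_lengthsE:
  assumes "L \<in> curve_lengths g S p q"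
  obtains c K D where "valid_path c" "path_image c \<subseteq> S" "pathstart c = p" "pathfinish c = q" "finite K"
    and "\<And>s. s \<in> {0..1} - K \<Longrightarrow> (c has_vector_derivative D s) (at s)"
    and "((\<lambda>s. sqrt (g (c s) (D s) (D s))) has_integral L) {0..1}"
proof -
  obtain c where c: "valid_path c" "path_image c \<subseteq> S" "pathstart c = p" "pathfinish c = q"
    "((\<lambda>s. sqrt (g (c s) (vector_derivative c (at s within {0..1}))
             (vector_derivative c (at s within {0..1})))) has_integral L) {0..1}"
    using assms by (auto simp: curve_lengths_def)
  obtain K where K: "finite K" "\<And>s. s \<in> {0..1} - K \<Longrightarrow> c differentiable (at s)"
    using c(1) by (auto simp: valid_path_def piecewise_C1_differentiable_on_def C1_differentiable_on_eq)
  show ?thesis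
  proof (rule that[OF c(1-4) K(1) _ c(5)])
    fix s assume s: "s \<in> {0..1} - K"
    then have "(c has_vector_derivative vector_derivative c (at s)) (at s)"
      using K(2) vector_derivative_works by blast
    then show "(c has_vector_derivative vector_derivative c (at s within {0..1})) (at s)"
      using vector_derivative_at_within_ivl[of c _ s 0 1] s by auto
  qed
qed

text \<open>All lower bounds for distances come from this: a function whose derivative is bounded by the metric
  is 1-Lipschitz along curves, by the fundamental theorem of calculus.\<close>

lemma curve_length_ge:
  fixes F :: "'a::euclidean_space \<Rightarrow> real"
  assumes L: "L \<in> curve_lengths g S p q"
    and F: "\<And>x. x \<in> S \<Longrightarrow> (F has_derivative F' x) (at x)"
    and bd: "\<And>x v. x \<in> S \<Longrightarrow> \<bar>F' x v\<bar> \<le> sqrt (g x v v)"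
  shows "\<bar>F q - F p\<bar> \<le> L"
proof -
  obtain c K D where c: "valid_path c" "path_image c \<subseteq> S" "pathstart c = p" "pathfinish c = q" "finite K"
    and D: "\<And>s. s \<in> {0..1} - K \<Longrightarrow> (c has_vector_derivative D s) (at s)"
    and int: "((\<lambda>s. sqrt (g (c s) (D s) (D s))) has_integral L) {0..1}"
    by (rule curve_lengthsE[OF L]) blast
  have cS: "c s \<in> S" if "s \<in> {0..1}" for s
    using c(2) that by (auto simp: path_image_def)
  have I: "((\<lambda>s. F' (c s) (D s)) has_integral (F (c 1) - F (c 0))) {0..1}"
  proof (rule fundamental_theorem_of_calculus_interior_strong[OF c(5)])
    have "continuous_on {0..1} c"
      using c(1) by (simp add: valid_path_def piecewise_C1_differentiable_on_def)
    moreover have "continuous_on S F"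
      using F by (meson has_derivative_at_withinI has_derivative_continuous_on)
    ultimately show "continuous_on {0..1} (\<lambda>x. F (c x))"
      using cS by (intro continuous_on_compose2[of S F "{0..1}" c]) auto
  next
    fix s :: real assume "s \<in> {0<..<1} - K"
    then have s: "s \<in> {0..1}" "s \<in> {0..1} - K" by auto
    have "((\<lambda>s. F (c s)) has_derivative (\<lambda>h. F' (c s) (h *\<^sub>R D s))) (at s)"
      using has_derivative_compose[OF D[OF s(2), unfolded has_vector_derivative_def] F[OF cS[OF s(1)]]] .
    moreover have "linear (F' (c s))"
      using F[OF cS[OF s(1)]] has_derivative_linear by blast
    ultimately show "((\<lambda>s. F (c s)) has_vector_derivative F' (c s) (D s)) (at s)"
      by (simp add: has_vector_derivative_def linear_cmul)
  qed simp
  have "F (c 1) - F (c 0) \<le> L"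
    by (rule has_integral_le[OF I int]) (use bd cS in \<open>fastforce simp: abs_le_iff\<close>)
  moreover have "- (F (c 1) - F (c 0)) \<le> L"
    by (rule has_integral_le[OF has_integral_neg[OF I] int]) (use bd cS in \<open>fastforce simp: abs_le_iff\<close>)
  ultimately show ?thesis
    using c(3,4) by (simp add: pathstart_def pathfinish_def abs_le_iff)
qed

lemma C1_curve_length:
  assumes D: "\<And>s. s \<in> {0..1} \<Longrightarrow> (c has_vector_derivative D s) (at s)"
    and "continuous_on {0..1} D" and S: "\<And>s. s \<in> {0..1} \<Longrightarrow> c s \<in> S"
    and sp: "continuous_on {0..1} (\<lambda>s. g (c s) (D s) (D s))"
  shows "integral {0..1} (\<lambda>s. sqrt (g (c s) (D s) (D s))) \<in> curve_lengths g S (c 0) (c 1)"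
proof (rule curve_lengthsI[where c = c and D = D and K = "{}"])
  show "valid_path c"
    using D assms(2) unfolding valid_path_def
    by (intro C1_differentiable_imp_piecewise) (use C1_differentiable_on_def in blast)
  show "((\<lambda>s. sqrt (g (c s) (D s) (D s))) has_integral
      integral {0..1} (\<lambda>s. sqrt (g (c s) (D s) (D s)))) {0..1}"
    using sp by (intro integrable_integral integrable_continuous_real continuous_intros)
qed (use D S in \<open>auto simp: path_image_def pathstart_def pathfinish_def\<close>)

lemma curve_lengths_reverse:
  assumes neg: "\<And>x v. g x (- v) (- v) = g x v v" and L: "L \<in> curve_lengths g S p q"
  shows "L \<in> curve_lengths g S q p"
proof -
  obtain c K D where c: "valid_path c" "path_image c \<subseteq> S" "pathstart c = p" "pathfinish c = q" "finite K"
    and D: "\<And>s. s \<in> {0..1} - K \<Longrightarrow> (c has_vector_derivative D s) (at s)"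
    and int: "((\<lambda>s. sqrt (g (c s) (D s) (D s))) has_integral L) {0..1}"
    by (rule curve_lengthsE[OF L]) blast
  show ?thesis
  proof (rule curve_lengthsI[where c = "reversepath c" and D = "\<lambda>s. - D (1 - s)" and K = "(\<lambda>s. 1 - s) ` K"])
    fix s :: real assume "s \<in> {0..1} - (\<lambda>s. 1 - s) ` K"
    then have "1 - s \<in> {0..1} - K" by (auto simp: image_iff)
    then have "(c has_vector_derivative D (1 - s)) (at (1 - s))" by (rule D)
    moreover have "((\<lambda>s. 1 - s) has_vector_derivative - 1) (at s)"
      by (auto intro!: derivative_eq_intros)
    ultimately have "(c \<circ> (\<lambda>s. 1 - s) has_vector_derivative (- 1) *\<^sub>R D (1 - s)) (at s)"
      by (intro vector_diff_chain_at)
    then show "(reversepath c has_vector_derivative - D (1 - s)) (at s)"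
      by (simp add: reversepath_def o_def)
  next
    have "((\<lambda>s. sqrt (g (c (1 - s)) (D (1 - s)) (D (1 - s)))) has_integral L) ((\<lambda>s. 1 - s) ` {0..1})"
      using has_integral_affinity01[OF int, of "-1" 1] by (simp add: minus_diff_commute)
    then show "((\<lambda>s. sqrt (g (reversepath c s) (- D (1 - s)) (- D (1 - s)))) has_integral L) {0..1}"
      by (simp add: neg reversepath_def)
  qed (use c in auto)
qed

lemma curve_lengths_join:
  assumes hom: "\<And>x v r. g x (r *\<^sub>R v) (r *\<^sub>R v) = r\<^sup>2 * g x v v"
    and L1: "L1 \<in> curve_lengths g S p q" and L2: "L2 \<in> curve_lengths g S q r"
  shows "L1 + L2 \<in> curve_lengths g S p r"
proof -
  obtain c1 K1 D1 where c1: "valid_path c1" "path_image c1 \<subseteq> S" "pathstart c1 = p" "pathfinish c1 = q" "finite K1"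
    and D1: "\<And>s. s \<in> {0..1} - K1 \<Longrightarrow> (c1 has_vector_derivative D1 s) (at s)"
    and int1: "((\<lambda>s. sqrt (g (c1 s) (D1 s) (D1 s))) has_integral L1) {0..1}"
    by (rule curve_lengthsE[OF L1]) blast
  obtain c2 K2 D2 where c2: "valid_path c2" "path_image c2 \<subseteq> S" "pathstart c2 = q" "pathfinish c2 = r" "finite K2"
    and D2: "\<And>s. s \<in> {0..1} - K2 \<Longrightarrow> (c2 has_vector_derivative D2 s) (at s)"
    and int2: "((\<lambda>s. sqrt (g (c2 s) (D2 s) (D2 s))) has_integral L2) {0..1}"
    by (rule curve_lengthsE[OF L2]) blast
  \<comment> \<open>the exceptional points of both halves and the possible corner at 1/2\<close>
  define K where "K = insert (1/2) ((\<lambda>s. 2 * s) -` K1 \<union> (\<lambda>s. 2 * s - 1) -` K2)"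
  define D where "D s = (if s < 1/2 then 2 *\<^sub>R D1 (2 * s) else 2 *\<^sub>R D2 (2 * s - 1))" for s :: real
  have finK: "finite K"
    unfolding K_def using c1(5) c2(5) by (auto intro!: finite_vimageI inj_onI)
  have sc: "sqrt (g x (2 *\<^sub>R v) (2 *\<^sub>R v)) = 2 * sqrt (g x v v)" for x v
    by (simp add: hom real_sqrt_mult)
  have i1: "((\<lambda>s. sqrt (g ((c1 +++ c2) s) (D s) (D s))) has_integral L1) {0..1/2}"
  proof (rule has_integral_spike_finite[OF finK])
    show "((\<lambda>s. 2 * sqrt (g (c1 (2 * s)) (D1 (2 * s)) (D1 (2 * s)))) has_integral L1) {0..1/2}"
      using has_integral_affinity01 [OF int1, where m = 2 and c = 0, THEN has_integral_cmul [where c = 2]]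
      by (simp_all only: image_affinity_atLeastAtMost_div_diff, simp_all)
  qed (auto simp: D_def K_def joinpaths_def sc)
  have i2: "((\<lambda>s. sqrt (g ((c1 +++ c2) s) (D s) (D s))) has_integral L2) {1/2..1}"
  proof (rule has_integral_spike_finite[OF finK])
    show "((\<lambda>s. 2 * sqrt (g (c2 (2 * s - 1)) (D2 (2 * s - 1)) (D2 (2 * s - 1)))) has_integral L2) {1/2..1}"
      using has_integral_affinity01 [OF int2, where m = 2 and c = "-1", THEN has_integral_cmul [where c = 2]]
      by (simp_all only: image_affinity_atLeastAtMost_div_diff, simp_all)
  qed (auto simp: D_def K_def joinpaths_def sc)
  show ?thesis
  proof (rule curve_lengthsI[where c = "c1 +++ c2" and D = D and K = K, OF _ _ _ _ finK])
    fix s :: real assume s: "s \<in> {0..1} - K"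
    consider "s < 1/2" | "s > 1/2" using s by (force simp: K_def)
    then show "(c1 +++ c2 has_vector_derivative D s) (at s)"
    proof cases
      case 1
      have "(c1 has_vector_derivative D1 (2 * s)) (at (2 * s))"
        using s 1 by (intro D1) (auto simp: K_def)
      moreover have "((\<lambda>s. 2 * s) has_vector_derivative 2) (at s)"
        by (auto intro!: derivative_eq_intros)
      ultimately have "((\<lambda>s. c1 (2 * s)) has_vector_derivative D s) (at s)"
        using 1 vector_diff_chain_at[of "\<lambda>s. 2 * s" 2 s c1] by (simp add: D_def o_def)
      then show ?thesis
        by (rule has_vector_derivative_transform_within[where d = "1/2 - s"])
          (use 1 in \<open>auto simp: joinpaths_def dist_real_def\<close>)
    next
      case 2
      have "(c2 has_vector_derivative D2 (2 * s - 1)) (at (2 * s - 1))"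
        using s 2 by (intro D2) (auto simp: K_def)
      moreover have "((\<lambda>s. 2 * s - 1) has_vector_derivative 2) (at s)"
        by (auto intro!: derivative_eq_intros)
      ultimately have "((\<lambda>s. c2 (2 * s - 1)) has_vector_derivative D s) (at s)"
        using 2 vector_diff_chain_at[of "\<lambda>s. 2 * s - 1" 2 s c2] by (simp add: D_def o_def)
      then show ?thesis
        by (rule has_vector_derivative_transform_within[where d = "s - 1/2"])
          (use 2 in \<open>auto simp: joinpaths_def dist_real_def\<close>)
    qed
  next
    show "((\<lambda>s. sqrt (g ((c1 +++ c2) s) (D s) (D s))) has_integral L1 + L2) {0..1}"
      by (rule has_integral_combine[OF _ _ i1 i2]) auto
  qed (use c1 c2 path_image_join_subset[of c1 c2] in \<open>auto simp: valid_path_join\<close>)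
qed

lemma curve_lengths_nonempty_trans:
  assumes "\<And>x v r. g x (r *\<^sub>R v) (r *\<^sub>R v) = r\<^sup>2 * g x v v"
    "curve_lengths g S p q \<noteq> {}" "curve_lengths g S q r \<noteq> {}"
  shows "curve_lengths g S p r \<noteq> {}"
  using curve_lengths_join[where g = g, OF assms(1)] assms(2,3) by blast

lemma riem_dist_le:
  assumes "\<And>x v. x \<in> S \<Longrightarrow> 0 \<le> g x v v" "L \<in> curve_lengths g S p q"
  shows "riem_dist g S p q \<le> L"
proof -
  have "bdd_below (curve_lengths g S p q)"
    by (rule bdd_belowI[of _ 0])
      (use curve_length_ge[of _ g S p q "\<lambda>_. 0" "\<lambda>_ _. 0"] assms(1) in auto)
  then show ?thesis
    using assms(2) by (auto simp: riem_dist_def intro: cInf_lower)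
qed

lemma riem_dist_ge:
  assumes "curve_lengths g S p q \<noteq> {}" "\<And>L. L \<in> curve_lengths g S p q \<Longrightarrow> r \<le> L"
  shows "r \<le> riem_dist g S p q"
  using assms by (auto simp: riem_dist_def intro: cInf_greatest)

text \<open>Apply the Lipschitz bound to the coordinate along the chord from \<open>p\<close> to \<open>q\<close>.\<close>

lemma euclidean_dist_le_length:
  assumes "\<And>x v. x \<in> S \<Longrightarrow> (norm v)\<^sup>2 \<le> g x v v" "L \<in> curve_lengths g S p q"
  shows "dist p q \<le> L"
proof -
  \<comment> \<open>if \<open>p = q\<close> then \<open>w = 0\<close>, and the argument still works\<close>
  define w where "w = (q - p) /\<^sub>R norm (q - p)"
  have w: "norm w \<le> 1" by (cases "q = p") (simp_all add: w_def)
  have "\<bar>w \<bullet> v\<bar> \<le> sqrt (g x v v)" if "x \<in> S" for x v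
  proof -
    have "\<bar>w \<bullet> v\<bar> \<le> norm w * norm v" by (rule Cauchy_Schwarz_ineq2)
    also have "\<dots> \<le> norm v" using w by (simp add: mult_left_le_one_le)
    also have "\<dots> \<le> sqrt (g x v v)" using assms(1)[OF that] by (simp add: real_le_rsqrt)
    finally show ?thesis .
  qed
  then have "\<bar>w \<bullet> q - w \<bullet> p\<bar> \<le> L"
    by (intro curve_length_ge[OF assms(2), of _ "\<lambda>_ v. w \<bullet> v"]) (auto intro!: derivative_eq_intros)
  moreover have "w \<bullet> q - w \<bullet> p = norm (q - p)"
  proof -
    have "w \<bullet> q - w \<bullet> p = inverse (norm (q - p)) * (norm (q - p))\<^sup>2"
      by (simp add: w_def power2_norm_eq_inner inner_diff_right algebra_simps)
    then show ?thesis by (cases "q = p") (simp_all add: power2_eq_square)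
  qed
  ultimately show ?thesis by (simp add: dist_norm norm_minus_commute)
qed

lemma Metric_space_riem_dist:
  assumes hom: "\<And>x v r. g x (r *\<^sub>R v) (r *\<^sub>R v) = r\<^sup>2 * g x v v"
    and pos: "\<And>x v. x \<in> S \<Longrightarrow> (norm v)\<^sup>2 \<le> g x v v"
    and conn: "\<And>p q. p \<in> S \<Longrightarrow> q \<in> S \<Longrightarrow> curve_lengths g S p q \<noteq> {}"
  shows "Metric_space S (riem_dist g S)"
proof
  have pos0: "0 \<le> g x v v" if "x \<in> S" for x v
    using pos[OF that, of v] by (meson order_trans zero_le_power2)
  have neg: "g x (- v) (- v) = g x v v" for x v using hom[of x "-1" v] by simp
  have nonneg: "0 \<le> L" if "L \<in> curve_lengths g S p q" for p q L
    using euclidean_dist_le_length[where g = g and S = S, OF pos that] by (meson order_trans zero_le_dist)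
  fix p q r
  show "0 \<le> riem_dist g S p q"
    by (cases "curve_lengths g S p q = {}")
      (auto intro: riem_dist_ge nonneg, simp add: riem_dist_def)
  have "curve_lengths g S p q = curve_lengths g S q p"
    by (auto intro: curve_lengths_reverse[where g = g, OF neg])
  then show "riem_dist g S p q = riem_dist g S q p" by (simp add: riem_dist_def)
  show "riem_dist g S p q = 0 \<longleftrightarrow> p = q" if "p \<in> S" "q \<in> S"
  proof
    assume "riem_dist g S p q = 0"
    moreover have "dist p q \<le> riem_dist g S p q"
      using riem_dist_ge[OF conn[OF that] euclidean_dist_le_length[where g = g and S = S, OF pos]] .
    ultimately show "p = q" by simp
  next
    assume "p = q"
    have g0: "g p 0 0 = 0" using hom[of p 0 0] by simp
    have "0 \<in> curve_lengths g S p p"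
      using C1_curve_length[of "\<lambda>_. p" "\<lambda>_. 0" S g] that g0 by simp
    from riem_dist_le[where g = g and S = S, OF pos0 this] \<open>0 \<le> riem_dist g S p q\<close> show "riem_dist g S p q = 0"
      using \<open>p = q\<close> by simp
  qed
  show "riem_dist g S p r \<le> riem_dist g S p q + riem_dist g S q r" if "p \<in> S" "q \<in> S" "r \<in> S"
  proof -
    \<comment> \<open>take the infimum over \<open>L2\<close> first and over \<open>L1\<close> afterwards\<close>
    have "riem_dist g S p r \<le> L1 + L2"
      if "L1 \<in> curve_lengths g S p q" "L2 \<in> curve_lengths g S q r" for L1 L2
      using riem_dist_le[where g = g and S = S, OF pos0 curve_lengths_join[where g = g, OF hom that]] .
    then have "riem_dist g S p r - L1 \<le> L2"
      if "L1 \<in> curve_lengths g S p q" "L2 \<in> curve_lengths g S q r" for L1 L2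
      using that by (simp add: diff_le_eq add.commute)
    then have "riem_dist g S p r - L1 \<le> riem_dist g S q r" if "L1 \<in> curve_lengths g S p q" for L1
      using that conn[OF \<open>q \<in> S\<close> \<open>r \<in> S\<close>] by (intro riem_dist_ge)
    then have "riem_dist g S p r - riem_dist g S q r \<le> riem_dist g S p q"
      using conn[OF \<open>p \<in> S\<close> \<open>q \<in> S\<close>] by (intro riem_dist_ge) (auto simp: algebra_simps)
    then show ?thesis by simp
  qed
qed

text \<open>Completeness in two independent steps: Cauchy sequences have a Euclidean limit on \<open>S\<close>, and near a
  point of \<open>S\<close> the induced distance is controlled by the Euclidean one.\<close>

lemma complete_induced_metricI:
  assumes hom: "\<And>x v r. g x (r *\<^sub>R v) (r *\<^sub>R v) = r\<^sup>2 * g x v v"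
    and pos: "\<And>x v. x \<in> S \<Longrightarrow> (norm v)\<^sup>2 \<le> g x v v"
    and conn: "\<And>p q. p \<in> S \<Longrightarrow> q \<in> S \<Longrightarrow> curve_lengths g S p q \<noteq> {}"
    and lim: "\<And>\<sigma>. range \<sigma> \<subseteq> S \<Longrightarrow>
       (\<And>\<epsilon>. \<epsilon> > 0 \<Longrightarrow> \<exists>N. \<forall>m\<ge>N. \<forall>n\<ge>N. riem_dist g S (\<sigma> m) (\<sigma> n) < \<epsilon>) \<Longrightarrow> \<exists>l\<in>S. \<sigma> \<longlonglongrightarrow> l"
    and loc: "\<And>p. p \<in> S \<Longrightarrow> \<exists>C \<delta>. \<delta> > 0 \<and> (\<forall>q\<in>S. dist q p < \<delta> \<longrightarrow> riem_dist g S q p \<le> C * dist q p)"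
  shows "complete_induced_metric g S"
proof -
  interpret Metric_space S "riem_dist g S"
    by (rule Metric_space_riem_dist[where g = g, OF hom pos conn])
  have "\<exists>x. limitin mtopology \<sigma> x sequentially" if "MCauchy \<sigma>" for \<sigma>
  proof -
    have \<sigma>: "range \<sigma> \<subseteq> S" using that by (simp add: MCauchy_def)
    have "\<exists>l\<in>S. \<sigma> \<longlonglongrightarrow> l"
      using that by (intro lim[OF \<sigma>]) (auto simp: MCauchy_def)
    then obtain l where l: "l \<in> S" "\<sigma> \<longlonglongrightarrow> l" by blast
    obtain C \<delta> where C: "\<delta> > 0" "\<And>q. q \<in> S \<Longrightarrow> dist q l < \<delta> \<Longrightarrow> riem_dist g S q l \<le> C * dist q l"
      using loc[OF l(1)] by blast
    have d0: "(\<lambda>n. dist (\<sigma> n) l) \<longlonglongrightarrow> 0"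
      using l(2) tendsto_dist_iff by blast
    then have Cd0: "(\<lambda>n. C * dist (\<sigma> n) l) \<longlonglongrightarrow> 0"
      by (rule tendsto_mult_right_zero)
    have "limitin mtopology \<sigma> l sequentially"
      unfolding limitin_metric
    proof (intro conjI l(1) allI impI)
      fix \<epsilon> :: real assume "\<epsilon> > 0"
      from order_tendstoD(2)[OF Cd0 this] order_tendstoD(2)[OF d0 C(1)]
      show "\<forall>\<^sub>F n in sequentially. \<sigma> n \<in> S \<and> riem_dist g S (\<sigma> n) l < \<epsilon>"
        by eventually_elim (use \<sigma> C(2) in fastforce)
    qed
    then show ?thesis ..
  qed
  then show ?thesis
    unfolding complete_induced_metric_def mcomplete_def using Metric_space_axioms by blast
qed


section \<open>Level sets\<close>

text \<open>The direction \<open>w x\<close> witnesses that the differential at \<open>x\<close> does not vanish.\<close>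

lemma smooth_hypersurface_level:
  fixes \<phi> :: "'a::euclidean_space \<Rightarrow> real"
  assumes "open U" "smooth_on \<phi> U" "S = {x \<in> U. \<phi> x = 0}"
    and D: "\<And>x. x \<in> U \<Longrightarrow> (\<phi> has_derivative D x) (at x)" "\<And>x. x \<in> U \<Longrightarrow> D x (w x) \<noteq> 0"
  shows "smooth_hypersurface S"
proof -
  have "frechet_derivative \<phi> (at x) \<noteq> (\<lambda>v. 0)" if "x \<in> U" for x
    using frechet_derivative_at[OF D(1)[OF that]] D(2)[OF that] by metis
  then show ?thesis
    unfolding smooth_hypersurface_def
    using assms(1-3) by (intro ballI exI[of _ U] exI[of _ \<phi>]) auto
qed

text \<open>A curve in a level set of \<open>F\<close> has constant composition with \<open>F\<close>.\<close>

lemma tangent_space_level: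
  fixes F :: "'a::euclidean_space \<Rightarrow> real"
  assumes v: "v \<in> tangent_space S p" and F: "(F has_derivative F') (at p)" "\<And>x. x \<in> S \<Longrightarrow> F x = k"
  shows "F' v = 0"
proof -
  obtain c \<delta> where c: "\<delta> > 0" "c 0 = p" "\<And>s. \<bar>s\<bar> < \<delta> \<Longrightarrow> c s \<in> S" "(c has_vector_derivative v) (at (0::real))"
    using v by (auto simp: tangent_space_def)
  have "((\<lambda>s. F (c s)) has_derivative (\<lambda>h. F' (h *\<^sub>R v))) (at 0)"
    using has_derivative_compose[OF c(4)[unfolded has_vector_derivative_def]] F(1) c(2) by blast
  moreover have "((\<lambda>s. F (c s)) has_derivative (\<lambda>h. 0)) (at 0)"
    by (rule has_derivative_transform_within[OF has_derivative_const[of k] c(1)])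
      (use c(3) F(2) in \<open>auto simp: dist_real_def\<close>)
  ultimately have "(\<lambda>h. F' (h *\<^sub>R v)) = (\<lambda>h. 0)" by (rule has_derivative_unique)
  then show ?thesis by (metis scaleR_one)
qed


section \<open>The hyperbolic metric and its connection\<close>

lemma norm_square_less_1: "x \<in> hyp \<Longrightarrow> (norm x)\<^sup>2 < 1"
  by (simp add: power_less_one_iff abs_square_less_1)

lemma hyp_metric_simps:
  "hyp_metric x (a + b) c = hyp_metric x a c + hyp_metric x b c"
  "hyp_metric x a (b + c) = hyp_metric x a b + hyp_metric x a c"
  "hyp_metric x (a - b) c = hyp_metric x a c - hyp_metric x b c"
  "hyp_metric x a (b - c) = hyp_metric x a b - hyp_metric x a c"
  "hyp_metric x (r *\<^sub>R a) b = r * hyp_metric x a b"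
  "hyp_metric x a (r *\<^sub>R b) = r * hyp_metric x a b"
  "hyp_metric x (- a) b = - hyp_metric x a b"
  "hyp_metric x a (- b) = - hyp_metric x a b"
  "hyp_metric x 0 b = 0" "hyp_metric x a 0 = 0"
  by (simp_all add: hyp_metric_def algebra_simps inner_add_left inner_add_right inner_diff_left
      inner_diff_right add_divide_distrib diff_divide_distrib)

lemma hyp_metric_commute: "hyp_metric x a b = hyp_metric x b a"
  by (simp add: hyp_metric_def inner_commute)

lemma hyp_metric_ge:
  assumes "x \<in> hyp" shows "(norm v)\<^sup>2 \<le> hyp_metric x v v"
proof -
  have n: "(norm x)\<^sup>2 < 1" by (rule norm_square_less_1[OF assms])
  then have "(1 - (norm x)\<^sup>2)\<^sup>2 \<le> 1" by (simp add: power_le_one)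
  then have "1 \<le> 4 / (1 - (norm x)\<^sup>2)\<^sup>2" using n by (simp add: le_divide_eq)
  then have "1 * (norm v)\<^sup>2 \<le> 4 / (1 - (norm x)\<^sup>2)\<^sup>2 * (norm v)\<^sup>2"
    by (intro mult_right_mono) auto
  then show ?thesis by (simp add: hyp_metric_def power2_norm_eq_inner)
qed

lemma hyp_metric_nonneg: "x \<in> hyp \<Longrightarrow> 0 \<le> hyp_metric x v v"
  using hyp_metric_ge[of x v] by (meson order_trans zero_le_power2)

lemma hyp_metric_eq_0: "x \<in> hyp \<Longrightarrow> hyp_metric x v v = 0 \<Longrightarrow> v = 0"
  using hyp_metric_ge[of x v] by simp

lemma hyp_metric_Cauchy_Schwarz:
  "\<bar>hyp_metric x v w\<bar> \<le> sqrt (hyp_metric x v v) * sqrt (hyp_metric x w w)"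
proof -
  define k where "k = 4 / (1 - (norm x)\<^sup>2)\<^sup>2"
  have k: "sqrt k * sqrt k = k" by (simp add: k_def)
  have "\<bar>hyp_metric x v w\<bar> = k * \<bar>v \<bullet> w\<bar>"
    by (simp add: hyp_metric_def abs_mult k_def)
  also have "\<dots> \<le> (sqrt k * sqrt k) * (norm v * norm w)"
    unfolding k by (intro mult_left_mono Cauchy_Schwarz_ineq2) (auto simp: k_def)
  also have "\<dots> = sqrt (k * (v \<bullet> v)) * sqrt (k * (w \<bullet> w))"
    by (simp only: real_sqrt_mult norm_eq_sqrt_inner mult_ac)
  finally show ?thesis by (simp add: hyp_metric_def k_def)
qed

lemma hyp_metric_has_derivative:
  assumes "x \<in> hyp"
  shows "((\<lambda>q. hyp_metric q v w) has_derivative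
     (\<lambda>h. 16 * (x \<bullet> h) / (1 - (norm x)\<^sup>2) ^ 3 * (v \<bullet> w))) (at x)"
proof -
  have n: "1 - x \<bullet> x \<noteq> 0"
    using norm_square_less_1[OF assms] by (simp add: power2_norm_eq_inner)
  have "((\<lambda>s. 4 / (1 - s)\<^sup>2) has_real_derivative 8 / (1 - x \<bullet> x) ^ 3) (at (x \<bullet> x))"
    using n by (auto intro!: derivative_eq_intros simp: divide_simps) (simp add: power2_eq_square power3_eq_cube power4_eq_xxxx algebra_simps)
  moreover have "((\<lambda>x. x \<bullet> x) has_derivative (\<lambda>h. 2 * (x \<bullet> h))) (at x)"
    by (auto intro!: derivative_eq_intros simp: inner_commute)
  ultimately have "((\<lambda>q. 4 / (1 - q \<bullet> q)\<^sup>2) has_derivative (\<lambda>h. 2 * (x \<bullet> h) * (8 / (1 - x \<bullet> x) ^ 3))) (at x)"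
    by (rule DERIV_compose_FDERIV)
  from has_derivative_mult_left[OF this, of "v \<bullet> w"] show ?thesis
    by (simp add: hyp_metric_def power2_norm_eq_inner)
qed

text \<open>The metric is \<open>exp (2 \<phi>)\<close> times the Euclidean one with \<open>grad \<phi> = 2 x / (1 - |x|\<^sup>2)\<close>, and this is the usual
  formula for the connection of a conformal change.\<close>

lemma christoffel_hyp_metric:
  assumes "x \<in> hyp"
  shows "christoffel hyp_metric x v w =
    (2 / (1 - (norm x)\<^sup>2)) *\<^sub>R ((x \<bullet> v) *\<^sub>R w + (x \<bullet> w) *\<^sub>R v - (v \<bullet> w) *\<^sub>R x)" (is "_ = ?z")
  unfolding christoffel_def
proof (rule the_equality)
  have n: "1 - (norm x)\<^sup>2 \<noteq> 0" using norm_square_less_1[OF assms] by simp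
  have fd: "frechet_derivative (\<lambda>q. hyp_metric q a b) (at x) h = 16 * (x \<bullet> h) / (1 - (norm x)\<^sup>2) ^ 3 * (a \<bullet> b)" for a b h
    using frechet_derivative_at[OF hyp_metric_has_derivative[OF assms, of a b]] by metis
  show z: "\<forall>y. hyp_metric x ?z y = (frechet_derivative (\<lambda>q. hyp_metric q w y) (at x) v
    + frechet_derivative (\<lambda>q. hyp_metric q v y) (at x) w
    - frechet_derivative (\<lambda>q. hyp_metric q v w) (at x) y) / 2"
  proof -
    have "4 / m\<^sup>2 * (2 / m * (a + b - c)) = (16 * a / m ^ 3 + 16 * b / m ^ 3 - 16 * c / m ^ 3) / 2" for a b c m :: real
      by (cases "m = 0") (simp_all add: field_simps power2_eq_square power3_eq_cube)
    then show ?thesis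
      unfolding fd unfolding hyp_metric_def inner_scaleR_left inner_diff_left inner_add_left
      by (simp add: mult.assoc)
  qed
  fix z' assume "\<forall>y. hyp_metric x z' y = (frechet_derivative (\<lambda>q. hyp_metric q w y) (at x) v
    + frechet_derivative (\<lambda>q. hyp_metric q v y) (at x) w
    - frechet_derivative (\<lambda>q. hyp_metric q v w) (at x) y) / 2"
  then have "hyp_metric x z' y = hyp_metric x ?z y" for y
    using z by metis
  from this[of "z' - ?z"] have "hyp_metric x (z' - ?z) (z' - ?z) = 0"
    by (simp only: hyp_metric_simps(3))
  then have "z' - ?z = 0" by (rule hyp_metric_eq_0[OF assms])
  then show "z' = ?z" by (simp only: right_minus_eq)
qed

lemma christoffel_hyp_metric_scaleR:
  "x \<in> hyp \<Longrightarrow> christoffel hyp_metric x v (r *\<^sub>R w) = r *\<^sub>R christoffel hyp_metric x v w"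
  "x \<in> hyp \<Longrightarrow> christoffel hyp_metric x (r *\<^sub>R v) w = r *\<^sub>R christoffel hyp_metric x v w"
  by (simp_all add: christoffel_hyp_metric scaleR_add_right scaleR_diff_right mult_ac)

lemma christoffel_hyp_prod_metric:
  assumes "fst p \<in> hyp"
  shows "christoffel hyp_prod_metric p v w = (christoffel hyp_metric (fst p) (fst v) (fst w), 0)"
    (is "_ = ?z")
  unfolding christoffel_def[of hyp_prod_metric]
proof (rule the_equality)
  let ?x = "fst p"
  have n: "1 - (norm ?x)\<^sup>2 \<noteq> 0" using norm_square_less_1[OF assms] by simp
  have "((\<lambda>q. hyp_prod_metric q a b) has_derivative
      (\<lambda>h. 16 * (?x \<bullet> fst h) / (1 - (norm ?x)\<^sup>2) ^ 3 * (fst a \<bullet> fst b))) (at p)" for a b :: "(real ^ 'a) \<times> real"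
    unfolding hyp_prod_metric_def
    using has_derivative_add[OF has_derivative_compose[OF has_derivative_fst[OF has_derivative_ident]
        hyp_metric_has_derivative[OF assms, of "fst a" "fst b"]] has_derivative_const[of "snd a * snd b"]] by simp
  then have fd: "frechet_derivative (\<lambda>q. hyp_prod_metric q a b) (at p) h = 16 * (?x \<bullet> fst h) / (1 - (norm ?x)\<^sup>2) ^ 3 * (fst a \<bullet> fst b)" for a b h :: "(real ^ 'a) \<times> real"
    using frechet_derivative_at by metis
  show z: "\<forall>y. hyp_prod_metric p ?z y = (frechet_derivative (\<lambda>q. hyp_prod_metric q w y) (at p) v
    + frechet_derivative (\<lambda>q. hyp_prod_metric q v y) (at p) w
    - frechet_derivative (\<lambda>q. hyp_prod_metric q v w) (at p) y) / 2"
  proof -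
    have "4 / m\<^sup>2 * (2 / m * (a + b - c)) = (16 * a / m ^ 3 + 16 * b / m ^ 3 - 16 * c / m ^ 3) / 2" for a b c m :: real
      by (cases "m = 0") (simp_all add: field_simps power2_eq_square power3_eq_cube)
    then show ?thesis
      unfolding fd unfolding christoffel_hyp_metric[OF assms] hyp_prod_metric_def hyp_metric_def
        inner_scaleR_left inner_diff_left inner_add_left fst_conv snd_conv
      by (simp add: mult.assoc)
  qed
  fix z' assume z': "\<forall>y. hyp_prod_metric p z' y = (frechet_derivative (\<lambda>q. hyp_prod_metric q w y) (at p) v
    + frechet_derivative (\<lambda>q. hyp_prod_metric q v y) (at p) w
    - frechet_derivative (\<lambda>q. hyp_prod_metric q v w) (at p) y) / 2"
  have "hyp_prod_metric p z' y = hyp_prod_metric p ?z y" for y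
    using z z' by metis
  then have e: "hyp_prod_metric p z' (z' - ?z) = hyp_prod_metric p ?z (z' - ?z)" .
  have "hyp_metric ?x (fst (z' - ?z)) (fst (z' - ?z)) + (snd (z' - ?z))\<^sup>2 = 0"
    using e by (simp add: hyp_prod_metric_def hyp_metric_simps power2_eq_square algebra_simps)
  then have "hyp_metric ?x (fst (z' - ?z)) (fst (z' - ?z)) = 0 \<and> snd (z' - ?z) = 0"
    using hyp_metric_nonneg[OF assms, of "fst (z' - ?z)"]
    by (metis add_nonneg_eq_0_iff zero_le_power2 power2_eq_square mult_eq_0_iff)
  then have "fst (z' - ?z) = 0" "snd (z' - ?z) = 0" using hyp_metric_eq_0[OF assms] by blast+
  then show "z' = ?z" by (simp add: prod_eq_iff)
qed

text \<open>The metric is conformal: a Euclidean orthonormal basis of the hyperplane orthogonal to \<open>z\<close> only has to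
  be rescaled.\<close>

lemma hyp_orthonormal_frame:
  fixes z :: "real ^ 'n"
  assumes "x \<in> hyp" "z \<noteq> 0"
  shows "\<exists>B. finite B \<and> card B = CARD('n) - 1 \<and> (\<forall>v\<in>B. hyp_metric x z v = 0)
    \<and> (\<forall>v\<in>B. \<forall>w\<in>B. hyp_metric x v w = (if v = w then 1 else 0))"
proof -
  define m where "m = (1 - (norm x)\<^sup>2) / 2"
  have m: "m \<noteq> 0" using norm_square_less_1[OF assms(1)] by (simp add: m_def)
  have g: "hyp_metric x v w = v \<bullet> w / m\<^sup>2" for v w
    by (simp add: hyp_metric_def m_def power_divide)
  obtain B where B: "B \<subseteq> {v. z \<bullet> v = 0}" "pairwise orthogonal B" "\<And>v. v \<in> B \<Longrightarrow> norm v = 1"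
     "independent B" "card B = dim {v. z \<bullet> v = 0}"
    using orthonormal_basis_subspace[OF subspace_hyperplane[of z]] by metis
  have "finite B" using B(4) independent_bound by blast
  moreover have "card B = CARD('n) - 1" using B(5) dim_hyperplane[OF assms(2)] by simp
  moreover have inj: "inj_on (\<lambda>v. m *\<^sub>R v) B" using m by (auto intro: inj_onI)
  moreover have "hyp_metric x (m *\<^sub>R v) (m *\<^sub>R w) = (if m *\<^sub>R v = m *\<^sub>R w then 1 else 0)" if "v \<in> B" "w \<in> B" for v w
  proof (cases "v = w")
    case True
    have "v \<bullet> v = 1" using B(3)[OF that(1)] by (simp flip: power2_norm_eq_inner)
    then show ?thesis using True m by (simp add: g power2_eq_square)
  next
    case False
    then have "v \<bullet> w = 0" using B(2) that by (auto simp: pairwise_def orthogonal_def)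
    then show ?thesis using False m by (simp add: g)
  qed
  moreover have "hyp_metric x z (m *\<^sub>R v) = 0" if "v \<in> B" for v
    using B(1) that by (auto simp: g)
  ultimately show ?thesis
    by (intro exI[of _ "(\<lambda>v. m *\<^sub>R v) ` B"]) (auto simp: card_image)
qed

lemma curve_lengths_hyp_nonempty:
  assumes "p \<in> hyp" "q \<in> hyp"
  shows "curve_lengths hyp_metric hyp p q \<noteq> {}"
proof -
  define c where "c s = p + s *\<^sub>R (q - p)" for s
  have c: "c s \<in> hyp" if "s \<in> {0..1}" for s
    using convexD_alt[OF convex_ball assms, of s] that by (simp add: c_def algebra_simps)
  have "integral {0..1} (\<lambda>s. sqrt (hyp_metric (c s) (q - p) (q - p))) \<in> curve_lengths hyp_metric hyp (c 0) (c 1)"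
  proof (rule C1_curve_length)
    show "(c has_vector_derivative (q - p)) (at s)" for s
      unfolding c_def[abs_def] by (auto intro!: derivative_eq_intros)
    have "(1 - (norm (c s))\<^sup>2)\<^sup>2 \<noteq> 0" if "s \<in> {0..1}" for s
      using norm_square_less_1[OF c[OF that]] by simp
    then show "continuous_on {0..1} (\<lambda>s. hyp_metric (c s) (q - p) (q - p))"
      unfolding hyp_metric_def c_def by (intro continuous_intros) auto
  qed (use c in auto)
  then show ?thesis by (auto simp: c_def)
qed

text \<open>A 1-Lipschitz function that tends to infinity at the boundary sphere; it keeps Cauchy sequences away
  from the sphere.\<close>

lemma neg_log_has_derivative:
  assumes "x \<in> hyp"
  shows "((\<lambda>x. - ln (1 - x \<bullet> x)) has_derivative (\<lambda>h. 2 * (x \<bullet> h) / (1 - (norm x)\<^sup>2))) (at x)"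
    and "\<bar>2 * (x \<bullet> h) / (1 - (norm x)\<^sup>2)\<bar> \<le> sqrt (hyp_metric x h h)"
proof -
  have n: "1 - x \<bullet> x > 0" using norm_square_less_1[OF assms] by (simp add: power2_norm_eq_inner)
  have "((\<lambda>s. - ln (1 - s)) has_real_derivative 1 / (1 - x \<bullet> x)) (at (x \<bullet> x))"
    using n by (auto intro!: derivative_eq_intros)
  moreover have "((\<lambda>x. x \<bullet> x) has_derivative (\<lambda>h. 2 * (x \<bullet> h))) (at x)"
    by (auto intro!: derivative_eq_intros simp: inner_commute)
  ultimately have "((\<lambda>x. - ln (1 - x \<bullet> x)) has_derivative (\<lambda>h. 2 * (x \<bullet> h) * (1 / (1 - x \<bullet> x)))) (at x)"
    by (rule DERIV_compose_FDERIV)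
  then show "((\<lambda>x. - ln (1 - x \<bullet> x)) has_derivative (\<lambda>h. 2 * (x \<bullet> h) / (1 - (norm x)\<^sup>2))) (at x)"
    by (simp add: power2_norm_eq_inner)
  have "\<bar>x \<bullet> h\<bar> \<le> norm x * norm h" by (rule Cauchy_Schwarz_ineq2)
  also have "\<dots> \<le> 1 * norm h" using assms by (intro mult_right_mono) auto
  finally have "2 * \<bar>x \<bullet> h\<bar> / (1 - (norm x)\<^sup>2) \<le> 2 * norm h / (1 - (norm x)\<^sup>2)"
    using norm_square_less_1[OF assms] by (intro divide_right_mono) auto
  also have "\<dots> = sqrt (hyp_metric x h h)"
    using norm_square_less_1[OF assms]
    by (simp add: hyp_metric_def real_sqrt_mult real_sqrt_divide norm_eq_sqrt_inner[of h])
  finally show "\<bar>2 * (x \<bullet> h) / (1 - (norm x)\<^sup>2)\<bar> \<le> sqrt (hyp_metric x h h)"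
    using norm_square_less_1[OF assms] by (simp add: abs_mult)
qed

lemma hyp_prod_metric_scaleR: "hyp_prod_metric p (r *\<^sub>R v) (r *\<^sub>R v) = r\<^sup>2 * hyp_prod_metric p v v"
  by (simp add: hyp_prod_metric_def hyp_metric_simps power2_eq_square algebra_simps)

lemma hyp_prod_metric_ge: "fst p \<in> hyp \<Longrightarrow> (norm v)\<^sup>2 \<le> hyp_prod_metric p v v"
  using hyp_metric_ge[of "fst p" "fst v"]
  by (simp add: hyp_prod_metric_def power2_eq_square[of "snd v"] flip: power2_norm_eq_inner)
    (simp add: norm_prod_def power2_eq_square)


section \<open>The height over a totally geodesic hyperplane\<close>

text \<open>In the hyperboloid model this is the coordinate along \<open>e\<close>.\<close>

definition hyp_height :: "real ^ 'n \<Rightarrow> real ^ 'n \<Rightarrow> real" where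
  "hyp_height e x = 2 * (e \<bullet> x) / (1 - (norm x)\<^sup>2)"

text \<open>The Riemannian gradient of \<open>hyp_height e\<close>; in these coordinates it is a polynomial field.\<close>

definition height_grad :: "real ^ 'n \<Rightarrow> real ^ 'n \<Rightarrow> real ^ 'n" where
  "height_grad e x = ((1 - (norm x)\<^sup>2) / 2) *\<^sub>R e + (e \<bullet> x) *\<^sub>R x"

text \<open>For a unit vector \<open>e\<close> this is the signed hyperbolic distance to the hyperplane \<open>e \<bullet> x = 0\<close>; that is
  proved in \<open>signed_dist_radial\<close>.\<close>

definition plane_dist :: "real ^ 'n \<Rightarrow> real ^ 'n \<Rightarrow> real" where
  "plane_dist e x = arsinh (hyp_height e x)"

lemma height_has_derivative:
  assumes "x \<in> hyp"
  shows "(hyp_height e has_derivative hyp_metric x (height_grad e x)) (at x)"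
proof -
  have n: "1 - x \<bullet> x \<noteq> 0"
    using norm_square_less_1[OF assms] by (simp add: power2_norm_eq_inner)
  have "((\<lambda>s. 2 / (1 - s)) has_real_derivative 2 / (1 - x \<bullet> x)\<^sup>2) (at (x \<bullet> x))"
    using n by (auto intro!: derivative_eq_intros simp: divide_simps power2_eq_square)
  moreover have "((\<lambda>x. x \<bullet> x) has_derivative (\<lambda>h. 2 * (x \<bullet> h))) (at x)"
    by (auto intro!: derivative_eq_intros simp: inner_commute)
  ultimately have "((\<lambda>q. 2 / (1 - q \<bullet> q)) has_derivative (\<lambda>h. 2 * (x \<bullet> h) * (2 / (1 - x \<bullet> x)\<^sup>2))) (at x)"
    by (rule DERIV_compose_FDERIV)
  moreover have "((\<lambda>x. e \<bullet> x) has_derivative (\<lambda>h. e \<bullet> h)) (at x)"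
    by (auto intro!: derivative_eq_intros)
  ultimately have "((\<lambda>q. 2 / (1 - q \<bullet> q) * (e \<bullet> q)) has_derivative
     (\<lambda>h. 2 / (1 - x \<bullet> x) * (e \<bullet> h) + 2 * (x \<bullet> h) * (2 / (1 - x \<bullet> x)\<^sup>2) * (e \<bullet> x))) (at x)"
    by (rule has_derivative_mult)
  moreover have "2 / (1 - x \<bullet> x) * (e \<bullet> h) + 2 * (x \<bullet> h) * (2 / (1 - x \<bullet> x)\<^sup>2) * (e \<bullet> x)
      = hyp_metric x (height_grad e x) h" for h
  proof -
    have "2 / m * b + 2 * c * (2 / m\<^sup>2) * a = 4 / m\<^sup>2 * (m / 2 * b + a * c)" if "m \<noteq> 0" for m a b c :: real
      using that by (simp add: field_simps power2_eq_square)
    from this[OF n] show ?thesis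
      by (simp add: hyp_metric_def height_grad_def power2_norm_eq_inner inner_add_left)
  qed
  ultimately show ?thesis
    by (simp add: hyp_height_def[abs_def] power2_norm_eq_inner)
qed

lemma height_grad_has_derivative:
  "(height_grad e has_derivative (\<lambda>h. (e \<bullet> x) *\<^sub>R h + (e \<bullet> h) *\<^sub>R x - (x \<bullet> h) *\<^sub>R e)) (at x)"
proof -
  have 1: "((\<lambda>x. (1 - x \<bullet> x) / 2) has_derivative (\<lambda>h. - (x \<bullet> h))) (at x)"
    by (auto intro!: derivative_eq_intros simp: inner_commute)
  have 2: "((\<lambda>x. e \<bullet> x) has_derivative (\<lambda>h. e \<bullet> h)) (at x)"
    by (auto intro!: derivative_eq_intros)
  show ?thesis
    using has_derivative_add[OF has_derivative_scaleR[OF 1 has_derivative_const[of e]]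
        has_derivative_scaleR[OF 2 has_derivative_ident]]
    by (simp add: height_grad_def[abs_def] power2_norm_eq_inner algebra_simps)
qed

text \<open>The left-hand side is the covariant derivative of the gradient, so the Hessian of the height is the
  height times the metric. On the hyperboloid this is the fact that the linear coordinate functions
  satisfy \<open>Hess f = f g\<close>. Both curvature computations below rest on it.\<close>

lemma height_hessian:
  assumes "x \<in> hyp"
  shows "(e \<bullet> x) *\<^sub>R h + (e \<bullet> h) *\<^sub>R x - (x \<bullet> h) *\<^sub>R e + christoffel hyp_metric x h (height_grad e x)
     = hyp_height e x *\<^sub>R h"
proof -
  define m where "m = 1 - (norm x)\<^sup>2"
  have m: "m \<noteq> 0" "(norm x)\<^sup>2 = 1 - m" using norm_square_less_1[OF assms] by (simp_all add: m_def)
  define a b c where abc: "a = e \<bullet> x" "b = e \<bullet> h" "c = x \<bullet> h"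
  have xx: "x \<bullet> x = 1 - m" using m(2) by (simp add: power2_norm_eq_inner)
  have 1: "x \<bullet> height_grad e x = m / 2 * a + a * (1 - m)"
    by (simp add: height_grad_def m(2) inner_add_right xx abc inner_commute)
  have 2: "h \<bullet> height_grad e x = m / 2 * b + a * c"
    by (simp add: height_grad_def m(2) inner_add_right abc inner_commute)
  have m3: "1 - (norm x)\<^sup>2 = m" by (simp add: m_def)
  have 3: "(2 / m) * c * (m / 2) = c" "(2 / m) * (c * a) - (2 / m) * (m / 2 * b + a * c) = - b"
    "(2 / m) * (m / 2 * a + a * (1 - m)) = hyp_height e x - a"
    using m(1) by (simp_all add: hyp_height_def m3 abc field_simps)
  have 4: "k *\<^sub>R (c *\<^sub>R (p *\<^sub>R e + a *\<^sub>R x) + q *\<^sub>R h - r *\<^sub>R x)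
      = (k * c * p) *\<^sub>R e + (k * q) *\<^sub>R h + (k * (c * a) - k * r) *\<^sub>R x" for k p q r :: real
    by (simp add: scaleR_add_right scaleR_diff_right scaleR_diff_left mult.assoc)
  have "christoffel hyp_metric x h (height_grad e x) =
     (2 / m) *\<^sub>R (c *\<^sub>R ((m / 2) *\<^sub>R e + a *\<^sub>R x) + (m / 2 * a + a * (1 - m)) *\<^sub>R h - (m / 2 * b + a * c) *\<^sub>R x)"
    unfolding christoffel_hyp_metric[OF assms] 1 2 unfolding height_grad_def m3 abc ..
  also have "\<dots> = ((2 / m) * c * (m / 2)) *\<^sub>R e + ((2 / m) * (m / 2 * a + a * (1 - m))) *\<^sub>R h
      + ((2 / m) * (c * a) - (2 / m) * (m / 2 * b + a * c)) *\<^sub>R x"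
    by (rule 4)
  finally show ?thesis unfolding 3 by (simp add: abc algebra_simps)
qed

lemma height_grad_norm:
  assumes "x \<in> hyp" "norm e = 1"
  shows "hyp_metric x (height_grad e x) (height_grad e x) = 1 + (hyp_height e x)\<^sup>2"
proof -
  define m where "m = 1 - (norm x)\<^sup>2"
  have m: "m \<noteq> 0" "(norm x)\<^sup>2 = 1 - m" using norm_square_less_1[OF assms(1)] by (simp_all add: m_def)
  have xx: "x \<bullet> x = 1 - m" "e \<bullet> e = 1"
    using m(2) assms(2) by (simp_all flip: power2_norm_eq_inner)
  show ?thesis
    using m(1) unfolding hyp_metric_def height_grad_def hyp_height_def m(2)
    by (simp add: inner_add_left inner_add_right xx inner_commute field_simps power2_eq_square)
qed

lemma height_grad_nonzero: "x \<in> hyp \<Longrightarrow> norm e = 1 \<Longrightarrow> height_grad e x \<noteq> 0"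
  using height_grad_norm[of x e] by (auto simp: hyp_metric_simps power2_eq_square)
    (smt (verit) zero_le_square)

lemma sinh_plane_dist: "sinh (plane_dist e x) = hyp_height e x"
  by (simp add: plane_dist_def)

lemma cosh_plane_dist_square: "(cosh (plane_dist e x))\<^sup>2 = 1 + (hyp_height e x)\<^sup>2"
  by (simp add: cosh_square_eq sinh_plane_dist add.commute)

lemma height_grad_cosh:
  assumes "x \<in> hyp" "norm e = 1"
  shows "hyp_metric x (height_grad e x) (height_grad e x) = (cosh (plane_dist e x))\<^sup>2"
  using height_grad_norm[OF assms] by (simp add: cosh_plane_dist_square)

lemma plane_dist_has_derivative:
  assumes "x \<in> hyp"
  shows "(plane_dist e has_derivative
     (\<lambda>h. hyp_metric x (height_grad e x) h / cosh (plane_dist e x))) (at x)"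
proof -
  have "((\<lambda>x. arsinh (hyp_height e x)) has_derivative
     (\<lambda>h. hyp_metric x (height_grad e x) h * (1 / sqrt ((hyp_height e x)\<^sup>2 + 1)))) (at x)"
    using has_derivative_compose[OF height_has_derivative[OF assms, of e]
        arsinh_real_has_field_derivative[of _ UNIV, unfolded has_field_derivative_def]] 
    by (simp add: mult.commute)
  then show ?thesis
    by (simp add: plane_dist_def[abs_def] cosh_arsinh_real)
qed

text \<open>The gradient of \<open>plane_dist e\<close> has length 1.\<close>

lemma plane_dist_Lipschitz:
  assumes "x \<in> hyp" "norm e = 1"
  shows "\<bar>hyp_metric x (height_grad e x) h / cosh (plane_dist e x)\<bar> \<le> sqrt (hyp_metric x h h)"
proof -
  have c: "sqrt (hyp_metric x (height_grad e x) (height_grad e x)) = cosh (plane_dist e x)"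
    using height_grad_norm[OF assms] by (simp add: plane_dist_def cosh_arsinh_real add.commute)
  show ?thesis
    using hyp_metric_Cauchy_Schwarz[of x "height_grad e x" h] unfolding c
    by (simp add: abs_div field_simps)
qed

lemma continuous_plane_dist: "x \<in> hyp \<Longrightarrow> isCont (plane_dist e) x"
  using has_derivative_continuous[OF plane_dist_has_derivative] .

lemma Ck_on_plane_dist: "Ck_on k (plane_dist e) hyp"
proof -
  have n: "1 - x \<bullet> x > 0" if "x \<in> hyp" for x :: "real ^ 'a"
    using norm_square_less_1[OF that] by (simp add: power2_norm_eq_inner)
  have "Ck_on k (\<lambda>x. 2 * (e \<bullet> x) * (1 - x \<bullet> x) powr (- 1)) hyp"
    by (intro Ck_on_mult Ck_on_powr_comp Ck_on_diff Ck_on_const Ck_on_subset[OF Ck_on_inner_self]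
        Ck_on_linear bounded_linear_intros open_ball) (use n in auto)
  then have "Ck_on k (\<lambda>x. arsinh (2 * (e \<bullet> x) * (1 - x \<bullet> x) powr (- 1))) hyp"
    by (intro Ck_on_compose[OF open_ball open_UNIV Ck_on_arsinh]) auto
  moreover have "arsinh (2 * (e \<bullet> x) * (1 - x \<bullet> x) powr (- 1)) = plane_dist e x" if "x \<in> hyp" for x
    using n[OF that] by (simp add: plane_dist_def hyp_height_def power2_norm_eq_inner powr_minus_divide)
  ultimately show ?thesis
    using Ck_on_cong[OF open_ball, of 0 1 "\<lambda>x. arsinh (2 * (e \<bullet> x) * (1 - x \<bullet> x) powr (- 1))" "plane_dist e" k]
    by blast
qed


section \<open>Hyperboloid coordinates\<close>

text \<open>The spatial part of the point of the hyperboloid over \<open>x\<close>. In these coordinates geodesics,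
  translations and equidistant hypersurfaces become linear.\<close>

definition hyperboloid :: "real ^ 'n \<Rightarrow> real ^ 'n" where
  "hyperboloid x = (2 / (1 - (norm x)\<^sup>2)) *\<^sub>R x"

definition ball_point :: "real ^ 'n \<Rightarrow> real ^ 'n" where
  "ball_point y = (1 / (1 + sqrt (1 + (norm y)\<^sup>2))) *\<^sub>R y"

lemma inner_hyperboloid: "e \<bullet> hyperboloid x = hyp_height e x"
  by (simp add: hyperboloid_def hyp_height_def)

lemma ball_point_hyperboloid:
  assumes "x \<in> hyp" shows "ball_point (hyperboloid x) = x"
proof -
  define m where "m = 1 - (norm x)\<^sup>2"
  have m: "0 < m" "m \<le> 1" "(norm x)\<^sup>2 = 1 - m"
    using norm_square_less_1[OF assms] by (simp_all add: m_def)
  have "1 + (norm (hyperboloid x))\<^sup>2 = ((2 - m) / m)\<^sup>2"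
    using m(1) by (simp add: hyperboloid_def power_mult_distrib m(3) power_divide)
      (simp add: field_simps power2_eq_square)
  then have "sqrt (1 + (norm (hyperboloid x))\<^sup>2) = (2 - m) / m"
    using m by (simp add: real_sqrt_unique)
  then have "1 / (1 + sqrt (1 + (norm (hyperboloid x))\<^sup>2)) * (2 / m) = 1"
    using m by (simp add: field_simps)
  then show ?thesis
    by (simp add: ball_point_def hyperboloid_def m(3))
qed

lemma hyperboloid_ball_point:
  shows "ball_point y \<in> hyp" and "hyperboloid (ball_point y) = y"
proof -
  define k where "k = sqrt (1 + (norm y)\<^sup>2)"
  have k: "k \<ge> 1" "(norm y)\<^sup>2 = (k - 1) * (k + 1)"
    by (simp_all add: k_def algebra_simps power2_eq_square)
  have n: "(norm (ball_point y))\<^sup>2 = (k - 1) / (k + 1)"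
  proof -
    have "norm (ball_point y) = norm y / (1 + k)"
      using k(1) by (simp add: ball_point_def k_def[symmetric] abs_of_pos del: real_sqrt_abs)
    then show ?thesis
      using k by (simp add: power_divide) (simp add: divide_simps power2_eq_square add.commute)
  qed
  also have "\<dots> < 1" using k(1) by (simp add: divide_less_eq)
  finally have "(norm (ball_point y))\<^sup>2 < 1" .
  then show "ball_point y \<in> hyp" by (simp add: abs_square_less_1)
  have "2 / (1 - (norm (ball_point y))\<^sup>2) * (1 / (1 + k)) = 1"
    using k unfolding n by (simp add: field_simps)
  then show "hyperboloid (ball_point y) = y"
    by (simp add: hyperboloid_def) (simp add: ball_point_def k_def)
qed

lemma hyperboloid_inj: "x \<in> hyp \<Longrightarrow> y \<in> hyp \<Longrightarrow> hyperboloid x = hyperboloid y \<Longrightarrow> x = y"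
  using ball_point_hyperboloid by metis

lemma plane_dist_ball_point: "plane_dist e (ball_point y) = arsinh (e \<bullet> y)"
  using inner_hyperboloid[of e "ball_point y"] by (simp add: plane_dist_def hyperboloid_ball_point)

lemma ball_point_differentiable: "ball_point differentiable (at y)"
proof -
  have p: "1 + y \<bullet> y > 0" by (simp add: add_pos_nonneg)
  have "((\<lambda>s. 1 / (1 + sqrt (1 + s))) has_real_derivative
      - (inverse (sqrt (1 + y \<bullet> y)) / 2) / (1 + sqrt (1 + y \<bullet> y))\<^sup>2) (at (y \<bullet> y))"
    using p by (auto intro!: derivative_eq_intros simp: power2_eq_square) (smt (verit) real_sqrt_ge_zero)
  moreover have "((\<lambda>x. x \<bullet> x) has_derivative (\<lambda>h. 2 * (y \<bullet> h))) (at y)"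
    by (auto intro!: derivative_eq_intros simp: inner_commute)
  ultimately have "((\<lambda>y. 1 / (1 + sqrt (1 + y \<bullet> y))) has_derivative
      (\<lambda>h. 2 * (y \<bullet> h) * (- (inverse (sqrt (1 + y \<bullet> y)) / 2) / (1 + sqrt (1 + y \<bullet> y))\<^sup>2))) (at y)"
    by (rule DERIV_compose_FDERIV)
  from has_derivative_scaleR[OF this has_derivative_ident] show ?thesis
    unfolding ball_point_def[abs_def] power2_norm_eq_inner differentiable_def by blast
qed

lemma hyperboloid_differentiable: 
  assumes "x \<in> hyp" shows "hyperboloid differentiable (at x)"
proof -
  have n: "1 - x \<bullet> x \<noteq> 0" using norm_square_less_1[OF assms] by (simp add: power2_norm_eq_inner)
  have "((\<lambda>s. 2 / (1 - s)) has_real_derivative 2 / (1 - x \<bullet> x)\<^sup>2) (at (x \<bullet> x))"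
    using n by (auto intro!: derivative_eq_intros simp: divide_simps power2_eq_square)
  moreover have "((\<lambda>x. x \<bullet> x) has_derivative (\<lambda>h. 2 * (x \<bullet> h))) (at x)"
    by (auto intro!: derivative_eq_intros simp: inner_commute)
  ultimately have "((\<lambda>q. 2 / (1 - q \<bullet> q)) has_derivative (\<lambda>h. 2 * (x \<bullet> h) * (2 / (1 - x \<bullet> x)\<^sup>2))) (at x)"
    by (rule DERIV_compose_FDERIV)
  from has_derivative_scaleR[OF this has_derivative_ident] show ?thesis
    unfolding hyperboloid_def[abs_def] power2_norm_eq_inner differentiable_def by blast
qed


section \<open>Geodesics through the origin\<close>

lemma tanh_surj: assumes "\<bar>t\<bar> < (1::real)" obtains s where "tanh s = t"
proof
  have p: "(1 + t) / (1 - t) > 0" using assms by (intro divide_pos_pos) auto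
  have "tanh (ln (sqrt ((1 + t) / (1 - t)))) = ((1 + t) / (1 - t) - 1) / ((1 + t) / (1 - t) + 1)"
    using p by (subst tanh_ln_real) auto
  also have "\<dots> = t" using assms by (simp add: field_simps)
  finally show "tanh (ln (sqrt ((1 + t) / (1 - t)))) = t" .
qed

text \<open>The half-angle formulas, multiplied out so that no denominators occur.\<close>

lemma tanh_half:
  fixes s :: real
  shows "sinh s * (1 - (tanh (s/2))\<^sup>2) = 2 * tanh (s/2)" and "cosh s * (1 - (tanh (s/2))\<^sup>2) = 1 + (tanh (s/2))\<^sup>2"
    and "(tanh (s/2))\<^sup>2 < 1"
proof -
  define C S where CS: "C = cosh (s/2)" "S = sinh (s/2)"
  have C: "C > 0" by (simp add: CS)
  have CC: "C\<^sup>2 = S\<^sup>2 + 1" using cosh_square_eq[of "s/2"] by (simp add: CS)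
  have t: "tanh (s/2) = S / C" by (simp add: tanh_def CS)
  have s: "sinh s = 2 * S * C" "cosh s = C\<^sup>2 + S\<^sup>2"
    using sinh_double[of "s/2"] cosh_double[of "s/2"] by (simp_all add: CS)
  have q: "1 - (S / C)\<^sup>2 = 1 / C\<^sup>2"
  proof -
    have "S\<^sup>2 + 1 \<noteq> 0" using C CC by auto
    then show ?thesis using CC by (simp add: power_divide eq_divide_eq left_diff_distrib)
  qed
  show "sinh s * (1 - (tanh (s/2))\<^sup>2) = 2 * tanh (s/2)" "cosh s * (1 - (tanh (s/2))\<^sup>2) = 1 + (tanh (s/2))\<^sup>2"
    unfolding t s q using C by (simp_all add: field_simps power2_eq_square)
  show "(tanh (s/2))\<^sup>2 < 1" using q C unfolding t by (smt (verit) divide_pos_pos zero_less_power)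
qed

lemma tanh_half_has_derivative:
  "((\<lambda>s. tanh (s/2)) has_real_derivative (1 - (tanh (s/2))\<^sup>2) / 2) (at s)"
  by (auto intro!: derivative_eq_intros)

lemma hyperboloid_radial: "norm w = 1 \<Longrightarrow> hyperboloid (tanh (s/2) *\<^sub>R w) = sinh s *\<^sub>R w"
  using tanh_half(1,3)[of s] by (simp add: hyperboloid_def power_mult_distrib field_simps)

lemma radial_geodesic:
  assumes "norm w = 1"
  shows "geodesic_through_0 (\<lambda>s. tanh (s/2) *\<^sub>R w)"
  unfolding geodesic_through_0_def unit_speed_geodesic_def
proof (intro conjI exI allI)
  fix s :: real
  define t where "t = tanh (s/2)"
  have t1: "t\<^sup>2 < 1" using tanh_half(3) by (simp add: t_def)
  have ww: "w \<bullet> w = 1" using assms by (simp flip: power2_norm_eq_inner)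
  have n: "(norm (t *\<^sub>R w))\<^sup>2 = t\<^sup>2" using assms by (simp add: power_mult_distrib)
  show hyp: "tanh (s/2) *\<^sub>R w \<in> hyp"
    using t1 assms by (simp add: t_def abs_square_less_1)
  show "((\<lambda>s. tanh (s/2) *\<^sub>R w) has_vector_derivative ((1 - (tanh (s/2))\<^sup>2) / 2) *\<^sub>R w) (at s)"
    using has_vector_derivative_scaleR[OF tanh_half_has_derivative has_vector_derivative_const[of w]] by simp
  show "hyp_metric (tanh (s/2) *\<^sub>R w) (((1 - (tanh (s/2))\<^sup>2) / 2) *\<^sub>R w) (((1 - (tanh (s/2))\<^sup>2) / 2) *\<^sub>R w) = 1"
  proof -
    have "4 / m\<^sup>2 * (m / 2 * (m / 2)) = 1" if "m \<noteq> 0" for m :: real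
      using that by (simp add: power2_eq_square)
    from this[of "1 - t\<^sup>2"] show ?thesis
      using t1 unfolding t_def[symmetric] hyp_metric_def n by (simp add: ww)
  qed
  have d: "((\<lambda>s. (1 - (tanh (s/2))\<^sup>2) / 2) has_real_derivative - (t * (1 - t\<^sup>2) / 2)) (at s)"
    using tanh_half_has_derivative by (auto intro!: derivative_eq_intros simp: t_def)
  have "christoffel hyp_metric (t *\<^sub>R w) (((1 - t\<^sup>2) / 2) *\<^sub>R w) (((1 - t\<^sup>2) / 2) *\<^sub>R w) = (t * (1 - t\<^sup>2) / 2) *\<^sub>R w"
  proof -
    define m where "m = (1 - t\<^sup>2) / 2"
    have m: "m \<noteq> 0" "1 - t\<^sup>2 = 2 * m" using t1 by (auto simp: m_def)
    have "christoffel hyp_metric (t *\<^sub>R w) (m *\<^sub>R w) (m *\<^sub>R w)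
        = (2 / (2 * m) * (m * (t * m) + m * (t * m) - m * (m * t))) *\<^sub>R w"
      using hyp unfolding t_def[symmetric]
      by (simp only: christoffel_hyp_metric n m(2) inner_scaleR_left inner_scaleR_right ww
          scaleR_scaleR scaleR_left_distrib[symmetric] scaleR_left_diff_distrib[symmetric] mult_1_right mult.assoc)
    also have "2 / (2 * m) * (m * (t * m) + m * (t * m) - m * (m * t)) = t * m"
      using m(1) by (simp add: field_simps)
    finally show ?thesis by (simp add: m_def)
  qed
  then show "((\<lambda>s. ((1 - (tanh (s/2))\<^sup>2) / 2) *\<^sub>R w) has_vector_derivative
      - christoffel hyp_metric (tanh (s/2) *\<^sub>R w) (((1 - (tanh (s/2))\<^sup>2) / 2) *\<^sub>R w) (((1 - (tanh (s/2))\<^sup>2) / 2) *\<^sub>R w)) (at s)"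
    using has_vector_derivative_scaleR[OF d has_vector_derivative_const[of w]] by (simp add: t_def)
qed simp

text \<open>The combinations \<open>p' - p\<close> and \<open>p' + p\<close> solve first-order equations, which replaces a general
  uniqueness theorem for the geodesic equation.\<close>

lemma second_order_ode_sinh:
  fixes p :: "real \<Rightarrow> real"
  assumes "\<And>s. (p has_real_derivative p' s) (at s)" "\<And>s. (p' has_real_derivative p s) (at s)" "p 0 = 0"
  shows "p s = p' 0 * sinh s"
proof -
  have "((\<lambda>s. (p' s - p s) * exp s) has_real_derivative 0) (at s)" for s
    using assms(1,2) by (auto intro!: derivative_eq_intros simp: algebra_simps)
  then have 1: "(p' s - p s) * exp s = (p' 0 - p 0) * exp 0"
    using DERIV_isconst_all[of "\<lambda>s. (p' s - p s) * exp s" s 0] by blast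
  have "((\<lambda>s. (p' s + p s) * exp (- s)) has_real_derivative 0) (at s)" for s
    using assms(1,2) by (auto intro!: derivative_eq_intros simp: algebra_simps)
  then have 2: "(p' s + p s) * exp (- s) = (p' 0 + p 0) * exp (- 0)"
    using DERIV_isconst_all[of "\<lambda>s. (p' s + p s) * exp (- s)" s 0] by blast
  have "p' s - p s = p' 0 * exp (- s)" "p' s + p s = p' 0 * exp s"
    using 1 2 assms(3) by (simp_all add: exp_minus field_simps)
  then show ?thesis by (simp add: sinh_def field_simps)
qed

lemmas has_vector_derivative_inner = bounded_bilinear.has_vector_derivative[OF bounded_bilinear_inner]

text \<open>Along a unit speed geodesic every height function satisfies \<open>p'' = p\<close>, because its Hessian is \<open>p\<close> times
  the metric. Hence in hyperboloid coordinates the geodesic is \<open>sinh s *\<^sub>R e\<close>.\<close>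

lemma geodesic_through_0_radial:
  assumes "geodesic_through_0 \<gamma>"
  obtains e where "norm e = 1" "\<gamma> = (\<lambda>s. tanh (s/2) *\<^sub>R e)"
proof -
  obtain \<gamma>' where g: "\<And>s. \<gamma> s \<in> hyp" "\<And>s. (\<gamma> has_vector_derivative \<gamma>' s) (at s)"
     "\<And>s. hyp_metric (\<gamma> s) (\<gamma>' s) (\<gamma>' s) = 1"
     "\<And>s. (\<gamma>' has_vector_derivative - christoffel hyp_metric (\<gamma> s) (\<gamma>' s) (\<gamma>' s)) (at s)" "\<gamma> 0 = 0"
    using assms unfolding geodesic_through_0_def unit_speed_geodesic_def by blast
  define e where "e = 2 *\<^sub>R \<gamma>' 0"
  have "(norm e)\<^sup>2 = 1" using g(3)[of 0] g(5) 
    by (simp add: e_def hyp_metric_def power_mult_distrib power2_norm_eq_inner)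
  then have e: "norm e = 1" by (metis norm_ge_zero one_power2 power2_eq_iff_nonneg zero_le_one)
  have H: "hyp_height w (\<gamma> s) = (w \<bullet> e) * sinh s" for w s
  proof -
    \<comment> \<open>\<open>m\<close> is the conformal factor along the geodesic, \<open>m * P\<close> the height\<close>
    define m where "m s = 2 / (1 - \<gamma> s \<bullet> \<gamma> s)" for s
    define P Q B C where "P s = w \<bullet> \<gamma> s" and "Q s = w \<bullet> \<gamma>' s" and "B s = \<gamma> s \<bullet> \<gamma>' s" and "C s = \<gamma>' s \<bullet> \<gamma>' s" for s
    have nz: "1 - \<gamma> s \<bullet> \<gamma> s \<noteq> 0" for s
      using norm_square_less_1[OF g(1)[of s]] by (simp add: power2_norm_eq_inner)
    have mA: "m s * (\<gamma> s \<bullet> \<gamma> s) = m s - 2" for s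
      using nz[of s] by (simp add: m_def field_simps)
    \<comment> \<open>unit speed\<close>
    have mC: "(m s)\<^sup>2 * C s = 1" for s
    proof -
      have "(2::real)\<^sup>2 = 4" by simp
      then show ?thesis
        using g(3)[of s] by (simp only: m_def C_def hyp_metric_def power2_norm_eq_inner power_divide)
    qed
    \<comment> \<open>the geodesic equation\<close>
    have acc: "- christoffel hyp_metric (\<gamma> s) (\<gamma>' s) (\<gamma>' s) = (m s * C s) *\<^sub>R \<gamma> s - (2 * m s * B s) *\<^sub>R \<gamma>' s" for s
    proof -
      have "christoffel hyp_metric (\<gamma> s) (\<gamma>' s) (\<gamma>' s) = m s *\<^sub>R (B s *\<^sub>R \<gamma>' s + B s *\<^sub>R \<gamma>' s - C s *\<^sub>R \<gamma> s)"
        by (simp only: christoffel_hyp_metric[OF g(1)] power2_norm_eq_inner m_def B_def C_def)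
      moreover
      have "2 * m s * B s = m s * (B s + B s)" by simp
      ultimately show ?thesis by (simp only: scaleR_diff_right scaleR_scaleR minus_diff_eq flip: scaleR_left_distrib)
    qed
    have dA: "((\<lambda>s. \<gamma> s \<bullet> \<gamma> s) has_real_derivative 2 * B s) (at s)" for s
      using has_vector_derivative_inner[OF g(2) g(2), of s]
      by (simp add: has_real_derivative_iff_has_vector_derivative B_def inner_commute)
    have dP: "(P has_real_derivative Q s) (at s)" for s
      using has_vector_derivative_inner[OF has_vector_derivative_const[of w] g(2), of s]
      by (simp add: has_real_derivative_iff_has_vector_derivative P_def[abs_def] Q_def)
    have dQ: "(Q has_real_derivative m s * C s * P s - 2 * m s * B s * Q s) (at s)" for s
      using has_vector_derivative_inner[OF has_vector_derivative_const[of w] g(4), of s] unfolding acc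
      by (simp add: has_real_derivative_iff_has_vector_derivative P_def Q_def[abs_def] inner_diff_right)
    have dB: "(B has_real_derivative C s + m s * C s * (\<gamma> s \<bullet> \<gamma> s) - 2 * m s * (B s)\<^sup>2) (at s)" for s
      using has_vector_derivative_inner[OF g(2) g(4), of s] unfolding acc
      by (simp add: has_real_derivative_iff_has_vector_derivative B_def[abs_def] C_def inner_diff_right power2_eq_square algebra_simps)
    have dm: "(m has_real_derivative (m s)\<^sup>2 * B s) (at s)" for s
      unfolding m_def[abs_def] using dA[of s] nz[of s]
      by (auto intro!: derivative_eq_intros simp: power2_eq_square field_simps)
    have "((\<lambda>s. m s * Q s + (m s)\<^sup>2 * P s * B s) has_real_derivative
        ((m s)\<^sup>2 * B s * Q s + m s * (m s * C s * P s - 2 * m s * B s * Q s)) +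
        (2 * m s * ((m s)\<^sup>2 * B s) * P s * B s + (m s)\<^sup>2 * Q s * B s
        + (m s)\<^sup>2 * P s * (C s + m s * C s * (\<gamma> s \<bullet> \<gamma> s) - 2 * m s * (B s)\<^sup>2))) (at s)" for s
      using dm[of s] dQ[of s] dP[of s] dB[of s]
      by (auto intro!: derivative_eq_intros) (simp add: algebra_simps power2_eq_square)
    moreover have "((m s)\<^sup>2 * B s * Q s + m s * (m s * C s * P s - 2 * m s * B s * Q s)) +
        (2 * m s * ((m s)\<^sup>2 * B s) * P s * B s + (m s)\<^sup>2 * Q s * B s
        + (m s)\<^sup>2 * P s * (C s + m s * C s * (\<gamma> s \<bullet> \<gamma> s) - 2 * m s * (B s)\<^sup>2)) = m s * P s" for s
    proof -
      have "((m s)\<^sup>2 * B s * Q s + m s * (m s * C s * P s - 2 * m s * B s * Q s)) +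
        (2 * m s * ((m s)\<^sup>2 * B s) * P s * B s + (m s)\<^sup>2 * Q s * B s
        + (m s)\<^sup>2 * P s * (C s + m s * C s * (\<gamma> s \<bullet> \<gamma> s) - 2 * m s * (B s)\<^sup>2))
        = ((m s)\<^sup>2 * C s) * P s * (2 + m s * (\<gamma> s \<bullet> \<gamma> s))"
        by (simp add: algebra_simps power2_eq_square)
      then show ?thesis unfolding mA mC by simp
    qed
    ultimately have 2: "((\<lambda>s. m s * Q s + (m s)\<^sup>2 * P s * B s) has_real_derivative m s * P s) (at s)" for s
      by simp
    have 1: "((\<lambda>s. m s * P s) has_real_derivative m s * Q s + (m s)\<^sup>2 * P s * B s) (at s)" for s
      using DERIV_mult[OF dm[of s] dP[of s]] by (simp add: algebra_simps)
    have "m s * P s = (m 0 * Q 0 + (m 0)\<^sup>2 * P 0 * B 0) * sinh s"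
      by (rule second_order_ode_sinh[OF 1 2]) (simp add: P_def g(5))
    then show ?thesis
      by (simp add: m_def P_def Q_def g(5) e_def hyp_height_def power2_norm_eq_inner)
  qed
  have "\<gamma> s = tanh (s/2) *\<^sub>R e" for s
  proof (rule hyperboloid_inj[OF g(1)])
    show "tanh (s/2) *\<^sub>R e \<in> hyp"
      using radial_geodesic[OF e] by (auto simp: geodesic_through_0_def unit_speed_geodesic_def)
    have "w \<bullet> hyperboloid (\<gamma> s) = w \<bullet> (sinh s *\<^sub>R e)" for w
      unfolding inner_hyperboloid H by simp
    then have "hyperboloid (\<gamma> s) = sinh s *\<^sub>R e"
      by (metis vector_eq_rdot inner_commute)
    then show "hyperboloid (\<gamma> s) = hyperboloid (tanh (s/2) *\<^sub>R e)"
      by (simp add: hyperboloid_radial[OF e])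
  qed
  then show thesis using that e by blast
qed

lemma vector_derivative_radial:
  "vector_derivative (\<lambda>s. tanh (s/2) *\<^sub>R e) (at 0) = (1/2) *\<^sub>R e"
proof (rule vector_derivative_at)
  show "((\<lambda>s. tanh (s/2) *\<^sub>R e) has_vector_derivative (1/2) *\<^sub>R e) (at 0)"
    using has_vector_derivative_scaleR[OF tanh_half_has_derivative[of 0] has_vector_derivative_const[of e]] by simp
qed

text \<open>The dimension must be at least 2 for the origin itself: on a line no geodesic is orthogonal to the
  given one.\<close>

lemma orth_hyperplane_radial:
  fixes e :: "real ^ 'n"
  assumes "CARD('n) \<ge> 2" "norm e = 1"
  shows "orth_hyperplane (\<lambda>s. tanh (s/2) *\<^sub>R e) = {x \<in> hyp. e \<bullet> x = 0}"
proof (intro equalityI subsetI)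
  fix x assume "x \<in> orth_hyperplane (\<lambda>s. tanh (s/2) *\<^sub>R e)"
  then obtain \<sigma> s where s: "x = \<sigma> s" "geodesic_through_0 \<sigma>"
    "hyp_metric 0 (vector_derivative \<sigma> (at 0)) (vector_derivative (\<lambda>s. tanh (s/2) *\<^sub>R e) (at 0)) = 0"
    unfolding orth_hyperplane_def by blast
  obtain w where w: "norm w = 1" "\<sigma> = (\<lambda>s. tanh (s/2) *\<^sub>R w)"
    using geodesic_through_0_radial[OF s(2)] .
  have "e \<bullet> w = 0"
    using s(3) unfolding w(2) vector_derivative_radial by (simp add: hyp_metric_def inner_commute)
  moreover have "x \<in> hyp"
    using s(1,2) unfolding geodesic_through_0_def unit_speed_geodesic_def by blast
  ultimately show "x \<in> {x \<in> hyp. e \<bullet> x = 0}"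
    by (simp add: s(1) w(2))
next
  fix x assume "x \<in> {x \<in> hyp. e \<bullet> x = 0}"
  then have x: "norm x < 1" "e \<bullet> x = 0" by auto
  obtain y where y: "y \<noteq> 0" "orthogonal e y"
    using orthogonal_to_vector_exists[of e] assms(1) by auto
  \<comment> \<open>any direction orthogonal to \<open>e\<close> serves for the origin\<close>
  define z where "z = (if x = 0 then y else x)"
  define w where "w = z /\<^sub>R norm z"
  have z: "z \<noteq> 0" "e \<bullet> z = 0" using x y by (auto simp: z_def orthogonal_def)
  have w: "norm w = 1" "e \<bullet> w = 0" using z by (simp_all add: w_def)
  obtain s where "tanh s = norm x" using tanh_surj[of "norm x"] x(1) by auto
  then have "x = (\<lambda>s. tanh (s/2) *\<^sub>R w) (2 * s)"
    by (auto simp: w_def z_def)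
  moreover have "hyp_metric 0 (vector_derivative (\<lambda>s. tanh (s/2) *\<^sub>R w) (at 0)) (vector_derivative (\<lambda>s. tanh (s/2) *\<^sub>R e) (at 0)) = 0"
    unfolding vector_derivative_radial using w(2) by (simp add: hyp_metric_def inner_commute)
  ultimately show "x \<in> orth_hyperplane (\<lambda>s. tanh (s/2) *\<^sub>R e)"
    unfolding orth_hyperplane_def mem_Collect_eq
    by (intro exI[of _ "\<lambda>s. tanh (s/2) *\<^sub>R w"] exI[of _ "2 * s"] conjI radial_geodesic[OF w(1)])
qed


section \<open>Hyperbolic translations and the signed distance\<close>

lemma hyp_translation_radial:
  assumes "norm e = 1" "e \<bullet> b = 0"
  shows "hyp_translation b (t *\<^sub>R e) =
     (1 / (1 + (norm b)\<^sup>2 * t\<^sup>2)) *\<^sub>R ((1 + t\<^sup>2) *\<^sub>R b + ((1 - (norm b)\<^sup>2) * t) *\<^sub>R e)"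
proof -
  have "b \<bullet> e = 0" using assms(2) by (simp add: inner_commute)
  then show ?thesis using assms(1) by (simp add: hyp_translation_def power_mult_distrib)
qed

lemma norm_hyp_translation_radial:
  assumes "norm e = 1" "e \<bullet> b = 0"
  shows "1 - (norm (hyp_translation b (t *\<^sub>R e)))\<^sup>2
     = (1 - (norm b)\<^sup>2) * (1 - t\<^sup>2) / (1 + (norm b)\<^sup>2 * t\<^sup>2)"
proof -
  define B where "B = (norm b)\<^sup>2"
  have d: "1 + B * t\<^sup>2 \<noteq> 0" by (smt (verit) B_def mult_nonneg_nonneg zero_le_power2)
  have ee: "e \<bullet> e = 1" using assms(1) by (simp flip: power2_norm_eq_inner)
  have "(norm ((1 + t\<^sup>2) *\<^sub>R b + ((1 - B) * t) *\<^sub>R e))\<^sup>2 = (1 + t\<^sup>2)\<^sup>2 * B + ((1 - B) * t)\<^sup>2"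
    unfolding B_def power2_norm_eq_inner using assms(2)
    by (simp add: inner_add_left inner_add_right inner_commute ee power2_eq_square)
  then have "(norm (hyp_translation b (t *\<^sub>R e)))\<^sup>2 = ((1 + t\<^sup>2)\<^sup>2 * B + ((1 - B) * t)\<^sup>2) / (1 + B * t\<^sup>2)\<^sup>2"
    unfolding hyp_translation_radial[OF assms] B_def[symmetric] norm_scaleR power_mult_distrib
    by (simp add: power_divide)
  also have "(1 + t\<^sup>2)\<^sup>2 * B + ((1 - B) * t)\<^sup>2 = (1 + B * t\<^sup>2) * ((1 + B * t\<^sup>2) - (1 - B) * (1 - t\<^sup>2))"
    by (simp add: power2_eq_square algebra_simps)
  finally show ?thesis
    using d by (simp add: power2_eq_square[of "1 + B * t\<^sup>2"] diff_divide_distrib flip: B_def)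
qed

text \<open>The translated geodesic is a hyperbola in hyperboloid coordinates. Its component along \<open>e\<close> is that
  of the original geodesic, so the translation preserves the height; the other component recovers \<open>b\<close>.\<close>

lemma hyp_translation_radial_coords:
  assumes "norm e = 1" "e \<bullet> b = 0" "b \<in> hyp"
  shows "hyp_translation b (tanh (s/2) *\<^sub>R e) \<in> hyp"
    and "hyperboloid (hyp_translation b (tanh (s/2) *\<^sub>R e)) = cosh s *\<^sub>R hyperboloid b + sinh s *\<^sub>R e"
proof -
  define t where "t = tanh (s/2)"
  define B where "B = (norm b)\<^sup>2"
  define K where "K = 1 + B * t\<^sup>2"
  have t: "t\<^sup>2 < 1" "sinh s * (1 - t\<^sup>2) = 2 * t" "cosh s * (1 - t\<^sup>2) = 1 + t\<^sup>2"
    using tanh_half[of s] by (simp_all add: t_def)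
  have B: "B < 1" using norm_square_less_1[OF assms(3)] by (simp add: B_def)
  have K: "K > 0" by (simp add: K_def B_def add_pos_nonneg)
  have n: "1 - (norm (hyp_translation b (t *\<^sub>R e)))\<^sup>2 = (1 - B) * (1 - t\<^sup>2) / K"
    using norm_hyp_translation_radial[OF assms(1,2)] by (simp add: B_def K_def)
  have "(1 - B) * (1 - t\<^sup>2) / K > 0"
    using B t(1) K by simp
  then have "(norm (hyp_translation b (t *\<^sub>R e)))\<^sup>2 < 1" using n by simp
  then show "hyp_translation b (tanh (s/2) *\<^sub>R e) \<in> hyp"
    by (simp add: t_def abs_square_less_1)
  have 1: "2 / ((1 - B) * (1 - t\<^sup>2) / K) * (1 / K) * (1 + t\<^sup>2) = cosh s * (2 / (1 - B))"
    using B K t(1) unfolding t(3)[symmetric] by simp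
  have 2: "2 / ((1 - B) * (1 - t\<^sup>2) / K) * (1 / K) * ((1 - B) * t) = sinh s"
  proof -
    have "2 / ((1 - B) * (1 - t\<^sup>2) / K) * (1 / K) * ((1 - B) * t) = 2 * t / (1 - t\<^sup>2)"
      using B K t(1) by simp
    then show ?thesis using t(1) unfolding t(2)[symmetric] by simp
  qed
  have "hyperboloid (hyp_translation b (t *\<^sub>R e)) =
      (2 / ((1 - B) * (1 - t\<^sup>2) / K)) *\<^sub>R (1 / K) *\<^sub>R ((1 + t\<^sup>2) *\<^sub>R b + ((1 - B) * t) *\<^sub>R e)"
    unfolding hyperboloid_def n unfolding hyp_translation_radial[OF assms(1,2)] B_def K_def ..
  also have "\<dots> = (2 / ((1 - B) * (1 - t\<^sup>2) / K) * (1 / K) * (1 + t\<^sup>2)) *\<^sub>R b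
      + (2 / ((1 - B) * (1 - t\<^sup>2) / K) * (1 / K) * ((1 - B) * t)) *\<^sub>R e"
    by (simp only: scaleR_add_right scaleR_scaleR mult.assoc)
  also have "\<dots> = cosh s *\<^sub>R hyperboloid b + sinh s *\<^sub>R e"
    unfolding 1 2 by (simp add: hyperboloid_def B_def)
  finally show "hyperboloid (hyp_translation b (tanh (s/2) *\<^sub>R e)) = cosh s *\<^sub>R hyperboloid b + sinh s *\<^sub>R e"
    by (simp add: t_def)
qed

lemma plane_dist_translation:
  assumes "norm e = 1" "e \<bullet> b = 0" "b \<in> hyp"
  shows "plane_dist e (hyp_translation b (tanh (s/2) *\<^sub>R e)) = s"
proof -
  have "e \<bullet> e = 1" using assms(1) by (simp flip: power2_norm_eq_inner)
  moreover have "e \<bullet> hyperboloid b = 0" using assms(2) by (simp add: hyperboloid_def)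
  ultimately have "hyp_height e (hyp_translation b (tanh (s/2) *\<^sub>R e)) = sinh s"
    unfolding inner_hyperboloid[symmetric] hyp_translation_radial_coords(2)[OF assms]
    by (simp add: inner_add_right)
  then show ?thesis by (simp add: plane_dist_def arsinh_sinh_real)
qed

text \<open>The base point \<open>b\<close> is the foot of the perpendicular from \<open>x\<close> to the hyperplane, read off from the
  hyperboloid coordinates.\<close>

lemma hyp_eq_translation:
  assumes "norm e = 1" "x \<in> hyp"
  obtains b where "b \<in> hyp" "e \<bullet> b = 0" "x = hyp_translation b (tanh (plane_dist e x / 2) *\<^sub>R e)"
proof -
  define s where "s = plane_dist e x"
  define y where "y = (1 / cosh s) *\<^sub>R (hyperboloid x - sinh s *\<^sub>R e)"
  define b where "b = ball_point y"
  have ee: "e \<bullet> e = 1" using assms(1) by (simp flip: power2_norm_eq_inner)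
  have "e \<bullet> y = 0"
    by (simp add: y_def inner_diff_right inner_hyperboloid ee s_def sinh_plane_dist)
  then have b: "b \<in> hyp" "e \<bullet> b = 0"
    using hyperboloid_ball_point(1)[of y] by (simp_all only: b_def) (simp add: ball_point_def)
  have "hyperboloid (hyp_translation b (tanh (s/2) *\<^sub>R e)) = hyperboloid x"
    using hyp_translation_radial_coords(2)[OF assms(1) b(2,1)]
    by (simp add: b_def hyperboloid_ball_point(2) y_def)
  then have "hyp_translation b (tanh (s/2) *\<^sub>R e) = x"
    using hyperboloid_inj hyp_translation_radial_coords(1)[OF assms(1) b(2,1)] assms(2) by blast
  then show thesis unfolding s_def by (intro that[OF b]) simp
qed

lemma translation_hypersurface_eq_graph:
  assumes "CARD('n) \<ge> 2" "norm e = 1"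
  shows "translation_hypersurface (\<lambda>s. tanh (s/2) *\<^sub>R e) I \<mu>
     = graph_over {x \<in> hyp. plane_dist e x \<in> I} (\<lambda>x. \<mu> (plane_dist (e :: real ^ 'n) x))"
proof (intro equalityI subsetI)
  fix p assume "p \<in> translation_hypersurface (\<lambda>s. tanh (s/2) *\<^sub>R e) I \<mu>"
  then show "p \<in> graph_over {x \<in> hyp. plane_dist e x \<in> I} (\<lambda>x. \<mu> (plane_dist e x))"
    unfolding translation_hypersurface_def graph_over_def orth_hyperplane_radial[OF assms]
    using plane_dist_translation[OF assms(2)] hyp_translation_radial_coords(1)[OF assms(2)] by fastforce
next
  fix p assume "p \<in> graph_over {x \<in> hyp. plane_dist e x \<in> I} (\<lambda>x. \<mu> (plane_dist e x))"
  then obtain x where x: "x \<in> hyp" "plane_dist e x \<in> I" "p = (x, \<mu> (plane_dist e x))"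
    by (auto simp: graph_over_def)
  obtain b where "b \<in> hyp" "e \<bullet> b = 0" "x = hyp_translation b (tanh (plane_dist e x / 2) *\<^sub>R e)"
    using hyp_eq_translation[OF assms(2) x(1)] .
  then show "p \<in> translation_hypersurface (\<lambda>s. tanh (s/2) *\<^sub>R e) I \<mu>"
    unfolding translation_hypersurface_def orth_hyperplane_radial[OF assms]
    using x by blast
qed

text \<open>The images of the geodesic under a translation, parametrised proportionally to arc length, realise
  the distance to the hyperplane.\<close>

lemma orthogonal_geodesic_length:
  assumes "norm e = 1" "e \<bullet> b = 0" "b \<in> hyp"
  shows "\<bar>r\<bar> \<in> curve_lengths hyp_metric hyp b (hyp_translation b (tanh (r/2) *\<^sub>R e))"
proof -
  define B where "B = (norm b)\<^sup>2"
  have B: "0 \<le> B" "B < 1" using norm_square_less_1[OF assms(3)] by (simp_all add: B_def)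
  have ee: "e \<bullet> e = 1" using assms(1) by (simp flip: power2_norm_eq_inner)
  have K: "1 + B * t\<^sup>2 > 0" for t using B by (simp add: add_pos_nonneg)
  define t where "t s = tanh (r * s / 2)" for s
  have t1: "(t s)\<^sup>2 < 1" for s using tanh_half(3) by (simp add: t_def)
  have dt: "(t has_real_derivative r * (1 - (t s)\<^sup>2) / 2) (at s)" for s
    unfolding t_def[abs_def] by (auto intro!: derivative_eq_intros)
  define c where "c s = hyp_translation b (t s *\<^sub>R e)" for s
  have c: "c s = ((1 + (t s)\<^sup>2) / (1 + B * (t s)\<^sup>2)) *\<^sub>R b + ((1 - B) * t s / (1 + B * (t s)\<^sup>2)) *\<^sub>R e" for s
    unfolding c_def hyp_translation_radial[OF assms(1,2)] by (simp add: B_def scaleR_add_right)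
  define A where "A s = r * (1 - (t s)\<^sup>2) / 2" for s
  define D where "D s = (2 * t s * (1 - B) / (1 + B * (t s)\<^sup>2)\<^sup>2 * A s) *\<^sub>R b
     + ((1 - B) * (1 - B * (t s)\<^sup>2) / (1 + B * (t s)\<^sup>2)\<^sup>2 * A s) *\<^sub>R e" for s
  have "((\<lambda>t. (1 + t\<^sup>2) / (1 + B * t\<^sup>2)) has_real_derivative 2 * t * (1 - B) / (1 + B * t\<^sup>2)\<^sup>2) (at t)" for t
  proof -
    have "((\<lambda>t. (1 + t\<^sup>2) / (1 + B * t\<^sup>2)) has_real_derivative
        ((2 * t) * (1 + B * t\<^sup>2) - (1 + t\<^sup>2) * (B * (2 * t))) / ((1 + B * t\<^sup>2) * (1 + B * t\<^sup>2))) (at t)"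
      by (rule DERIV_divide) (use K[of t] in \<open>auto intro!: derivative_eq_intros\<close>)
    also have "(2 * t) * (1 + B * t\<^sup>2) - (1 + t\<^sup>2) * (B * (2 * t)) = 2 * t * (1 - B)"
      by (simp add: algebra_simps)
    finally show ?thesis by (simp only: power2_eq_square)
  qed
  from DERIV_chain2[OF this dt]
  have d1: "((\<lambda>s. (1 + (t s)\<^sup>2) / (1 + B * (t s)\<^sup>2)) has_real_derivative
     2 * t s * (1 - B) / (1 + B * (t s)\<^sup>2)\<^sup>2 * A s) (at s)" for s
    unfolding A_def .
  have "((\<lambda>t. (1 - B) * t / (1 + B * t\<^sup>2)) has_real_derivative (1 - B) * (1 - B * t\<^sup>2) / (1 + B * t\<^sup>2)\<^sup>2) (at t)" for t
  proof -
    have "((\<lambda>t. (1 - B) * t / (1 + B * t\<^sup>2)) has_real_derivative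
        ((1 - B) * (1 + B * t\<^sup>2) - (1 - B) * t * (B * (2 * t))) / ((1 + B * t\<^sup>2) * (1 + B * t\<^sup>2))) (at t)"
      by (rule DERIV_divide) (use K[of t] in \<open>auto intro!: derivative_eq_intros\<close>)
    also have "(1 - B) * (1 + B * t\<^sup>2) - (1 - B) * t * (B * (2 * t)) = (1 - B) * (1 - B * t\<^sup>2)"
      by (simp add: algebra_simps power2_eq_square)
    finally show ?thesis by (simp only: power2_eq_square)
  qed
  from DERIV_chain2[OF this dt]
  have d2: "((\<lambda>s. (1 - B) * t s / (1 + B * (t s)\<^sup>2)) has_real_derivative
     (1 - B) * (1 - B * (t s)\<^sup>2) / (1 + B * (t s)\<^sup>2)\<^sup>2 * A s) (at s)" for s
    unfolding A_def .
  have cD: "(c has_vector_derivative D s) (at s)" for s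
    unfolding c[abs_def] D_def
    using has_vector_derivative_add[OF has_vector_derivative_scaleR[OF d1 has_vector_derivative_const[of b]]
         has_vector_derivative_scaleR[OF d2 has_vector_derivative_const[of e]]] by simp
  have sp: "hyp_metric (c s) (D s) (D s) = r\<^sup>2" for s
  proof -
    have bb: "b \<bullet> b = B" by (simp add: B_def power2_norm_eq_inner)
    have "(p / k\<^sup>2 * a)\<^sup>2 * B + (q / k\<^sup>2 * a)\<^sup>2 = a\<^sup>2 * (p\<^sup>2 * B + q\<^sup>2) / (k\<^sup>2)\<^sup>2" for p q k a :: real
      by (simp add: power_divide power_mult_distrib add_divide_distrib algebra_simps)
    moreover have "D s \<bullet> D s = (2 * t s * (1 - B) / (1 + B * (t s)\<^sup>2)\<^sup>2 * A s)\<^sup>2 * B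
       + ((1 - B) * (1 - B * (t s)\<^sup>2) / (1 + B * (t s)\<^sup>2)\<^sup>2 * A s)\<^sup>2"
      unfolding D_def using assms(2)
      by (simp only: inner_add_left inner_add_right inner_commute[of b e] ee bb inner_scaleR_left inner_scaleR_right)
        (simp add: power2_eq_square)
    moreover have "(2 * t s * (1 - B))\<^sup>2 * B + ((1 - B) * (1 - B * (t s)\<^sup>2))\<^sup>2 = (1 - B)\<^sup>2 * (1 + B * (t s)\<^sup>2)\<^sup>2"
      by (simp add: power2_eq_square algebra_simps)
    ultimately have DD: "D s \<bullet> D s = (A s)\<^sup>2 * ((1 - B)\<^sup>2 * (1 + B * (t s)\<^sup>2)\<^sup>2) / ((1 + B * (t s)\<^sup>2)\<^sup>2)\<^sup>2"
      by simp
    then have "D s \<bullet> D s = (A s)\<^sup>2 * (1 - B)\<^sup>2 / (1 + B * (t s)\<^sup>2)\<^sup>2"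
    proof -
      have "a * (c * k) / k\<^sup>2 = a * c / k" if "k \<noteq> 0" for a c k :: real
        using that by (simp add: power2_eq_square)
      from this[of "(1 + B * (t s)\<^sup>2)\<^sup>2" "(A s)\<^sup>2" "(1 - B)\<^sup>2"] show ?thesis
        using K[of "t s"] unfolding DD by simp
    qed
    moreover have "1 - (norm (c s))\<^sup>2 = (1 - B) * (1 - (t s)\<^sup>2) / (1 + B * (t s)\<^sup>2)"
      unfolding c_def norm_hyp_translation_radial[OF assms(1,2)] B_def ..
    ultimately show ?thesis
      using B t1[of s] K[of "t s"]
      by (simp add: hyp_metric_def power_divide power_mult_distrib A_def)
  qed
  have tc: "continuous_on {0..1} t"
    by (rule DERIV_continuous_on[OF has_field_derivative_at_within[OF dt]])
  have cont: "continuous_on {0..1} D"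
    unfolding D_def A_def using K tc
    by (intro continuous_intros) (auto simp: less_imp_neq[symmetric])
  have "integral {0..1} (\<lambda>s. sqrt (hyp_metric (c s) (D s) (D s))) \<in> curve_lengths hyp_metric hyp (c 0) (c 1)"
  proof (rule C1_curve_length[OF cD cont])
    show "c s \<in> hyp" for s
      using hyp_translation_radial_coords(1)[OF assms, of "r * s"] by (simp add: c_def t_def)
  qed (simp add: sp)
  moreover have "c 0 = b" by (simp add: c t_def)
  moreover have "c 1 = hyp_translation b (tanh (r/2) *\<^sub>R e)" by (simp add: c_def t_def)
  ultimately show ?thesis by (simp add: sp)
qed

text \<open>The lower bound is the Lipschitz property of \<open>plane_dist e\<close>, the upper bound the perpendicular of the
  previous lemma.\<close>

lemma signed_dist_radial:
  fixes e :: "real ^ 'n"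
  assumes "CARD('n) \<ge> 2" "norm e = 1" "x \<in> hyp"
  shows "signed_dist (\<lambda>s. tanh (s/2) *\<^sub>R e) x = plane_dist e x"
proof -
  let ?P = "{x \<in> hyp. e \<bullet> x = 0}"
  have ee: "e \<bullet> e = 1" using assms(2) by (simp flip: power2_norm_eq_inner)
  have ge: "\<bar>plane_dist e x\<bar> \<le> hyp_dist x y" if "y \<in> ?P" for y
  proof -
    have y: "y \<in> hyp" "plane_dist e y = 0" using that by (auto simp: plane_dist_def hyp_height_def)
    show ?thesis unfolding hyp_dist_def
    proof (rule riem_dist_ge[OF curve_lengths_hyp_nonempty[OF assms(3) y(1)]])
      fix L assume "L \<in> curve_lengths hyp_metric hyp x y"
      from curve_length_ge[OF this plane_dist_has_derivative[of _ e] plane_dist_Lipschitz[OF _ assms(2)]]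
      show "\<bar>plane_dist e x\<bar> \<le> L" using y(2) by simp
    qed
  qed
  \<comment> \<open>the foot of the perpendicular\<close>
  obtain b where b: "b \<in> hyp" "e \<bullet> b = 0" "x = hyp_translation b (tanh (plane_dist e x / 2) *\<^sub>R e)"
    using hyp_eq_translation[OF assms(2,3)] .
  have "\<bar>plane_dist e x\<bar> \<in> curve_lengths hyp_metric hyp x b"
    using curve_lengths_reverse[OF _ orthogonal_geodesic_length[OF assms(2) b(2,1), of "plane_dist e x"]] b(3)
    by (simp add: hyp_metric_simps)
  then have le: "hyp_dist x b \<le> \<bar>plane_dist e x\<bar>"
    unfolding hyp_dist_def by (intro riem_dist_le hyp_metric_nonneg)
  have INF: "(INF y\<in>?P. hyp_dist x y) = \<bar>plane_dist e x\<bar>"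
  proof (rule antisym)
    show "(INF y\<in>?P. hyp_dist x y) \<le> \<bar>plane_dist e x\<bar>"
      using le b(1,2) ge by (intro order_trans[OF cINF_lower[of "hyp_dist x" ?P b]] bdd_belowI2) auto
    show "\<bar>plane_dist e x\<bar> \<le> (INF y\<in>?P. hyp_dist x y)"
      using ge b(1,2) by (intro cINF_greatest) auto
  qed
  have 1: "tanh (1/2) *\<^sub>R e \<in> hyp" using assms(2) tanh_real_lt_1[of "1/2"] by simp
  have pos: "plane_dist e x > 0 \<longleftrightarrow> e \<bullet> x > 0" "plane_dist e x = 0 \<longleftrightarrow> e \<bullet> x = 0"
    using norm_square_less_1[OF assms(3)]
    by (auto simp: plane_dist_def hyp_height_def zero_less_divide_iff)
  have cc: "connected_component (hyp - ?P) (tanh (1/2) *\<^sub>R e) x \<longleftrightarrow> e \<bullet> x > 0"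
  proof
    assume "e \<bullet> x > 0"
    show "connected_component (hyp - ?P) (tanh (1/2) *\<^sub>R e) x"
      unfolding connected_component_def
    proof (intro exI conjI)
      show "connected (hyp \<inter> {x. e \<bullet> x > 0})"
        by (intro convex_connected convex_Int convex_ball convex_halfspace_gt)
    qed (use \<open>e \<bullet> x > 0\<close> assms(3) 1 ee in auto)
  next
    assume "connected_component (hyp - ?P) (tanh (1/2) *\<^sub>R e) x"
    then obtain T where T: "connected T" "T \<subseteq> hyp - ?P" "tanh (1/2) *\<^sub>R e \<in> T" "x \<in> T"
      unfolding connected_component_def by blast
    show "e \<bullet> x > 0"
    proof (rule ccontr)
      assume "\<not> e \<bullet> x > 0"
      then have "\<exists>z\<in>T. e \<bullet> z = 0"
        using connected_ivt_hyperplane[OF T(1,4,3), of e 0] ee by simp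
      then show False using T(2) by auto
    qed
  qed
  show ?thesis
    unfolding signed_dist_def orth_hyperplane_radial[OF assms(1,2)] INF using cc pos by auto
qed


section \<open>Equidistant hypersurfaces\<close>

lemma smooth_hypersurface_equidistant:
  assumes "norm e = 1"
  shows "smooth_hypersurface {x \<in> hyp. plane_dist e x = a}"
proof (rule smooth_hypersurface_level[where U = hyp and \<phi> = "\<lambda>x. plane_dist e x - a"
      and D = "\<lambda>x h. hyp_metric x (height_grad e x) h / cosh (plane_dist e x)" and w = "height_grad e"])
  show "smooth_on (\<lambda>x. plane_dist e x - a) hyp"
    unfolding smooth_on_def by (intro allI Ck_on_diff Ck_on_plane_dist Ck_on_const open_ball)
  show "((\<lambda>x. plane_dist e x - a) has_derivative (\<lambda>h. hyp_metric x (height_grad e x) h / cosh (plane_dist e x))) (at x)"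
    if "x \<in> hyp" for x
    using has_derivative_diff[OF plane_dist_has_derivative[OF that] has_derivative_const[of a]] by simp
  show "hyp_metric x (height_grad e x) (height_grad e x) / cosh (plane_dist e x) \<noteq> 0" if "x \<in> hyp" for x
    using height_grad_cosh[OF that assms] by simp
qed auto

text \<open>For the converse inclusion a curve in the hypersurface is needed: a straight line in hyperboloid
  coordinates, where the equidistant hypersurfaces are affine hyperplanes.\<close>

lemma tangent_space_equidistant:
  assumes "norm e = 1" "x \<in> hyp" "plane_dist e x = a"
  shows "v \<in> tangent_space {x \<in> hyp. plane_dist e x = a} x \<longleftrightarrow> hyp_metric x (height_grad e x) v = 0"
proof
  assume "v \<in> tangent_space {x \<in> hyp. plane_dist e x = a} x"
  from tangent_space_level[OF this plane_dist_has_derivative[OF assms(2), of e]]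
  show "hyp_metric x (height_grad e x) v = 0" by simp
next
  assume v: "hyp_metric x (height_grad e x) v = 0"
  obtain H where H: "(hyperboloid has_derivative H) (at x)"
    using hyperboloid_differentiable[OF assms(2)] by (auto simp: differentiable_def)
  obtain K where K: "(ball_point has_derivative K) (at (hyperboloid x))"
    using ball_point_differentiable by (auto simp: differentiable_def)
  \<comment> \<open>the two coordinate changes are inverse to each other, hence so are their differentials\<close>
  have "((\<lambda>x. ball_point (hyperboloid x)) has_derivative (\<lambda>h. K (H h))) (at x)"
    using has_derivative_compose[OF H K] .
  moreover have "((\<lambda>x. ball_point (hyperboloid x)) has_derivative (\<lambda>h. h)) (at x)"
    by (rule has_derivative_transform_within_open[OF has_derivative_ident open_ball assms(2)])
      (simp add: ball_point_hyperboloid)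
  ultimately have KH: "K (H v) = v" using has_derivative_unique by metis
  have "((\<lambda>x. e \<bullet> hyperboloid x) has_derivative (\<lambda>h. e \<bullet> H h)) (at x)"
    by (rule has_derivative_inner_right[OF H])
  then have eH: "e \<bullet> H v = 0"
    using has_derivative_unique[OF _ height_has_derivative[OF assms(2), of e]] v
    unfolding inner_hyperboloid by metis
  define c where "c s = ball_point (hyperboloid x + s *\<^sub>R H v)" for s
  have "((\<lambda>s. hyperboloid x + s *\<^sub>R H v) has_derivative (\<lambda>s. s *\<^sub>R H v)) (at 0)"
    by (auto intro!: derivative_eq_intros)
  from has_derivative_compose[OF this, of ball_point K] K
  have "(c has_derivative (\<lambda>s. K (s *\<^sub>R H v))) (at 0)" by (simp add: c_def[abs_def])
  then have "(c has_vector_derivative v) (at 0)"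
    using linear_cmul[OF has_derivative_linear[OF K]] KH by (simp add: has_vector_derivative_def)
  moreover have "c 0 = x" by (simp add: c_def ball_point_hyperboloid[OF assms(2)])
  moreover have "c s \<in> {x \<in> hyp. plane_dist e x = a}" for s
    using assms(3) hyperboloid_ball_point(1)
    by (simp add: c_def plane_dist_ball_point inner_add_right eH inner_hyperboloid flip: plane_dist_def)
  ultimately show "v \<in> tangent_space {x \<in> hyp. plane_dist e x = a} x"
    unfolding tangent_space_def by (intro CollectI exI[of _ c] exI[of _ 1]) auto
qed

text \<open>The length of the gradient of the height is the constant \<open>cosh a\<close> on the hypersurface, so the
  curvatures are those of the Hessian of the height: all equal to \<open>sinh a / cosh a\<close>.\<close>

lemma equidistant_mean_curvature:
  fixes e :: "real ^ 'n"
  assumes "CARD('n) \<ge> 2" "norm e = 1"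
  shows "has_constant_mean_curvature hyp_metric {x \<in> hyp. plane_dist e x = a}
     (\<lambda>x. (- 1 / cosh a) *\<^sub>R height_grad e x) (tanh a)"
  unfolding has_constant_mean_curvature_def unit_normal_field_def
proof (intro conjI ballI)
  fix x assume "x \<in> {x \<in> hyp. plane_dist e x = a}"
  then have x: "x \<in> hyp" "plane_dist e x = a" by auto
  show "hyp_metric x ((- 1 / cosh a) *\<^sub>R height_grad e x) ((- 1 / cosh a) *\<^sub>R height_grad e x) = 1"
    using height_grad_cosh[OF x(1) assms(2)] x(2) by (simp add: hyp_metric_simps power2_eq_square)
  show "hyp_metric x ((- 1 / cosh a) *\<^sub>R height_grad e x) v = 0"
    if "v \<in> tangent_space {x \<in> hyp. plane_dist e x = a} x" for v
    using that tangent_space_equidistant[OF assms(2) x] by (simp add: hyp_metric_simps)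
  obtain B where B: "finite B" "card B = CARD('n) - 1"
    "\<And>v. v \<in> B \<Longrightarrow> hyp_metric x (height_grad e x) v = 0"
    "\<And>v w. v \<in> B \<Longrightarrow> w \<in> B \<Longrightarrow> hyp_metric x v w = (if v = w then 1 else 0)"
    using hyp_orthonormal_frame[OF x(1) height_grad_nonzero[OF x(1) assms(2)]] by blast
  define A where "A h = (- 1 / cosh a) *\<^sub>R ((e \<bullet> x) *\<^sub>R h + (e \<bullet> h) *\<^sub>R x - (x \<bullet> h) *\<^sub>R e)" for h
  have A: "((\<lambda>x. (- 1 / cosh a) *\<^sub>R height_grad e x) has_derivative A) (at x within {x \<in> hyp. plane_dist e x = a})"
    unfolding A_def[abs_def]
    by (rule has_derivative_at_withinI[OF has_derivative_scaleR_right[OF height_grad_has_derivative]])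
  have "A v + christoffel hyp_metric x v ((- 1 / cosh a) *\<^sub>R height_grad e x) = - (tanh a *\<^sub>R v)" for v
    unfolding A_def christoffel_hyp_metric_scaleR(1)[OF x(1)] scaleR_add_right[symmetric] height_hessian[OF x(1)]
    by (simp add: tanh_def x(2) flip: sinh_plane_dist)
  then show "has_mean_curvature_at hyp_metric {x \<in> hyp. plane_dist e x = a}
     (\<lambda>x. (- 1 / cosh a) *\<^sub>R height_grad e x) x (tanh a)"
    unfolding has_mean_curvature_at_def
    using A B assms(1) tangent_space_equidistant[OF assms(2) x]
    by (intro exI[of _ A] exI[of _ B] exI[of _ "\<lambda>_. tanh a"]) auto
qed

text \<open>A half-space in hyperboloid coordinates.\<close>

lemma connected_plane_dist_greater: "connected {x \<in> hyp. plane_dist e x > a}"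
proof -
  have "{x \<in> hyp. plane_dist e x > a} = ball_point ` {y. e \<bullet> y > sinh a}"
  proof (intro equalityI subsetI)
    fix x assume x: "x \<in> {x \<in> hyp. plane_dist e x > a}"
    then have "sinh a < sinh (plane_dist e x)" by simp
    then have "hyperboloid x \<in> {y. e \<bullet> y > sinh a}" by (simp add: inner_hyperboloid sinh_plane_dist)
    then show "x \<in> ball_point ` {y. e \<bullet> y > sinh a}"
      using x ball_point_hyperboloid[of x] by (auto intro!: rev_image_eqI)
  next
    fix x assume "x \<in> ball_point ` {y. e \<bullet> y > sinh a}"
    then obtain y where "x = ball_point y" "sinh a < e \<bullet> y" by auto
    then show "x \<in> {x \<in> hyp. plane_dist e x > a}"
      using hyperboloid_ball_point(1)[of y] arsinh_less_iff_real[of "sinh a" "e \<bullet> y"]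
      by (simp add: plane_dist_ball_point arsinh_sinh_real)
  qed
  moreover have "continuous_on {y. e \<bullet> y > sinh a} ball_point"
    using ball_point_differentiable
    by (intro differentiable_imp_continuous_on differentiable_at_imp_differentiable_on) auto
  ultimately show ?thesis
    using connected_continuous_image convex_connected convex_halfspace_gt by metis
qed

lemma open_plane_dist_greater: "open {x \<in> hyp. plane_dist e x > a}"
proof -
  have "continuous_on hyp (plane_dist e)"
    using continuous_plane_dist continuous_at_imp_continuous_on by blast
  from continuous_open_preimage[OF this open_ball open_greaterThan, of a]
  show ?thesis by (simp add: Int_def vimage_def)
qed

lemma plane_dist_surj: "norm e = 1 \<Longrightarrow> plane_dist e (tanh (s/2) *\<^sub>R e) = s"
  using plane_dist_ball_point[of e "sinh s *\<^sub>R e"] hyperboloid_radial[of e s]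
    ball_point_hyperboloid[of "tanh (s/2) *\<^sub>R e"] tanh_half(3)[of s]
  by (simp add: abs_square_less_1 arsinh_sinh_real flip: power2_norm_eq_inner)

text \<open>The mean curvature vector is a negative multiple of the gradient of the height, so \<open>plane_dist e\<close>
  decreases in its direction.\<close>

lemma non_mean_convex_side_equidistant:
  fixes e :: "real ^ 'n"
  assumes "CARD('n) \<ge> 2" "norm e = 1" "a > 0"
  shows "non_mean_convex_side {x \<in> hyp. plane_dist e x = a} {x \<in> hyp. plane_dist e x > a}"
proof -
  let ?G = "{x \<in> hyp. plane_dist e x = a}" and ?C = "{x \<in> hyp. plane_dist e x > a}"
  let ?\<xi> = "\<lambda>x. (- 1 / cosh a) *\<^sub>R height_grad e x"
  have "?C \<in> components (hyp - ?G)"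
    unfolding in_components_maximal
  proof (intro conjI allI impI)
    have "tanh ((a + 1) / 2) *\<^sub>R e \<in> ?C"
      using plane_dist_surj[OF assms(2), of "a + 1"] tanh_half(3)[of "a + 1"] assms(2)
      by (simp add: abs_square_less_1)
    then show "?C \<noteq> {}" by blast
    show "connected ?C" by (rule connected_plane_dist_greater)
    fix d assume d: "d \<noteq> {} \<and> ?C \<subseteq> d \<and> d \<subseteq> hyp - ?G \<and> connected d"
    show "d = ?C"
    proof (rule ccontr)
      assume "d \<noteq> ?C"
      then obtain x where x: "x \<in> d" "x \<notin> ?C" using d by blast
      obtain y where y: "y \<in> ?C" using \<open>?C \<noteq> {}\<close> by blast
      have "connected (plane_dist e ` d)"
        by (intro connected_continuous_image continuous_at_imp_continuous_on ballI continuous_plane_dist)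
          (use d in blast)+
      moreover have "plane_dist e x \<le> a" "a \<le> plane_dist e y" using x y d by auto
      ultimately have "a \<in> plane_dist e ` d"
        using x(1) y d unfolding is_interval_connected_1[symmetric] is_interval_1 by blast
      then show False using d by auto
    qed
  qed auto
  moreover have "\<not> points_into x (tanh a *\<^sub>R ?\<xi> x) ?C" if "x \<in> ?G" for x
  proof
    assume pt: "points_into x (tanh a *\<^sub>R ?\<xi> x) ?C"
    define w where "w = tanh a *\<^sub>R ?\<xi> x"
    have ev: "\<forall>\<^sub>F s in at_right 0. plane_dist e (x + s *\<^sub>R w) > a"
      using pt unfolding points_into_def w_def[symmetric] by (rule eventually_mono) auto
    have x: "x \<in> hyp" "plane_dist e x = a" using that by auto
    define k where "k = hyp_metric x (height_grad e x) w / cosh (plane_dist e x)"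
    have k: "k < 0"
      using height_grad_cosh[OF x(1) assms(2)] assms(3) by (simp add: k_def w_def hyp_metric_simps x(2))
    have "((\<lambda>s. x + s *\<^sub>R w) has_derivative (\<lambda>s. s *\<^sub>R w)) (at 0)"
      by (auto intro!: derivative_eq_intros)
    from has_derivative_compose[OF this, of "plane_dist e"] plane_dist_has_derivative[OF x(1), of e]
    have "((\<lambda>s. plane_dist e (x + s *\<^sub>R w)) has_derivative
       (\<lambda>s. hyp_metric x (height_grad e x) (s *\<^sub>R w) / cosh (plane_dist e x))) (at 0)" by simp
    then have "((\<lambda>s. plane_dist e (x + s *\<^sub>R w)) has_real_derivative k) (at 0)"
      unfolding has_field_derivative_def
      by (rule has_derivative_eq_rhs) (simp add: fun_eq_iff k_def hyp_metric_simps)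
    from DERIV_neg_dec_right[OF this k] obtain d where d: "d > 0"
      "\<And>h. 0 < h \<Longrightarrow> h < d \<Longrightarrow> plane_dist e (x + h *\<^sub>R w) < a"
      using x(2) by auto
    have "\<forall>\<^sub>F s in at_right 0. s < d \<and> 0 < s"
      using d(1) by (auto simp: eventually_at_right_field intro!: exI[of _ d])
    with ev have "\<forall>\<^sub>F s in at_right (0::real). False"
      by eventually_elim (use d(2) in fastforce)
    then show False by simp
  qed
  ultimately show ?thesis
    using equidistant_mean_curvature[OF assms(1,2), of a]
    unfolding non_mean_convex_side_def has_constant_mean_curvature_def
    by (intro conjI exI[of _ ?\<xi>] exI[of _ "\<lambda>_. tanh a"]) auto
qed

text \<open>At infinity an equidistant hypersurface runs into the boundary of its hyperplane.\<close>

lemma asymptotic_boundary_equidistant: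
  assumes "norm e = 1" "norm \<omega> = 1" "e \<bullet> \<omega> = 0"
  shows "\<omega> \<in> asymptotic_boundary {x \<in> hyp. plane_dist e x = a}"
proof -
  define s where "s = sinh a"
  define y where "y t = \<omega> + (t * s) *\<^sub>R e" for t
  \<comment> \<open>\<open>c t\<close> has hyperboloid coordinates \<open>\<omega> / t + sinh a *\<^sub>R e\<close>, written without division by \<open>t\<close> so that it
      extends continuously to \<open>t = 0\<close>\<close>
  define c where "c t = (1 / (t + sqrt (t\<^sup>2 + (norm (y t))\<^sup>2))) *\<^sub>R y t" for t
  have c: "c t \<in> {x \<in> hyp. plane_dist e x = a}" if t: "t > 0" for t
  proof -
    have "1 + (norm ((1 / t) *\<^sub>R y t))\<^sup>2 = (t\<^sup>2 + (norm (y t))\<^sup>2) / t\<^sup>2"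
      using t by (simp add: power_mult_distrib field_simps)
    then have "sqrt (1 + (norm ((1 / t) *\<^sub>R y t))\<^sup>2) = sqrt (t\<^sup>2 + (norm (y t))\<^sup>2) / t"
      using t by (simp add: real_sqrt_divide)
    then have "1 / (1 + sqrt (1 + (norm ((1 / t) *\<^sub>R y t))\<^sup>2)) * (1 / t) = 1 / (t + sqrt (t\<^sup>2 + (norm (y t))\<^sup>2))"
      using t by (simp add: field_simps)
    then have "c t = ball_point ((1 / t) *\<^sub>R y t)" by (simp only: c_def ball_point_def scaleR_scaleR)
    moreover have "e \<bullet> ((1 / t) *\<^sub>R y t) = sinh a"
      using assms t by (simp add: y_def inner_add_right s_def flip: power2_norm_eq_inner)
    ultimately show ?thesis
      using hyperboloid_ball_point(1) by (simp add: plane_dist_ball_point arsinh_sinh_real)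
  qed
  have "(c \<longlongrightarrow> (1 / (0 + sqrt (0\<^sup>2 + (norm (\<omega> + (0 * s) *\<^sub>R e))\<^sup>2))) *\<^sub>R (\<omega> + (0 * s) *\<^sub>R e)) (at_right 0)"
    unfolding c_def y_def using assms(2) by (intro tendsto_intros) auto
  then have lim: "(c \<longlongrightarrow> \<omega>) (at_right 0)" using assms(2) by simp
  have "\<omega> \<in> closure {x \<in> hyp. plane_dist e x = a}"
  proof (rule Lim_in_closed_set[OF closed_closure _ _ lim])
    show "\<forall>\<^sub>F t in at_right 0. c t \<in> closure {x \<in> hyp. plane_dist e x = a}"
      using eventually_at_right_less[of 0] by eventually_elim (use c closure_subset in blast)
  qed simp
  then show ?thesis using assms(2) by (simp add: asymptotic_boundary_def)
qed

lemma asymptotic_boundary_positive_side: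
  assumes "\<omega> \<in> asymptotic_boundary {x \<in> hyp. plane_dist e x > a}" "a > 0"
  shows "norm \<omega> = 1" "e \<bullet> \<omega> \<ge> 0"
proof -
  show "norm \<omega> = 1" using assms(1) by (simp add: asymptotic_boundary_def)
  have "{x \<in> hyp. plane_dist e x > a} \<subseteq> {x. e \<bullet> x \<ge> 0}"
  proof
    fix x assume "x \<in> {x \<in> hyp. plane_dist e x > a}"
    then have "x \<in> hyp" "plane_dist e x > 0" using assms(2) by auto
    then show "x \<in> {x. e \<bullet> x \<ge> 0}"
      using norm_square_less_1[of x] by (auto simp: plane_dist_def hyp_height_def zero_less_divide_iff)
  qed
  then have "closure {x \<in> hyp. plane_dist e x > a} \<subseteq> {x. e \<bullet> x \<ge> 0}"
    by (intro closure_minimal closed_halfspace_ge)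
  then show "e \<bullet> \<omega> \<ge> 0" using assms(1) by (auto simp: asymptotic_boundary_def)
qed


section \<open>The profile curve\<close>

lemma continuous_antiderivative:
  fixes f :: "real \<Rightarrow> real"
  assumes "\<And>x. a < x \<Longrightarrow> isCont f x"
  obtains F where "\<And>x. a < x \<Longrightarrow> (F has_real_derivative f x) (at x)"
  using einterval_antiderivative[of "ereal a" "\<infinity>" f] assms
  by (auto simp: has_real_derivative_iff_has_vector_derivative)

text \<open>Here \<open>q\<close> is the sine of the inclination of the profile curve, \<open>\<mu>' / sqrt (1 + \<mu>'\<^sup>2)\<close>. The equation is
  \<open>(q cosh\<^sup>N)' = N \<tau> cosh\<^sup>N\<close> and the initial value is \<open>q a = 1\<close>. Since \<open>tanh a = \<tau>\<close>, the derivative of \<open>q\<close>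
  vanishes at \<open>a\<close> as well, which is the source of the quadratic bound.\<close>

lemma sine_profile_exists:
  fixes \<tau> a :: real and N :: nat
  assumes N: "N \<ge> 1" and \<tau>: "0 < \<tau>" "\<tau> < 1" and a: "tanh a = \<tau>"
  obtains q :: "real \<Rightarrow> real"
  where "\<And>\<rho>. \<rho> > a \<Longrightarrow> (q has_real_derivative N * (\<tau> - tanh \<rho> * q \<rho>)) (at \<rho>)"
    and "\<And>\<rho>. \<rho> > a \<Longrightarrow> \<tau> \<le> q \<rho>" and "\<And>\<rho>. \<rho> > a \<Longrightarrow> q \<rho> < 1"
    and "\<And>\<rho>. \<rho> > a \<Longrightarrow> 1 - q \<rho> \<le> N * (\<rho> - a)\<^sup>2"
proof -
  \<comment> \<open>start below \<open>a\<close>, so that the antiderivative is differentiable at \<open>a\<close> itself\<close>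
  obtain Q0 :: "real \<Rightarrow> real" where Q0: "\<And>x. a - 1 < x \<Longrightarrow> (Q0 has_real_derivative cosh x ^ N) (at x)"
    by (rule continuous_antiderivative[of "a - 1" "\<lambda>x. cosh x ^ N"]) (auto intro!: continuous_intros)
  define Q where "Q x = Q0 x - Q0 a" for x
  have Q: "(Q has_real_derivative cosh x ^ N) (at x)" if "a \<le> x" for x
    using Q0[of x] that unfolding Q_def[abs_def] by (auto intro!: derivative_eq_intros)
  define q where "q \<rho> = (cosh a ^ N + N * \<tau> * Q \<rho>) / cosh \<rho> ^ N" for \<rho>
  have c: "cosh \<rho> ^ N > 0" for \<rho> :: real by simp
  have dc: "((\<lambda>\<rho>::real. cosh \<rho> ^ N) has_real_derivative N * tanh \<rho> * cosh \<rho> ^ N) (at \<rho>)" for \<rho>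
  proof -
    have "sinh \<rho> * cosh \<rho> ^ (N - Suc 0) = tanh \<rho> * cosh \<rho> ^ N"
      using N power_eq_if[of "cosh \<rho>" N] by (simp add: tanh_def)
    then show ?thesis by (auto intro!: derivative_eq_intros simp: mult.assoc)
  qed
  have dq: "(q has_real_derivative N * (\<tau> - tanh \<rho> * q \<rho>)) (at \<rho>)" if "\<rho> > a" for \<rho>
  proof -
    have "(q has_real_derivative ((0 + N * \<tau> * cosh \<rho> ^ N) * cosh \<rho> ^ N
        - (cosh a ^ N + N * \<tau> * Q \<rho>) * (N * tanh \<rho> * cosh \<rho> ^ N)) / (cosh \<rho> ^ N * cosh \<rho> ^ N)) (at \<rho>)"
      unfolding q_def[abs_def]
      by (intro DERIV_divide DERIV_add DERIV_const DERIV_cmult Q dc) (use that c[of \<rho>] in auto)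
    also have "((0 + N * \<tau> * cosh \<rho> ^ N) * cosh \<rho> ^ N
        - (cosh a ^ N + N * \<tau> * Q \<rho>) * (N * tanh \<rho> * cosh \<rho> ^ N)) / (cosh \<rho> ^ N * cosh \<rho> ^ N)
        = N * (\<tau> - tanh \<rho> * q \<rho>)"
      using c[of \<rho>] unfolding q_def by (simp add: field_simps)
    finally show ?thesis .
  qed
  \<comment> \<open>\<open>g\<close> is \<open>(1 - q) cosh\<^sup>N\<close>; it vanishes at \<open>a\<close> and its derivative is \<open>N cosh\<^sup>N (tanh - \<tau>)\<close>\<close>
  define g where "g \<rho> = cosh \<rho> ^ N - cosh a ^ N - N * \<tau> * Q \<rho>" for \<rho>
  have g: "1 - q \<rho> = g \<rho> / cosh \<rho> ^ N" for \<rho>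
    using c[of \<rho>] by (simp add: q_def g_def field_simps)
  have dg: "(g has_real_derivative N * cosh x ^ N * (tanh x - \<tau>)) (at x)" if "a \<le> x" for x
    unfolding g_def[abs_def]
    by (rule DERIV_cong, (rule derivative_intros Q[OF that] dc)+) (simp add: algebra_simps)
  have mvt: "\<exists>z. a < z \<and> z < \<rho> \<and> g \<rho> = (\<rho> - a) * (N * cosh z ^ N * (tanh z - \<tau>))" if "\<rho> > a" for \<rho>
    using MVT2[of a \<rho> g "\<lambda>z. N * cosh z ^ N * (tanh z - \<tau>)"] dg that by (simp add: g_def Q_def)
  have "q \<rho> < 1" if r: "\<rho> > a" for \<rho>
  proof -
    obtain z where z: "a < z" "z < \<rho>" "g \<rho> = (\<rho> - a) * (N * cosh z ^ N * (tanh z - \<tau>))"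
      using mvt[OF r] by blast
    have "tanh z > \<tau>" using z(1) unfolding a[symmetric] by simp
    then have "g \<rho> > 0" unfolding z(3) using r c[of z] N by simp
    then have "g \<rho> / cosh \<rho> ^ N > 0" using c[of \<rho>] by simp
    then show ?thesis using g[of \<rho>] by linarith
  qed
  moreover have "1 - q \<rho> \<le> N * (\<rho> - a)\<^sup>2" if r: "\<rho> > a" for \<rho>
  proof -
    obtain z where z: "a < z" "z < \<rho>" "g \<rho> = (\<rho> - a) * (N * cosh z ^ N * (tanh z - \<tau>))"
      using mvt[OF r] by blast
    have "(tanh has_real_derivative 1 - (tanh y)\<^sup>2) (at y)" for y :: real
      by (auto intro!: derivative_eq_intros)
    then obtain y where "tanh z - tanh a = (z - a) * (1 - (tanh y)\<^sup>2)"
      using MVT2[OF z(1), of tanh "\<lambda>y. 1 - (tanh y)\<^sup>2"] by blast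
    also have "\<dots> \<le> (z - a) * 1" using z(1) by (intro mult_left_mono) auto
    finally have 1: "tanh z - \<tau> \<le> \<rho> - a" using z(2) a by simp
    have 2: "cosh z ^ N \<le> cosh \<rho> ^ N"
    proof -
      have "0 < a" using a \<tau>(1) by (metis tanh_real_pos_iff)
      then show ?thesis using z by (intro power_mono) (auto simp: cosh_real_nonneg_le_iff)
    qed
    have "g \<rho> \<le> (\<rho> - a) * (N * cosh \<rho> ^ N * (\<rho> - a))"
      unfolding z(3) using 1 2 r z(1) a c[of \<rho>]
      by (intro mult_left_mono mult_mono) (auto simp: less_imp_le)
    also have "\<dots> = N * (\<rho> - a)\<^sup>2 * cosh \<rho> ^ N" by (simp add: power2_eq_square)
    finally show ?thesis using c[of \<rho>] unfolding g by (simp add: pos_divide_le_eq)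
  qed
  moreover have "\<tau> \<le> q \<rho>" if r: "\<rho> > a" for \<rho>
  proof -
    \<comment> \<open>\<open>k\<close> is \<open>(q - \<tau>) cosh\<^sup>N\<close>, which is positive at \<open>a\<close> and nondecreasing\<close>
    define k where "k \<rho> = cosh a ^ N + N * \<tau> * Q \<rho> - \<tau> * cosh \<rho> ^ N" for \<rho>
    have "k a \<le> k \<rho>"
    proof (rule DERIV_nonneg_imp_nondecreasing[where f = k])
      fix x assume x: "a \<le> x"
      have "(k has_real_derivative N * \<tau> * cosh x ^ N * (1 - tanh x)) (at x)"
        unfolding k_def[abs_def]
        by (rule DERIV_cong, (rule derivative_intros Q[OF x] dc)+) (simp add: algebra_simps)
      moreover have "N * \<tau> * cosh x ^ N * (1 - tanh x) \<ge> 0"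
        using \<tau>(1) tanh_real_lt_1[of x] by simp
      ultimately show "\<exists>y. (k has_real_derivative y) (at x) \<and> 0 \<le> y" by blast
    qed (use r in simp)
    moreover have "k a \<ge> 0" using \<tau> by (simp add: k_def Q_def mult_left_le_one_le)
    ultimately have "\<tau> * cosh \<rho> ^ N \<le> cosh a ^ N + N * \<tau> * Q \<rho>" by (simp add: k_def)
    then show ?thesis using c[of \<rho>] by (simp add: q_def pos_le_divide_eq)
  qed
  ultimately show thesis using that dq by blast
qed

text \<open>The bound on \<open>1 - q\<close> makes the slope at least \<open>c / (\<rho> - a)\<close> on the whole half-line, so the
  difference of \<open>\<mu>\<close> and \<open>c ln (\<rho> - a)\<close> is nondecreasing. This one comparison gives both infinite
  limits.\<close>

lemma profile_exists:
  fixes q :: "real \<Rightarrow> real"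
  assumes cont: "\<And>\<rho>. \<rho> > a \<Longrightarrow> isCont q \<rho>" and k: "0 < k" "0 < \<tau>"
    and lo: "\<And>\<rho>. \<rho> > a \<Longrightarrow> \<tau> \<le> q \<rho>" and hi: "\<And>\<rho>. \<rho> > a \<Longrightarrow> q \<rho> < 1"
    and bd: "\<And>\<rho>. \<rho> > a \<Longrightarrow> 1 - q \<rho> \<le> k * (\<rho> - a)\<^sup>2"
  obtains \<mu> where "\<And>\<rho>. \<rho> > a \<Longrightarrow> (\<mu> has_real_derivative q \<rho> / sqrt (1 - (q \<rho>)\<^sup>2)) (at \<rho>)"
    and "filterlim \<mu> at_bot (at_right a)" and "filterlim \<mu> at_top at_top"
proof -
  have q2: "(q \<rho>)\<^sup>2 < 1" if "\<rho> > a" for \<rho>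
    using lo[OF that] hi[OF that] k by (simp add: abs_square_less_1)
  obtain \<mu> where \<mu>: "\<And>\<rho>. \<rho> > a \<Longrightarrow> (\<mu> has_real_derivative q \<rho> / sqrt (1 - (q \<rho>)\<^sup>2)) (at \<rho>)"
  proof (rule continuous_antiderivative[of a "\<lambda>\<rho>. q \<rho> / sqrt (1 - (q \<rho>)\<^sup>2)"])
    show "isCont (\<lambda>\<rho>. q \<rho> / sqrt (1 - (q \<rho>)\<^sup>2)) \<rho>" if "a < \<rho>" for \<rho>
      using cont[OF that] q2[OF that] by (intro continuous_intros) auto
  qed blast
  define c where "c = \<tau> / sqrt (2 * k)"
  have c: "c > 0" using k by (simp add: c_def)
  have slope: "c / (\<rho> - a) \<le> q \<rho> / sqrt (1 - (q \<rho>)\<^sup>2)" if r: "\<rho> > a" for \<rho>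
  proof -
    have "1 - (q \<rho>)\<^sup>2 = (1 - q \<rho>) * (1 + q \<rho>)" by (simp add: algebra_simps power2_eq_square)
    also have "\<dots> \<le> (k * (\<rho> - a)\<^sup>2) * 2"
      using hi[OF r] lo[OF r] bd[OF r] k by (intro mult_mono) auto
    finally have "sqrt (1 - (q \<rho>)\<^sup>2) \<le> sqrt (2 * k * (\<rho> - a)\<^sup>2)" by (simp add: mult_ac)
    also have "\<dots> = sqrt (2 * k) * (\<rho> - a)" using r by (simp add: real_sqrt_mult)
    finally have "\<tau> / (sqrt (2 * k) * (\<rho> - a)) \<le> q \<rho> / sqrt (1 - (q \<rho>)\<^sup>2)"
      using q2[OF r] lo[OF r] k by (intro frac_le) auto
    then show ?thesis by (simp add: c_def)
  qed
  \<comment> \<open>comparison with the logarithm\<close>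
  define F where "F \<rho> = \<mu> \<rho> - c * ln (\<rho> - a)" for \<rho>
  have mono: "F x \<le> F y" if "a < x" "x \<le> y" for x y
  proof (rule DERIV_nonneg_imp_nondecreasing[OF that(2)])
    fix z assume "x \<le> z"
    then have z: "z > a" using that by simp
    have "(F has_real_derivative q z / sqrt (1 - (q z)\<^sup>2) - c / (z - a)) (at z)"
      unfolding F_def[abs_def] using \<mu>[OF z] z by (auto intro!: derivative_eq_intros)
    then show "\<exists>y. (F has_real_derivative y) (at z) \<and> 0 \<le> y" using slope[OF z] by auto
  qed
  have lim: "filterlim (\<lambda>\<rho>. F (a + 1) + c * ln (\<rho> - a)) at_bot (at_right a)"
  proof -
    have "filterlim (\<lambda>\<rho>. \<rho> - a) (at_right 0) (at_right a)"
      by (simp add: filterlim_at_right_to_0[of _ _ a] filterlim_ident)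
    then have "filterlim (\<lambda>\<rho>. ln (\<rho> - a)) at_bot (at_right a)"
      by (rule filterlim_compose[OF ln_at_0])
    then have "filterlim (\<lambda>\<rho>. c * ln (\<rho> - a)) at_bot (at_right a)"
      by (rule filterlim_tendsto_pos_mult_at_bot[OF tendsto_const c])
    then have "\<forall>\<^sub>F \<rho> in at_right a. c * ln (\<rho> - a) \<le> Z - F (a + 1)" for Z
      by (simp add: filterlim_at_bot)
    then show ?thesis by (simp add: filterlim_at_bot algebra_simps)
  qed
  have lim2: "filterlim (\<lambda>\<rho>. F (a + 1) + c * ln (\<rho> - a)) at_top at_top"
  proof -
    have "filterlim (\<lambda>\<rho>::real. \<rho> - a) at_top at_top"
      using filterlim_tendsto_add_at_top[OF tendsto_const filterlim_ident, of "-a"] by (simp add: add.commute)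
    then have "filterlim (\<lambda>\<rho>. ln (\<rho> - a)) at_top at_top"
      by (rule filterlim_compose[OF ln_at_top])
    then show ?thesis
      by (intro filterlim_tendsto_add_at_top[OF tendsto_const]
          filterlim_tendsto_pos_mult_at_top[OF tendsto_const c])
  qed
  have "filterlim \<mu> at_bot (at_right a)"
  proof (rule filterlim_at_bot_mono[OF lim])
    show "\<forall>\<^sub>F \<rho> in at_right a. \<mu> \<rho> \<le> F (a + 1) + c * ln (\<rho> - a)"
      unfolding eventually_at_right_field
    proof (intro exI[of _ "a + 1"] conjI allI impI)
      fix \<rho> assume "a < \<rho>" "\<rho> < a + 1"
      then show "\<mu> \<rho> \<le> F (a + 1) + c * ln (\<rho> - a)"
        using mono[of \<rho> "a + 1"] by (simp add: F_def)
    qed simp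
  qed
  moreover have "filterlim \<mu> at_top at_top"
  proof (rule filterlim_at_top_mono[OF lim2])
    show "\<forall>\<^sub>F \<rho> in at_top. F (a + 1) + c * ln (\<rho> - a) \<le> \<mu> \<rho>"
      using eventually_ge_at_top[of "a + 1"]
    proof eventually_elim
      case (elim \<rho>)
      then show ?case using mono[of "a + 1" \<rho>] by (simp add: F_def)
    qed
  qed
  ultimately show thesis using that \<mu> by blast
qed


section \<open>Mean curvature of the translation graph\<close>

text \<open>The graph of \<open>\<mu> \<circ> plane_dist e\<close> over \<open>plane_dist e > a\<close>, where \<open>q\<close> and \<open>r = sqrt (1 - q\<^sup>2)\<close> are sine and
  cosine of the inclination of the profile curve. The equation for \<open>q\<close> prescribes the mean curvature
  \<open>(n - 1) \<tau> / n\<close>.\<close>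

locale translation_graph =
  fixes e :: "real ^ 'n" and a \<tau> :: real and q \<mu> :: "real \<Rightarrow> real"
  assumes card: "CARD('n) \<ge> 2" and e: "norm e = 1"
    and q0: "\<And>\<rho>. \<rho> > a \<Longrightarrow> 0 < q \<rho>" and q1: "\<And>\<rho>. \<rho> > a \<Longrightarrow> q \<rho> < 1"
    and dq: "\<And>\<rho>. \<rho> > a \<Longrightarrow> (q has_real_derivative (real CARD('n) - 1) * (\<tau> - tanh \<rho> * q \<rho>)) (at \<rho>)"
    and d\<mu>: "\<And>\<rho>. \<rho> > a \<Longrightarrow> (\<mu> has_real_derivative q \<rho> / sqrt (1 - (q \<rho>)\<^sup>2)) (at \<rho>)"
    and \<mu>_bot: "filterlim \<mu> at_bot (at_right a)" and \<mu>_top: "filterlim \<mu> at_top at_top"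
begin

definition "\<Omega> = {x \<in> hyp. plane_dist e x > a}"

definition "u x = \<mu> (plane_dist e x)"

definition "T = graph_over \<Omega> u"

definition "r \<rho> = sqrt (1 - (q \<rho>)\<^sup>2)"

definition "du x h = q (plane_dist e x) / r (plane_dist e x) * (hyp_metric x (height_grad e x) h / cosh (plane_dist e x))"

text \<open>The upward unit normal \<open>(- grad u, 1) / sqrt (1 + |grad u|\<^sup>2)\<close>, extended to all points over \<open>\<Omega>\<close>
  independently of the vertical coordinate.\<close>

definition "\<nu> p = ((- (q (plane_dist e (fst p)) / cosh (plane_dist e (fst p)))) *\<^sub>R height_grad e (fst p),
   r (plane_dist e (fst p)))"

lemma \<Omega>D: "x \<in> \<Omega> \<Longrightarrow> x \<in> hyp" "x \<in> \<Omega> \<Longrightarrow> plane_dist e x > a"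
  by (auto simp: \<Omega>_def)

lemma T_iff: "p \<in> T \<longleftrightarrow> fst p \<in> \<Omega> \<and> snd p = u (fst p)"
  by (cases p) (auto simp: T_def graph_over_def)

lemma r_pos: "\<rho> > a \<Longrightarrow> r \<rho> > 0"
  using q0[of \<rho>] q1[of \<rho>] by (simp add: r_def abs_square_less_1)

lemma r_square: "\<rho> > a \<Longrightarrow> (r \<rho>)\<^sup>2 = 1 - (q \<rho>)\<^sup>2"
  using r_pos[of \<rho>] by (simp add: r_def)

lemma u_has_derivative: "x \<in> \<Omega> \<Longrightarrow> (u has_derivative du x) (at x)"
  unfolding u_def[abs_def] du_def[abs_def] r_def
  using DERIV_compose_FDERIV[OF d\<mu> plane_dist_has_derivative[of x e]] \<Omega>D[of x] by (simp add: mult.commute)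

lemma open_\<Omega>: "open \<Omega>"
  unfolding \<Omega>_def by (rule open_plane_dist_greater)

lemma du_scaleR: "du x (c *\<^sub>R h) = c * du x h"
  by (simp add: du_def hyp_metric_simps)

lemma level_has_derivative:
  "fst p \<in> \<Omega> \<Longrightarrow> ((\<lambda>p. snd p - u (fst p)) has_derivative (\<lambda>v. snd v - du (fst p) (fst v))) (at p)"
  using has_derivative_diff[OF has_derivative_snd[OF has_derivative_ident]
      has_derivative_compose[OF has_derivative_fst[OF has_derivative_ident] u_has_derivative]] by simp

lemma tangent_space_T:
  assumes "p \<in> T"
  shows "v \<in> tangent_space T p \<longleftrightarrow> snd v = du (fst p) (fst v)"
proof
  assume "v \<in> tangent_space T p"
  from tangent_space_level[OF this level_has_derivative, of 0]
  show "snd v = du (fst p) (fst v)" using assms by (simp add: T_iff)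
next
  assume v: "snd v = du (fst p) (fst v)"
  have x: "fst p \<in> \<Omega>" using assms by (simp add: T_iff)
  obtain \<epsilon> where \<epsilon>: "\<epsilon> > 0" "ball (fst p) \<epsilon> \<subseteq> \<Omega>"
    using open_\<Omega> x open_contains_ball by blast
  \<comment> \<open>the summand 1 only avoids division by zero when \<open>v\<close> is vertical\<close>
  define \<delta> where "\<delta> = \<epsilon> / (norm (fst v) + 1)"
  define c where "c s = (fst p + s *\<^sub>R fst v, u (fst p + s *\<^sub>R fst v))" for s
  have "fst p + s *\<^sub>R fst v \<in> \<Omega>" if "\<bar>s\<bar> < \<delta>" for s
  proof -
    have "\<bar>s\<bar> * norm (fst v) \<le> \<bar>s\<bar> * (norm (fst v) + 1)" by (intro mult_left_mono) auto
    also have "\<dots> < \<epsilon>" using that by (simp add: \<delta>_def pos_less_divide_eq add_nonneg_pos)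
    finally have "fst p + s *\<^sub>R fst v \<in> ball (fst p) \<epsilon>" by (simp add: dist_norm)
    then show ?thesis using \<epsilon>(2) by blast
  qed
  then have "\<forall>s. \<bar>s\<bar> < \<delta> \<longrightarrow> c s \<in> T" by (simp add: T_iff c_def)
  moreover have "(c has_vector_derivative v) (at 0)"
  proof -
    have 1: "((\<lambda>s. fst p + s *\<^sub>R fst v) has_derivative (\<lambda>s. s *\<^sub>R fst v)) (at 0)"
      by (auto intro!: derivative_eq_intros)
    have "((\<lambda>s. u (fst p + s *\<^sub>R fst v)) has_derivative (\<lambda>s. du (fst p) (s *\<^sub>R fst v))) (at 0)"
      using has_derivative_compose[OF 1, of u "du (fst p)"] u_has_derivative[OF x] by simp
    from has_derivative_Pair[OF 1 this] show ?thesis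
      unfolding c_def[abs_def] has_vector_derivative_def
      by (rule has_derivative_eq_rhs) (auto simp: fun_eq_iff du_scaleR prod_eq_iff v)
  qed
  moreover have "c 0 = p" using assms by (simp add: c_def T_iff prod_eq_iff)
  moreover have "\<delta> > 0" using \<epsilon>(1) by (simp add: \<delta>_def add_nonneg_pos)
  ultimately show "v \<in> tangent_space T p"
    unfolding tangent_space_def by blast
qed

lemma unit_normal_T: "unit_normal_field hyp_prod_metric T \<nu>"
  unfolding unit_normal_field_def
proof (intro ballI conjI)
  fix p assume p: "p \<in> T"
  let ?x = "fst p" and ?\<rho> = "plane_dist e (fst p)"
  have x: "?x \<in> hyp" "?\<rho> > a" using p \<Omega>D by (auto simp: T_iff)
  show "hyp_prod_metric p (\<nu> p) (\<nu> p) = 1"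
    using r_square[OF x(2)]
    by (simp add: hyp_prod_metric_def \<nu>_def hyp_metric_simps height_grad_cosh[OF x(1) e] power2_eq_square)
  fix v assume "v \<in> tangent_space T p"
  then have "snd v = du ?x (fst v)" using tangent_space_T[OF p] by simp
  then show "hyp_prod_metric p (\<nu> p) v = 0"
    using r_pos[OF x(2)] by (simp add: hyp_prod_metric_def \<nu>_def hyp_metric_simps du_def)
qed

text \<open>The principal directions are the unit tangent \<open>b\<close> of the generating curve, with curvature \<open>q'\<close>, and the
  horizontal vectors orthogonal to the gradient of the height, with curvature \<open>q tanh \<rho>\<close>. The
  differential equation says that they add up to \<open>(n - 1) \<tau>\<close>.\<close>

lemma mean_curvature_T:
  assumes p: "p \<in> T"
  shows "has_mean_curvature_at hyp_prod_metric T \<nu> p ((real CARD('n) - 1) * \<tau> / real CARD('n))"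
proof -
  define x \<rho> where "x = fst p" and "\<rho> = plane_dist e x"
  define Z where "Z = height_grad e x"
  define S C where "S = sinh \<rho>" and "C = cosh \<rho>"
  define q' where "q' = (real CARD('n) - 1) * (\<tau> - tanh \<rho> * q \<rho>)"
  have x: "x \<in> hyp" "\<rho> > a" using p \<Omega>D by (auto simp: T_iff x_def \<rho>_def)
  have C: "C > 0" by (simp add: C_def)
  have ZZ: "hyp_metric x Z Z = C\<^sup>2" using height_grad_cosh[OF x(1) e] by (simp add: Z_def C_def \<rho>_def)
  have S: "hyp_height e x = S" by (simp add: S_def \<rho>_def sinh_plane_dist)
  have r: "r \<rho> > 0" "(r \<rho>)\<^sup>2 = 1 - (q \<rho>)\<^sup>2" using r_pos[OF x(2)] r_square[OF x(2)] by auto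
  have q: "0 < q \<rho>" "(q \<rho>)\<^sup>2 < 1" using q0[OF x(2)] q1[OF x(2)] by (auto simp: abs_square_less_1)
  define df where "df h = hyp_metric x Z h / C" for h
  have df: "(plane_dist e has_derivative df) (at x)"
    using plane_dist_has_derivative[OF x(1), of e] by (simp add: df_def[abs_def] Z_def C_def \<rho>_def)
  have dq': "(q has_real_derivative q') (at \<rho>)" using dq[OF x(2)] by (simp add: q'_def)
  have d\<alpha>: "((\<lambda>\<rho>. - (q \<rho> / cosh \<rho>)) has_real_derivative - ((q' * C - q \<rho> * S) / C\<^sup>2)) (at \<rho>)"
    using dq' C by (auto intro!: derivative_eq_intros simp: C_def S_def power2_eq_square)
  have dr: "(r has_real_derivative - (q \<rho> * q' / r \<rho>)) (at \<rho>)"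
    unfolding r_def[abs_def] using dq' q(2)
    by (auto intro!: derivative_eq_intros simp: divide_simps)
  define DZ where "DZ h = (e \<bullet> x) *\<^sub>R h + (e \<bullet> h) *\<^sub>R x - (x \<bullet> h) *\<^sub>R e" for h
  define A where "A h = ((- (q \<rho> / C)) *\<^sub>R DZ (fst h) + (df (fst h) * (- ((q' * C - q \<rho> * S) / C\<^sup>2))) *\<^sub>R Z,
     df (fst h) * (- (q \<rho> * q' / r \<rho>)))" for h :: "(real ^ 'n) \<times> real"
  have fst: "(fst has_derivative fst) (at p)" by (rule has_derivative_fst[OF has_derivative_ident])
  have A1: "((\<lambda>x. - (q (plane_dist e x) / cosh (plane_dist e x))) has_derivative
       (\<lambda>h. df h * (- ((q' * C - q \<rho> * S) / C\<^sup>2)))) (at x)"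
    using DERIV_compose_FDERIV[OF d\<alpha>[unfolded \<rho>_def] df] by (simp add: \<rho>_def)
  have A2: "((\<lambda>x. r (plane_dist e x)) has_derivative (\<lambda>h. df h * (- (q \<rho> * q' / r \<rho>)))) (at x)"
    using DERIV_compose_FDERIV[OF dr[unfolded \<rho>_def] df] by (simp add: \<rho>_def)
  have A3: "((\<lambda>x. ((- (q (plane_dist e x) / cosh (plane_dist e x))) *\<^sub>R height_grad e x, r (plane_dist e x))) has_derivative
       (\<lambda>h. ((- (q \<rho> / C)) *\<^sub>R DZ h + (df h * (- ((q' * C - q \<rho> * S) / C\<^sup>2))) *\<^sub>R Z,
     df h * (- (q \<rho> * q' / r \<rho>))))) (at x)"
    using has_derivative_Pair[OF has_derivative_scaleR[OF A1 height_grad_has_derivative[of e x]] A2]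
    by (simp add: DZ_def Z_def \<rho>_def C_def)
  have A: "(\<nu> has_derivative A) (at p within T)"
    unfolding \<nu>_def[abs_def] A_def[abs_def]
    by (rule has_derivative_at_withinI[OF has_derivative_compose[OF fst A3[unfolded x_def]], folded x_def])
  \<comment> \<open>the covariant derivative of the normal, simplified with the Hessian of the height\<close>
  have chr: "A v + christoffel hyp_prod_metric p v (\<nu> p)
      = ((- (q \<rho> * S / C)) *\<^sub>R fst v - (df (fst v) * ((q' * C - q \<rho> * S) / C\<^sup>2)) *\<^sub>R Z, - (df (fst v) * (q \<rho> * q' / r \<rho>)))" for v
  proof -
    have "\<nu> p = ((- (q \<rho> / C)) *\<^sub>R Z, r \<rho>)"
      by (simp only: \<nu>_def x_def \<rho>_def C_def Z_def)
    then have "christoffel hyp_prod_metric p v (\<nu> p) = ((- (q \<rho> / C)) *\<^sub>R christoffel hyp_metric x (fst v) Z, 0)"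
      using christoffel_hyp_prod_metric[of p v "\<nu> p"] x(1)
      by (simp only: x_def[symmetric] fst_conv christoffel_hyp_metric_scaleR(1))
    moreover have "(- (q \<rho> / C)) *\<^sub>R DZ (fst v) + (- (q \<rho> / C)) *\<^sub>R christoffel hyp_metric x (fst v) Z = (- (q \<rho> * S / C)) *\<^sub>R fst v"
      unfolding scaleR_add_right[symmetric] DZ_def Z_def height_hessian[OF x(1)] S by simp
    ultimately show ?thesis by (simp add: A_def algebra_simps)
  qed
  obtain B where B: "finite B" "card B = CARD('n) - 1" "\<And>v. v \<in> B \<Longrightarrow> hyp_metric x Z v = 0"
    "\<And>v w. v \<in> B \<Longrightarrow> w \<in> B \<Longrightarrow> hyp_metric x v w = (if v = w then 1 else 0)"
    using hyp_orthonormal_frame[OF x(1) height_grad_nonzero[OF x(1) e]] unfolding Z_def by blast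
  \<comment> \<open>unit tangent of the generating curve: the gradient direction scaled by \<open>r\<close>, rising by \<open>q\<close>\<close>
  define b where "b = ((r \<rho> / C) *\<^sub>R Z, q \<rho>)"
  define F where "F = insert b ((\<lambda>w. (w, 0)) ` B)"
  \<comment> \<open>the vertical component tells \<open>b\<close> from the horizontal vectors, since \<open>q > 0\<close>\<close>
  define \<kappa> where "\<kappa> v = (if snd v = 0 then q \<rho> * S / C else q')" for v :: "(real ^ 'n) \<times> real"
  have bn: "b \<notin> (\<lambda>w. (w, 0)) ` B" using q(1) by (auto simp: b_def)
  have inj: "inj_on (\<lambda>w. (w, 0::real)) B" by (auto intro: inj_onI)
  have n: "real (CARD('n) - 1) = real CARD('n) - 1" using card by simp
  have cF: "finite F" "card F = CARD('n)"
    using B(1,2) bn card by (simp_all add: F_def card_image[OF inj])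
  have sum: "(\<Sum>v\<in>F. \<kappa> v) = q' + (real CARD('n) - 1) * (q \<rho> * S / C)"
    using B(1,2) bn q(1) by (simp add: F_def sum.reindex[OF inj] \<kappa>_def b_def n)
  have dfb: "df ((r \<rho> / C) *\<^sub>R Z) = r \<rho>" using C by (simp add: df_def hyp_metric_simps ZZ power2_eq_square)
  show ?thesis
    unfolding has_mean_curvature_at_def
  proof (intro exI conjI)
    show "(\<nu> has_derivative A) (at p within T)" by (rule A)
    show "finite F" "card F = DIM((real ^ 'n) \<times> real) - 1" using cF by auto
    have dux: "du x h = q \<rho> / r \<rho> * df h" for h
      by (simp add: du_def df_def \<rho>_def Z_def C_def)
    show "F \<subseteq> tangent_space T p"
      using r(1) B(3) by (auto simp: tangent_space_T[OF p] F_def b_def dux dfb x_def[symmetric])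
        (simp add: df_def)
    show "\<forall>v\<in>F. \<forall>w\<in>F. hyp_prod_metric p v w = (if v = w then 1 else 0)"
    proof -
      have "hyp_prod_metric p b b = 1"
        using C r(2) by (simp add: hyp_prod_metric_def b_def hyp_metric_simps ZZ power2_eq_square flip: x_def)
      moreover have "hyp_prod_metric p b (w, 0) = 0" "hyp_prod_metric p (w, 0) b = 0" if "w \<in> B" for w
        using B(3)[OF that] by (simp_all add: hyp_prod_metric_def b_def hyp_metric_simps hyp_metric_commute[of x w] flip: x_def)
      moreover have "hyp_prod_metric p (v, 0) (w, 0) = (if v = w then 1 else 0)" if "v \<in> B" "w \<in> B" for v w
        using B(4)[OF that] by (simp add: hyp_prod_metric_def flip: x_def)
      ultimately show ?thesis using bn by (auto simp: F_def)
    qed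
    have "A b + christoffel hyp_prod_metric p b (\<nu> p) = - (\<kappa> b *\<^sub>R b)"
    proof -
      have key: "- (q \<rho> * S / C) * (r \<rho> / C) - r \<rho> * ((q' * C - q \<rho> * S) / C\<^sup>2) = - (q' * (r \<rho> / C))"
        using C by (simp add: field_simps power2_eq_square)
      have "(- (q \<rho> * S / C)) *\<^sub>R (r \<rho> / C) *\<^sub>R Z - (r \<rho> * ((q' * C - q \<rho> * S) / C\<^sup>2)) *\<^sub>R Z
          = (- (q' * (r \<rho> / C))) *\<^sub>R Z"
        unfolding scaleR_scaleR scaleR_left_diff_distrib[symmetric] key ..
      then have "A b + christoffel hyp_prod_metric p b (\<nu> p) = ((- (q' * (r \<rho> / C))) *\<^sub>R Z, - (r \<rho> * (q \<rho> * q' / r \<rho>)))"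
        unfolding chr unfolding b_def fst_conv dfb by simp
      then show ?thesis
        using q(1) r(1) by (simp add: b_def \<kappa>_def)
    qed
    moreover have "A (w, 0) + christoffel hyp_prod_metric p (w, 0) (\<nu> p) = - (\<kappa> (w, 0) *\<^sub>R (w, 0))" if "w \<in> B" for w
      using B(3)[OF that] unfolding chr by (simp add: df_def \<kappa>_def)
    ultimately show "\<forall>v\<in>F. A v + christoffel hyp_prod_metric p v (\<nu> p) = - (\<kappa> v *\<^sub>R v)"
      by (auto simp: F_def)
    have "q' + (real CARD('n) - 1) * (q \<rho> * S / C) = (real CARD('n) - 1) * \<tau>"
      by (simp add: q'_def tanh_def S_def C_def algebra_simps)
    then show "(real CARD('n) - 1) * \<tau> / real CARD('n) = (\<Sum>v\<in>F. \<kappa> v) / real (card F)"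
      unfolding sum cF(2) by simp
  qed
qed


section \<open>Smoothness and completeness of the translation graph\<close>

lemma Ck_on_q: "Ck_on k q {a<..}"
proof (induction k)
  case 0
  then show ?case using dq by (auto intro!: continuous_at_imp_continuous_on dest: DERIV_isCont)
next
  case (Suc k)
  show ?case
  proof (rule Ck_on_real_SucI[OF _ dq])
    show "Ck_on k (\<lambda>\<rho>. (real CARD('n) - 1) * (\<tau> - tanh \<rho> * q \<rho>)) {a<..}"
      by (intro Ck_on_mult Ck_on_diff Ck_on_const Suc Ck_on_subset[OF Ck_on_tanh] open_greaterThan) auto
  qed auto
qed

lemma Ck_on_\<mu>: "Ck_on k \<mu> {a<..}"
proof (cases k)
  case 0
  then show ?thesis using d\<mu> by (auto intro!: continuous_at_imp_continuous_on dest: DERIV_isCont)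
next
  case (Suc j)
  have q2: "1 - q \<rho> * q \<rho> > 0" if "\<rho> > a" for \<rho>
    using r_square[OF that] r_pos[OF that] by (metis power2_eq_square zero_less_power)
  show ?thesis unfolding Suc
  proof (rule Ck_on_real_SucI)
    show "(\<mu> has_real_derivative q \<rho> * (1 - q \<rho> * q \<rho>) powr (- (1/2))) (at \<rho>)" if "\<rho> \<in> {a<..}" for \<rho>
      using d\<mu>[of \<rho>] that q2[of \<rho>] by (simp add: powr_minus_divide powr_half_sqrt power2_eq_square)
    show "Ck_on j (\<lambda>\<rho>. q \<rho> * (1 - q \<rho> * q \<rho>) powr (- (1/2))) {a<..}"
      by (intro Ck_on_mult Ck_on_powr_comp Ck_on_diff Ck_on_const Ck_on_q open_greaterThan) (use q2 in auto)
  qed simp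
qed

lemma Ck_on_u: "Ck_on k u \<Omega>"
  unfolding u_def[abs_def]
  by (rule Ck_on_compose[OF open_\<Omega> open_greaterThan Ck_on_\<mu> Ck_on_subset[OF Ck_on_plane_dist]])
    (auto simp: \<Omega>_def)

lemma smooth_T: "smooth_hypersurface T"
proof (rule smooth_hypersurface_level[where U = "fst -` \<Omega>" and \<phi> = "\<lambda>p. snd p - u (fst p)"
      and D = "\<lambda>p v. snd v - du (fst p) (fst v)" and w = "\<lambda>p. (0, 1)"])
  show op: "open (fst -` \<Omega> :: ((real ^ 'n) \<times> real) set)"
    by (rule open_vimage_fst[OF open_\<Omega>])
  show "smooth_on (\<lambda>p. snd p - u (fst p)) (fst -` \<Omega> :: ((real ^ 'n) \<times> real) set)"
    unfolding smooth_on_def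
    by (intro allI Ck_on_diff[OF op] Ck_on_linear[OF op bounded_linear_snd]
        Ck_on_compose_linear[OF bounded_linear_fst open_\<Omega> Ck_on_u])
  show "T = {p \<in> fst -` \<Omega>. snd p - u (fst p) = 0}" by (auto simp: T_iff)
  show "snd (0, 1) - du (fst p) (fst (0 :: real ^ 'n, 1 :: real)) \<noteq> 0" for p :: "(real ^ 'n) \<times> real"
    by (simp add: du_def hyp_metric_simps)
qed (use level_has_derivative in auto)

lemma continuous_du: "continuous_on \<Omega> (\<lambda>x. du x h)"
proof -
  have "continuous_on \<Omega> (\<lambda>x. frechet_derivative u (at x) h)"
    using Ck_on_u[of "Suc 0"] by simp
  then show ?thesis
    by (rule continuous_on_eq) (use frechet_derivative_at[OF u_has_derivative] in metis)
qed

text \<open>The factor by which the graph map can enlarge Euclidean lengths at \<open>x\<close>: the conformal factor of the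
  hyperbolic metric divided by the cosine of the inclination.\<close>

definition "stretch x = 2 / (r (plane_dist e x) * (1 - (norm x)\<^sup>2))"

lemma continuous_stretch: "continuous_on \<Omega> stretch"
proof -
  have "continuous_on {a<..} r"
    using Ck_on_q[of 0] by (simp add: r_def[abs_def] continuous_intros)
  moreover have "continuous_on \<Omega> (plane_dist e)"
    using continuous_plane_dist \<Omega>D(1) by (auto intro: continuous_at_imp_continuous_on)
  ultimately have "continuous_on \<Omega> (\<lambda>x. r (plane_dist e x))"
    by (rule continuous_on_compose2) (auto simp: \<Omega>_def)
  then show ?thesis
    unfolding stretch_def[abs_def]
    using r_pos \<Omega>D norm_square_less_1 by (intro continuous_intros) fastforce+
qed

lemma graph_speed_le:
  assumes "x \<in> \<Omega>"
  shows "sqrt (hyp_metric x h h + (du x h)\<^sup>2) \<le> stretch x * norm h"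
proof -
  define \<rho> where "\<rho> = plane_dist e x"
  have x: "x \<in> hyp" "\<rho> > a" using \<Omega>D[OF assms] by (auto simp: \<rho>_def)
  have r: "r \<rho> > 0" "(r \<rho>)\<^sup>2 = 1 - (q \<rho>)\<^sup>2" using r_pos[OF x(2)] r_square[OF x(2)] by auto
  define G where "G = hyp_metric x h h"
  have G: "G \<ge> 0" using hyp_metric_nonneg[OF x(1)] by (simp add: G_def)
  have "(hyp_metric x (height_grad e x) h / cosh (plane_dist e x))\<^sup>2 \<le> (sqrt G)\<^sup>2"
    using plane_dist_Lipschitz[OF x(1) e, of h] unfolding G_def by (simp add: abs_le_square_iff[symmetric])
  then have "(du x h)\<^sup>2 \<le> (q \<rho> / r \<rho>)\<^sup>2 * G"
    using G unfolding du_def power_mult_distrib \<rho>_def by (intro mult_left_mono) auto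
  then have "G + (du x h)\<^sup>2 \<le> (1 + (q \<rho> / r \<rho>)\<^sup>2) * G" by (simp add: algebra_simps)
  also have "1 + (q \<rho> / r \<rho>)\<^sup>2 = (1 / r \<rho>)\<^sup>2" using r by (simp add: power_divide field_simps)
  also have "(1 / r \<rho>)\<^sup>2 * G = (stretch x * norm h)\<^sup>2"
    by (simp add: stretch_def G_def hyp_metric_def power_mult_distrib power_divide \<rho>_def power2_norm_eq_inner)
  finally have "sqrt (G + (du x h)\<^sup>2) \<le> sqrt ((stretch x * norm h)\<^sup>2)" by (rule real_sqrt_le_mono)
  also have "\<dots> = stretch x * norm h"
    using r(1) norm_square_less_1[OF x(1)] by (simp add: stretch_def \<rho>_def abs_mult)
  finally show ?thesis by (simp add: G_def)
qed

lemma segment_length: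
  assumes seg: "\<And>s. s \<in> {0..1} \<Longrightarrow> y + s *\<^sub>R (x - y) \<in> \<Omega>"
    and M: "\<And>s. s \<in> {0..1} \<Longrightarrow> stretch (y + s *\<^sub>R (x - y)) \<le> M"
  shows "\<exists>L \<in> curve_lengths hyp_prod_metric T (y, u y) (x, u x). L \<le> M * dist y x"
proof -
  define z where "z s = y + s *\<^sub>R (x - y)" for s
  define c where "c s = (z s, u (z s))" for s
  define D where "D s = (x - y, du (z s) (x - y))" for s
  have z: "z s \<in> \<Omega>" if "s \<in> {0..1}" for s using seg[OF that] by (simp add: z_def)
  have zc: "continuous_on {0..1} z" unfolding z_def by (intro continuous_intros)
  have duc: "continuous_on {0..1} (\<lambda>s. du (z s) (x - y))"
    using z by (intro continuous_on_compose2[OF continuous_du zc]) auto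
  have sp: "hyp_prod_metric (c s) (D s) (D s) = hyp_metric (z s) (x - y) (x - y) + (du (z s) (x - y))\<^sup>2" for s
    by (simp add: hyp_prod_metric_def c_def D_def power2_eq_square)
  have spc: "continuous_on {0..1} (\<lambda>s. hyp_prod_metric (c s) (D s) (D s))"
  proof -
    have "(1 - (norm (z s))\<^sup>2)\<^sup>2 \<noteq> 0" if "s \<in> {0..1}" for s
      using norm_square_less_1[OF \<Omega>D(1)[OF z[OF that]]] by simp
    then show ?thesis
      unfolding sp hyp_metric_def by (intro continuous_intros zc duc) auto
  qed
  have len: "integral {0..1} (\<lambda>s. sqrt (hyp_prod_metric (c s) (D s) (D s))) \<in> curve_lengths hyp_prod_metric T (c 0) (c 1)"
  proof (rule C1_curve_length[where c = c and D = D and g = hyp_prod_metric, OF _ _ _ spc])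
    fix s :: real assume s: "s \<in> {0..1}"
    have 1: "(z has_derivative (\<lambda>k. k *\<^sub>R (x - y))) (at s)"
      unfolding z_def[abs_def] by (auto intro!: derivative_eq_intros)
    show "(c has_vector_derivative D s) (at s)"
      using has_derivative_Pair[OF 1 has_derivative_compose[OF 1 u_has_derivative[OF z[OF s]]]]
      unfolding c_def[abs_def] has_vector_derivative_def
      by (rule has_derivative_eq_rhs) (simp add: fun_eq_iff D_def du_scaleR)
    show "c s \<in> T" using z[OF s] by (simp add: c_def T_iff)
  next
    show "continuous_on {0..1} D" unfolding D_def by (intro continuous_intros duc)
  qed
  have "integral {0..1} (\<lambda>s. sqrt (hyp_prod_metric (c s) (D s) (D s))) \<le> integral {0..1} (\<lambda>s::real. M * dist y x)"
  proof (rule integral_le)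
    show "(\<lambda>s. sqrt (hyp_prod_metric (c s) (D s) (D s))) integrable_on {0..1}"
      by (intro integrable_continuous_real continuous_intros spc)
    show "sqrt (hyp_prod_metric (c s) (D s) (D s)) \<le> M * dist y x" if "s \<in> {0..1}" for s
    proof -
      have "stretch (z s) * norm (x - y) \<le> M * norm (x - y)"
        using M[OF that] by (intro mult_right_mono) (auto simp: z_def)
      then show ?thesis
        using graph_speed_le[OF z[OF that], of "x - y"] by (simp add: sp dist_norm norm_minus_commute)
    qed
  qed auto
  then show ?thesis using len by (auto simp: c_def z_def)
qed

text \<open>On a compact ball inside \<open>\<Omega>\<close> the stretching factor is bounded, and the graph over a segment
  connects the two points.\<close>

lemma local_length_bound:
  assumes "x \<in> \<Omega>"
  shows "\<exists>M \<delta>. \<delta> > 0 \<and> M \<ge> 0 \<and> ball x \<delta> \<subseteq> \<Omega> \<and> (\<forall>y. dist y x < \<delta> \<longrightarrow>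
    (\<exists>L \<in> curve_lengths hyp_prod_metric T (y, u y) (x, u x). L \<le> M * dist y x))"
proof -
  obtain \<delta> where \<delta>: "\<delta> > 0" "cball x \<delta> \<subseteq> \<Omega>"
    using open_\<Omega> assms open_contains_cball by blast
  have "\<exists>w\<in>cball x \<delta>. \<forall>y\<in>cball x \<delta>. stretch y \<le> stretch w"
    using \<delta> continuous_on_subset[OF continuous_stretch \<delta>(2)]
    by (intro continuous_attains_sup) auto
  then obtain w where w: "\<And>y. y \<in> cball x \<delta> \<Longrightarrow> stretch y \<le> stretch w" by blast
  show ?thesis
  proof (rule exI[of _ "\<bar>stretch w\<bar>"], rule exI[of _ \<delta>], intro conjI allI impI)
    fix y assume y: "dist y x < \<delta>"
    have "y + s *\<^sub>R (x - y) \<in> cball x \<delta>" if "s \<in> {0..1}" for s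
      using convexD_alt[OF convex_cball, of y x \<delta> x s] y \<delta>(1) that
      by (simp add: algebra_simps dist_commute)
    then show "\<exists>L \<in> curve_lengths hyp_prod_metric T (y, u y) (x, u x). L \<le> \<bar>stretch w\<bar> * dist y x"
      using \<delta>(2) w by (intro segment_length) (blast, meson abs_ge_self order_trans)
  qed (use \<delta> ball_subset_cball in \<open>auto dest: subsetD\<close>)
qed

text \<open>Points over a small ball are joined by the graph over a segment; connectedness of \<open>\<Omega>\<close> does the rest.\<close>

lemma curve_lengths_T_nonempty:
  assumes "p \<in> T" "p' \<in> T" shows "curve_lengths hyp_prod_metric T p p' \<noteq> {}"
proof -
  define R where "R x y \<longleftrightarrow> curve_lengths hyp_prod_metric T (x, u x) (y, u y) \<noteq> {}" for x y
  have neg: "hyp_prod_metric x (- v) (- v) = hyp_prod_metric x v v" for x v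
    using hyp_prod_metric_scaleR[of x "-1" v] by simp
  have sym: "R y x" if "R x y" for x y
    using that curve_lengths_reverse[where g = hyp_prod_metric, OF neg] unfolding R_def by blast
  have "R (fst p) (fst p')"
  proof (rule connected_equivalence_relation[of \<Omega> "fst p" "fst p'" R])
    show "connected \<Omega>" unfolding \<Omega>_def by (rule connected_plane_dist_greater)
    show "R x z" if "R x y" "R y z" for x y z
      using that curve_lengths_nonempty_trans[where g = hyp_prod_metric, OF hyp_prod_metric_scaleR]
      unfolding R_def by blast
    fix x assume x: "x \<in> \<Omega>"
    obtain M \<delta> where b: "\<delta> > 0" "M \<ge> 0" "ball x \<delta> \<subseteq> \<Omega>"
      "\<And>y. dist y x < \<delta> \<Longrightarrow> \<exists>L \<in> curve_lengths hyp_prod_metric T (y, u y) (x, u x). L \<le> M * dist y x"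
      using local_length_bound[OF x] by blast
    show "\<exists>V. openin (top_of_set \<Omega>) V \<and> x \<in> V \<and> (\<forall>y\<in>V. R x y)"
    proof (intro exI[of _ "ball x \<delta>"] conjI ballI)
      show "openin (top_of_set \<Omega>) (ball x \<delta>)" using b(3) by (simp add: open_openin_trans open_\<Omega>)
      fix y assume "y \<in> ball x \<delta>"
      then have "R y x" using b(4)[of y] by (auto simp: R_def dist_commute)
      then show "R x y" by (rule sym)
    qed (use b in auto)
  qed (use assms sym in \<open>auto simp: T_iff\<close>)
  moreover have "(fst p, u (fst p)) = p" "(fst p', u (fst p')) = p'"
    using assms by (auto simp: T_iff prod_eq_iff)
  ultimately show ?thesis by (simp add: R_def)
qed

text \<open>A Cauchy sequence has a Euclidean limit. The function \<open>- ln (1 - |x|\<^sup>2)\<close> stays bounded along it, so the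
  limit is not over the boundary sphere; the vertical coordinate converges, so the limit is not over
  \<open>plane_dist e = a\<close>, where \<open>\<mu>\<close> tends to minus infinity.\<close>

lemma Cauchy_in_T_converges:
  assumes \<sigma>: "range \<sigma> \<subseteq> T"
    and Cau: "\<And>\<epsilon>. \<epsilon> > 0 \<Longrightarrow> \<exists>N. \<forall>m\<ge>N. \<forall>n\<ge>N. riem_dist hyp_prod_metric T (\<sigma> m) (\<sigma> n) < \<epsilon>"
  shows "\<exists>l\<in>T. \<sigma> \<longlonglongrightarrow> l"
proof -
  let ?d = "riem_dist hyp_prod_metric T"
  have T: "\<sigma> n \<in> T" for n using \<sigma> by blast
  have \<sigma>\<Omega>: "fst (\<sigma> n) \<in> \<Omega>" "snd (\<sigma> n) = u (fst (\<sigma> n))" for n using T[of n] by (auto simp: T_iff)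
  have pos: "(norm v)\<^sup>2 \<le> hyp_prod_metric p v v" if "p \<in> T" for p v
    using that hyp_prod_metric_ge[of p v] \<Omega>D(1) T_iff by blast
  have "dist (\<sigma> m) (\<sigma> n) \<le> ?d (\<sigma> m) (\<sigma> n)" for m n
    by (rule riem_dist_ge[OF curve_lengths_T_nonempty[OF T T]])
      (rule euclidean_dist_le_length[where g = hyp_prod_metric and S = T, OF pos])
  then have "Cauchy \<sigma>"
    unfolding Cauchy_def using Cau by (meson le_less_trans)
  then obtain l where l: "\<sigma> \<longlonglongrightarrow> l"
    using Cauchy_convergent_iff convergent_def by blast
  have l1: "(\<lambda>n. fst (\<sigma> n)) \<longlonglongrightarrow> fst l" and l2: "(\<lambda>n. u (fst (\<sigma> n))) \<longlonglongrightarrow> snd l"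
    using tendsto_fst[OF l] tendsto_snd[OF l] by (simp_all add: \<sigma>\<Omega>(2))
  define F where "F p = - ln (1 - fst p \<bullet> fst p)" for p :: "(real ^ 'n) \<times> real"
  have F: "\<bar>F p' - F p\<bar> \<le> ?d p p'" if "p \<in> T" "p' \<in> T" for p p'
  proof (rule riem_dist_ge[OF curve_lengths_T_nonempty[OF that]])
    fix L assume L: "L \<in> curve_lengths hyp_prod_metric T p p'"
    show "\<bar>F p' - F p\<bar> \<le> L"
    proof (rule curve_length_ge[OF L, where F' = "\<lambda>p v. 2 * (fst p \<bullet> fst v) / (1 - (norm (fst p))\<^sup>2)"])
      fix y :: "(real ^ 'n) \<times> real" and v :: "(real ^ 'n) \<times> real" assume y: "y \<in> T"
      have yh: "fst y \<in> hyp" using y \<Omega>D(1) by (simp add: T_iff)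
      show "(F has_derivative (\<lambda>v. 2 * (fst y \<bullet> fst v) / (1 - (norm (fst y))\<^sup>2))) (at y)"
        unfolding F_def[abs_def]
        by (rule has_derivative_compose[OF has_derivative_fst[OF has_derivative_ident] neg_log_has_derivative(1)[OF yh]])
      have "sqrt (hyp_metric (fst y) (fst v) (fst v)) \<le> sqrt (hyp_prod_metric y v v)"
        by (simp add: hyp_prod_metric_def)
      then show "\<bar>2 * (fst y \<bullet> fst v) / (1 - (norm (fst y))\<^sup>2)\<bar> \<le> sqrt (hyp_prod_metric y v v)"
        using neg_log_has_derivative(2)[OF yh, of "fst v"] by linarith
    qed
  qed
  obtain N where N: "\<And>m n. m \<ge> N \<Longrightarrow> n \<ge> N \<Longrightarrow> ?d (\<sigma> m) (\<sigma> n) < 1"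
    using Cau[of 1] by auto
  define \<eta> where "\<eta> = exp (- (F (\<sigma> N) + 1))"
  have "\<eta> \<le> 1 - fst (\<sigma> n) \<bullet> fst (\<sigma> n)" if "n \<ge> N" for n
  proof -
    have p: "1 - fst (\<sigma> n) \<bullet> fst (\<sigma> n) > 0"
      using norm_square_less_1[OF \<Omega>D(1)[OF \<sigma>\<Omega>(1)]] by (simp add: power2_norm_eq_inner)
    have "F (\<sigma> n) \<le> F (\<sigma> N) + 1"
      using F[OF T T, of n N] N[of N n] that by linarith
    then have "- (F (\<sigma> N) + 1) \<le> ln (1 - fst (\<sigma> n) \<bullet> fst (\<sigma> n))" by (simp add: F_def)
    then show ?thesis unfolding \<eta>_def using p by (simp add: ln_ge_iff)
  qed
  moreover have "(\<lambda>n. 1 - fst (\<sigma> n) \<bullet> fst (\<sigma> n)) \<longlonglongrightarrow> 1 - fst l \<bullet> fst l"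
    by (intro tendsto_intros l1)
  ultimately have "\<eta> \<le> 1 - fst l \<bullet> fst l"
    by (intro LIMSEQ_le_const) auto
  then have "(norm (fst l))\<^sup>2 < 1"
    using exp_gt_zero[of "- (F (\<sigma> N) + 1)"] unfolding power2_norm_eq_inner \<eta>_def by linarith
  then have lh: "fst l \<in> hyp" by (simp add: abs_square_less_1)
  have \<rho>: "(\<lambda>n. plane_dist e (fst (\<sigma> n))) \<longlonglongrightarrow> plane_dist e (fst l)"
    using isCont_tendsto_compose[OF continuous_plane_dist[OF lh] l1] .
  have ge: "plane_dist e (fst l) \<ge> a"
    using \<Omega>D(2)[OF \<sigma>\<Omega>(1)] by (intro LIMSEQ_le_const[OF \<rho>]) (auto intro: less_imp_le)
  have "plane_dist e (fst l) \<noteq> a"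
  proof
    assume eq: "plane_dist e (fst l) = a"
    have "filterlim (\<lambda>n. plane_dist e (fst (\<sigma> n))) (at_right a) sequentially"
      unfolding filterlim_at using \<rho> eq \<Omega>D(2)[OF \<sigma>\<Omega>(1)] by (auto simp: less_imp_neq[symmetric])
    from filterlim_compose[OF \<mu>_bot this]
    have "filterlim (\<lambda>n. u (fst (\<sigma> n))) at_bot sequentially" by (simp add: u_def)
    then have "\<forall>\<^sub>F n in sequentially. u (fst (\<sigma> n)) \<le> snd l - 1" by (simp add: filterlim_at_bot)
    moreover have "\<forall>\<^sub>F n in sequentially. u (fst (\<sigma> n)) > snd l - 1"
      using order_tendstoD(1)[OF l2] by simp
    ultimately have "\<forall>\<^sub>F n in sequentially. False" by eventually_elim simp
    then show False by simp
  qed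
  then have l\<Omega>: "fst l \<in> \<Omega>" using ge lh by (simp add: \<Omega>_def)
  have "(\<lambda>n. u (fst (\<sigma> n))) \<longlonglongrightarrow> u (fst l)"
    using isCont_tendsto_compose[OF has_derivative_continuous[OF u_has_derivative[OF l\<Omega>]] l1] .
  then have "snd l = u (fst l)" using l2 LIMSEQ_unique by blast
  then show ?thesis using l l\<Omega> T_iff by blast
qed

lemma complete_T: "complete_induced_metric hyp_prod_metric T"
proof (rule complete_induced_metricI[where g = hyp_prod_metric, OF hyp_prod_metric_scaleR])
  have pos: "0 \<le> hyp_prod_metric p v v" if "p \<in> T" for p v
    using that hyp_prod_metric_ge[of p v] \<Omega>D(1) T_iff by (meson order_trans zero_le_power2)
  show "(norm v)\<^sup>2 \<le> hyp_prod_metric p v v" if "p \<in> T" for p v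
    using that hyp_prod_metric_ge[of p v] \<Omega>D(1) T_iff by blast
  show "\<exists>C \<delta>. \<delta> > 0 \<and> (\<forall>p'\<in>T. dist p' p < \<delta> \<longrightarrow> riem_dist hyp_prod_metric T p' p \<le> C * dist p' p)" if p: "p \<in> T" for p
  proof -
    obtain M \<delta> where b: "\<delta> > 0" "M \<ge> 0"
      "\<And>y. dist y (fst p) < \<delta> \<Longrightarrow> \<exists>L \<in> curve_lengths hyp_prod_metric T (y, u y) (fst p, u (fst p)). L \<le> M * dist y (fst p)"
      using local_length_bound[of "fst p"] p unfolding T_iff by blast
    have "riem_dist hyp_prod_metric T p' p \<le> M * dist p' p" if p': "p' \<in> T" "dist p' p < \<delta>" for p'
    proof -
      have le: "dist (fst p') (fst p) \<le> dist p' p" by (rule dist_fst_le)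
      have "p' = (fst p', u (fst p'))" "p = (fst p, u (fst p))"
        using p p'(1) by (auto simp: T_iff prod_eq_iff)
      then obtain L where L: "L \<in> curve_lengths hyp_prod_metric T p' p" "L \<le> M * dist (fst p') (fst p)"
        using b(3)[of "fst p'"] le p'(2) by (metis le_less_trans)
      have "riem_dist hyp_prod_metric T p' p \<le> L"
        by (rule riem_dist_le[where g = hyp_prod_metric, OF pos L(1)])
      also have "\<dots> \<le> M * dist p' p" using L(2) mult_left_mono[OF le b(2)] by linarith
      finally show ?thesis .
    qed
    then show ?thesis using b(1) by blast
  qed
qed (use curve_lengths_T_nonempty Cauchy_in_T_converges in blast)+


section \<open>Infinite boundary values\<close>

lemma strict_mono_\<mu>: "strict_mono_on {a<..} \<mu>"
proof (rule strict_mono_onI)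
  fix x y assume xy: "x \<in> {a<..}" "y \<in> {a<..}" "x < y"
  show "\<mu> x < \<mu> y"
  proof (rule DERIV_pos_imp_increasing[OF xy(3)])
    fix z assume "x \<le> z" "z \<le> y"
    then have "z > a" using xy by simp
    then show "\<exists>d. (\<mu> has_real_derivative d) (at z) \<and> 0 < d"
      using d\<mu>[of z] q0[of z] r_pos[of z] by (auto simp: r_def intro!: exI[of _ "q z / sqrt (1 - (q z)\<^sup>2)"])
  qed
qed

lemma u_boundary:
  assumes "p \<in> hyp" "plane_dist e p = a"
  shows "filterlim (\<lambda>x. \<bar>u x\<bar>) at_top (at p within \<Omega>)"
proof -
  have "(plane_dist e \<longlongrightarrow> a) (at p within \<Omega>)"
    using continuous_plane_dist[OF assms(1), of e] assms(2)
    by (metis continuous_within tendsto_within_subset subset_UNIV isCont_def)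
  moreover have "\<forall>\<^sub>F x in at p within \<Omega>. plane_dist e x \<in> {a<..} \<and> plane_dist e x \<noteq> a"
    by (auto simp: eventually_at_filter \<Omega>_def)
  ultimately have "filterlim (plane_dist e) (at_right a) (at p within \<Omega>)"
    by (simp add: filterlim_at)
  from filterlim_compose[OF \<mu>_bot this] have "filterlim (\<lambda>x. - u x) at_top (at p within \<Omega>)"
    by (simp add: u_def filterlim_uminus_at_bot)
  then show ?thesis by (rule filterlim_at_top_mono) (rule always_eventually, simp add: abs_ge_minus_self)
qed

text \<open>The height has the positive numerator \<open>2 (e \<bullet> \<omega>)\<close> in the limit, while its denominator tends to
  0 from above.\<close>

lemma u_asymptotic:
  assumes "norm \<omega> = 1" "e \<bullet> \<omega> > 0"
  shows "filterlim (\<lambda>x. \<bar>u x\<bar>) at_top (at \<omega> within \<Omega>)"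
proof -
  have "((\<lambda>x. 1 - (norm x)\<^sup>2) \<longlongrightarrow> 1 - (norm \<omega>)\<^sup>2) (at \<omega> within \<Omega>)"
    by (intro tendsto_intros)
  moreover have "\<forall>\<^sub>F x in at \<omega> within \<Omega>. 1 - (norm x)\<^sup>2 \<in> {0<..} \<and> 1 - (norm x)\<^sup>2 \<noteq> 0"
    unfolding eventually_at_filter
    by (rule always_eventually) (use norm_square_less_1[OF \<Omega>D(1)] in fastforce)
  ultimately have "filterlim (\<lambda>x. 1 - (norm x)\<^sup>2) (at_right 0) (at \<omega> within \<Omega>)"
    using assms(1) by (simp add: filterlim_at)
  then have inv: "filterlim (\<lambda>x. inverse (1 - (norm x)\<^sup>2)) at_top (at \<omega> within \<Omega>)"
    by (rule filterlim_compose[OF filterlim_inverse_at_top_right])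
  have "((\<lambda>x. 2 * (e \<bullet> x)) \<longlongrightarrow> 2 * (e \<bullet> \<omega>)) (at \<omega> within \<Omega>)"
    by (intro tendsto_intros)
  from filterlim_tendsto_pos_mult_at_top[OF this _ inv]
  have "filterlim (hyp_height e) at_top (at \<omega> within \<Omega>)"
    using assms(2) by (simp add: hyp_height_def[abs_def] divide_inverse)
  from filterlim_compose[OF arsinh_real_at_top this]
  have "filterlim (plane_dist e) at_top (at \<omega> within \<Omega>)" by (simp add: plane_dist_def[abs_def])
  from filterlim_compose[OF \<mu>_top this] have "filterlim u at_top (at \<omega> within \<Omega>)"
    by (simp add: u_def[abs_def])
  then show ?thesis by (rule filterlim_at_top_mono) (rule always_eventually, rule allI, rule abs_ge_self)
qed

end


section \<open>Existence\<close>

theorem theorem2p5: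
  fixes H :: real and \<gamma> :: "real \<Rightarrow> real ^ 'n"
  assumes "CARD('n) \<ge> 2"
    and "0 < H" and "H < (real CARD('n) - 1) / real CARD('n)"
    and "geodesic_through_0 \<gamma>"
  shows "\<exists>T \<Gamma> \<Omega> u a \<mu>.
      T = translation_hypersurface \<gamma> {a<..} \<mu>
    \<and> smooth_hypersurface T
    \<and> complete_induced_metric hyp_prod_metric T
    \<and> (\<exists>\<nu>. (\<forall>p\<in>T. snd (\<nu> p) > 0) \<and> has_constant_mean_curvature hyp_prod_metric T \<nu> H)
    \<and> \<Gamma> = equidistant \<gamma> a
    \<and> smooth_hypersurface \<Gamma>
    \<and> (\<exists>\<xi>. has_constant_mean_curvature hyp_metric \<Gamma> \<xi>
           (real CARD('n) * H / (real CARD('n) - 1)))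
    \<and> non_mean_convex_side \<Gamma> \<Omega>
    \<and> T = graph_over \<Omega> u
    \<and> (\<forall>x\<in>\<Omega>. a < signed_dist \<gamma> x \<and> u x = \<mu> (signed_dist \<gamma> x))
    \<and> strictly_monotone_on {a<..} \<mu>
    \<and> (\<forall>p\<in>\<Gamma>. filterlim (\<lambda>x. \<bar>u x\<bar>) at_top (at p within \<Omega>))
    \<and> (\<forall>\<omega>\<in>asymptotic_boundary \<Omega> - asymptotic_boundary \<Gamma>.
           filterlim (\<lambda>x. \<bar>u x\<bar>) at_top (at \<omega> within \<Omega>))
    \<and> filterlim (\<lambda>\<rho>. \<bar>\<mu> \<rho>\<bar>) at_top at_top"
proof -
  define N where "N = CARD('n) - 1"
  define \<tau> where "\<tau> = real CARD('n) * H / (real CARD('n) - 1)"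
  have N: "N \<ge> 1" "real N = real CARD('n) - 1" using assms(1) by (auto simp: N_def)
  have \<tau>: "0 < \<tau>" "\<tau> < 1" using assms(1-3) by (simp_all add: \<tau>_def field_simps)
  \<comment> \<open>the bound on \<open>H\<close> says exactly that \<open>\<tau>\<close> is a value of \<open>tanh\<close>\<close>
  obtain a where a: "tanh a = \<tau>" using tanh_surj[of \<tau>] \<tau> by auto
  have a0: "a > 0" using a \<tau>(1) by (metis tanh_real_pos_iff)
  obtain e where e: "norm e = 1" and \<gamma>: "\<gamma> = (\<lambda>s. tanh (s/2) *\<^sub>R e)"
    using geodesic_through_0_radial[OF assms(4)] .
  obtain q :: "real \<Rightarrow> real" where q:
    "\<And>\<rho>. \<rho> > a \<Longrightarrow> (q has_real_derivative N * (\<tau> - tanh \<rho> * q \<rho>)) (at \<rho>)"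
    "\<And>\<rho>. \<rho> > a \<Longrightarrow> \<tau> \<le> q \<rho>" "\<And>\<rho>. \<rho> > a \<Longrightarrow> q \<rho> < 1"
    "\<And>\<rho>. \<rho> > a \<Longrightarrow> 1 - q \<rho> \<le> N * (\<rho> - a)\<^sup>2"
    using sine_profile_exists[OF N(1) \<tau> a] by blast
  obtain \<mu> where \<mu>: "\<And>\<rho>. \<rho> > a \<Longrightarrow> (\<mu> has_real_derivative q \<rho> / sqrt (1 - (q \<rho>)\<^sup>2)) (at \<rho>)"
    "filterlim \<mu> at_bot (at_right a)" "filterlim \<mu> at_top at_top"
    using profile_exists[of a q "real N" \<tau>] DERIV_isCont[OF q(1)] N(1) \<tau>(1) q(2-4) by auto
  interpret translation_graph e a \<tau> q \<mu>
    by unfold_locales (use assms(1) e q \<mu> \<tau>(1) N(2) in \<open>auto intro: less_le_trans\<close>)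
  let ?G = "{x \<in> hyp. plane_dist e x = a}"
  have sd: "signed_dist \<gamma> x = plane_dist e x" if "x \<in> hyp" for x
    unfolding \<gamma> by (rule signed_dist_radial[OF assms(1) e that])
  have G: "?G = equidistant \<gamma> a" using sd by (auto simp: equidistant_def)
  have T: "T = translation_hypersurface \<gamma> {a<..} \<mu>"
    unfolding \<gamma> translation_hypersurface_eq_graph[OF assms(1) e] T_def \<Omega>_def u_def[abs_def] by simp
  have "(real CARD('n) - 1) * \<tau> / real CARD('n) = H" using N by (simp add: \<tau>_def)
  then have "has_constant_mean_curvature hyp_prod_metric T \<nu> H"
    using unit_normal_T mean_curvature_T by (simp add: has_constant_mean_curvature_def)
  moreover have "\<forall>p\<in>T. snd (\<nu> p) > 0"
    using r_pos \<Omega>D(2) by (auto simp: T_iff \<nu>_def)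
  ultimately have \<nu>: "\<exists>\<nu>. (\<forall>p\<in>T. snd (\<nu> p) > 0) \<and> has_constant_mean_curvature hyp_prod_metric T \<nu> H"
    by blast
  have \<xi>: "\<exists>\<xi>. has_constant_mean_curvature hyp_metric ?G \<xi> (real CARD('n) * H / (real CARD('n) - 1))"
    using equidistant_mean_curvature[OF assms(1) e, of a] unfolding a \<tau>_def by blast
  have side: "non_mean_convex_side ?G \<Omega>"
    unfolding \<Omega>_def by (rule non_mean_convex_side_equidistant[OF assms(1) e a0])
  have u: "\<forall>x\<in>\<Omega>. a < signed_dist \<gamma> x \<and> u x = \<mu> (signed_dist \<gamma> x)"
    using \<Omega>D sd by (simp add: u_def)
  have mono: "strictly_monotone_on {a<..} \<mu>"
    using strict_mono_\<mu> by (simp add: strictly_monotone_on_def)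
  have bd: "\<forall>p\<in>?G. filterlim (\<lambda>x. \<bar>u x\<bar>) at_top (at p within \<Omega>)"
    using u_boundary by blast
  have asy: "\<forall>\<omega>\<in>asymptotic_boundary \<Omega> - asymptotic_boundary ?G.
           filterlim (\<lambda>x. \<bar>u x\<bar>) at_top (at \<omega> within \<Omega>)"
  proof
    fix \<omega> assume \<omega>: "\<omega> \<in> asymptotic_boundary \<Omega> - asymptotic_boundary ?G"
    have 1: "norm \<omega> = 1" "e \<bullet> \<omega> \<ge> 0"
      using asymptotic_boundary_positive_side[of \<omega> a e] \<omega> a0 by (simp_all add: \<Omega>_def)
    \<comment> \<open>points with \<open>e \<bullet> \<omega> = 0\<close> belong to the asymptotic boundary of the equidistant hypersurface\<close>
    have "e \<bullet> \<omega> \<noteq> 0" using asymptotic_boundary_equidistant[OF e 1(1)] \<omega> by blast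
    then show "filterlim (\<lambda>x. \<bar>u x\<bar>) at_top (at \<omega> within \<Omega>)" using u_asymptotic 1 by simp
  qed
  have inf: "filterlim (\<lambda>\<rho>. \<bar>\<mu> \<rho>\<bar>) at_top at_top"
    using \<mu>(3) by (rule filterlim_at_top_mono) (rule always_eventually, rule allI, rule abs_ge_self)
  show ?thesis
    by (rule exI[of _ T], rule exI[of _ ?G], rule exI[of _ \<Omega>], rule exI[of _ u], rule exI[of _ a],
        rule exI[of _ \<mu>])
      (intro conjI T smooth_T complete_T \<nu> G smooth_hypersurface_equidistant[OF e] \<xi> side T_def u mono bd asy inf)
qed

end
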